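(* Let $(X,Y)$ be a continuous bivariate random vector with joint density and joint cumulant generating function $\mathcal K_{X,Y}(\gamma,\eta)$ finite on an open neighbourhood of the origin; let $\overline X,\overline Y$ be the means of $n$ i.i.d. copies. Let $a\in\mathbb R$ be such that the saddlepoint $\hat\eta$ solving $\mathcal K_Y'(\eta)=a$ exists, suppose $\mathcal K_\gamma(\eta)$ is analytic in a neighbourhood of $\hat\eta$ and $Y$ is continuous at $a$. If $\hat\eta\neq0$, then as $n\to\infty$ $$\mathsf E[\overline X\mid\overline Y\ge a]=\mathsf E[X]+\frac{1}{\mathsf P[\overline Y\ge a]}\frac{e^{n(\mathcal K_Y(\hat\eta)-\hat\eta a)}}{\sqrt{2\pi n}}\Big\{\frac{\mathcal K_\gamma(\hat\eta)-\mathcal K_\gamma(0)}{\hat z}+\frac1n\Big[\frac{\mathcal K_\gamma(\hat\eta)-\mathcal K_\gamma(0)}{\hat z}\Big(\frac{\hat\rho_4}{8}-\frac{5\hat\rho_3^2}{24}-\frac{\hat\rho_3}{2\hat z}-\frac{1}{\hat z^2}\Big)+\frac{1}{\hat z\sqrt{\mathcal K_Y''(\hat\eta)}}\Big(\frac{\hat\rho_3}{2}+\frac1{\hat z}\Big)\mathcal K_\gamma'(\hat\eta)-\frac{1}{2\hat z\mathcal K_Y''(\hat\eta)}\mathcal K_\gamma''(\hat\eta)\Big]+O(n^{-2})\Big\},$$ where $\hat z=\hat\eta\sqrt{\mathcal K_Y''(\hat\eta)}$. If $\hat\eta=0$, then $$\mathsf E[\overline X\mid\overline Y\ge a]=\mathsf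 E[X]+\frac{\mathcal K_\gamma'(0)}{\sqrt{2\pi n\,\mathcal K_Y''(0)}\;\mathsf P[\overline Y\ge a]}+O(n^{-3/2}).$$
   Context: $\mathcal K_Y(\eta)=\mathcal K_{X,Y}(0,\eta)$ is the CGF of $Y$; $\mathcal K_\gamma(\eta)=\frac{\partial}{\partial\gamma}\mathcal K_{X,Y}(\gamma,\eta)|_{\gamma=0}$ (so $\mathcal K_\gamma(0)=\mathsf E[X]$), with $\mathcal K_\gamma',\mathcal K_\gamma''$ its derivatives in $\eta$. $\hat\rho_r=\mathcal K_Y^{(r)}(\hat\eta)/\mathcal K_Y''(\hat\eta)^{r/2}$. *)

theory Defs
  imports "HOL-Probability.Probability" "HOL-Library.Landau_Symbols"
begin

definition joint_cgf :: "'a measure \<Rightarrow> ('a \<Rightarrow> real) \<Rightarrow> ('a \<Rightarrow> real) \<Rightarrow> real \<Rightarrow> real \<Rightarrow> real" where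
  "joint_cgf M U V g e = ln (integral\<^sup>L M (\<lambda>\<omega>. exp (g * U \<omega> + e * V \<omega>)))"

definition cgf_Y :: "'a measure \<Rightarrow> ('a \<Rightarrow> real) \<Rightarrow> ('a \<Rightarrow> real) \<Rightarrow> real \<Rightarrow> real" where
  "cgf_Y M U V e = joint_cgf M U V 0 e"

definition cgf_gamma :: "'a measure \<Rightarrow> ('a \<Rightarrow> real) \<Rightarrow> ('a \<Rightarrow> real) \<Rightarrow> real \<Rightarrow> real" where
  "cgf_gamma M U V e = deriv (\<lambda>g. joint_cgf M U V g e) 0"

definition sample_mean :: "(nat \<Rightarrow> 'a \<Rightarrow> real) \<Rightarrow> nat \<Rightarrow> 'a \<Rightarrow> real" where
  "sample_mean Z n \<omega> = (\<Sum>i<n. Z i \<omega>) / real n"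

definition cond_exp_ge :: "'a measure \<Rightarrow> ('a \<Rightarrow> real) \<Rightarrow> ('a \<Rightarrow> real) \<Rightarrow> real \<Rightarrow> real" where
  "cond_exp_ge M U V a =
     integral\<^sup>L M (\<lambda>\<omega>. U \<omega> * indicator {\<omega>. a \<le> V \<omega>} \<omega>) / measure M {\<omega> \<in> space M. a \<le> V \<omega>}"

definition real_analytic_at :: "(real \<Rightarrow> real) \<Rightarrow> real \<Rightarrow> bool" where
  "real_analytic_at f x \<longleftrightarrow> (\<exists>\<delta>>0. \<exists>c::nat \<Rightarrow> real.
      \<forall>y. \<bar>y - x\<bar> < \<delta> \<longrightarrow> (\<lambda>k. c k * (y - x) ^ k) sums f y)"

definition std_cumulant :: "(real \<Rightarrow> real) \<Rightarrow> nat \<Rightarrow> real \<Rightarrow> real" where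
  "std_cumulant K r e = (deriv ^^ r) K e / ((deriv ^^ 2) K e) powr (real r / 2)"

end

theory Submission
  imports Defs "HOL-Complex_Analysis.Complex_Analysis"
begin

text \<open>Write \<open>T = (\<Sum>i<n. Y i - a)\<close> and \<open>U = X - E[X]\<close>. The numerator of \<open>E[mean X | mean Y \<ge> a] - E[X]\<close> is an
  average of the terms \<open>E[U i; T \<ge> 0]\<close>, and Fourier inversion on the line \<open>Re s = \<eta>\<close> represents each
  of them as the integral of \<open>exp (n (K s - s a)) (K\<^sub>\<gamma> s - K\<^sub>\<gamma> 0) / s\<close> over \<open>2 \<pi> \<i>\<close>. The singularity at
  \<open>s = 0\<close> is removable, so the cases \<open>\<eta> > 0\<close>, \<open>\<eta> < 0\<close> and \<open>\<eta> = 0\<close> are treated at once, and Laplace's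
  method at the saddlepoint gives the expansion. Since the characteristic function need not be
  integrable, the indicator of \<open>T \<ge> 0\<close> is first replaced by a Gaussian distribution function of
  exponentially small width; the density of \<open>Y\<close> enters through the Riemann-Lebesgue lemma, which
  bounds the tilted characteristic function away from 1. For \<open>\<eta> = 0\<close> the central limit theorem bounds
  \<open>P[mean Y \<ge> a]\<close> from below.\<close>

section \<open>The Riemann-Lebesgue lemma and the Cramer condition\<close>

text \<open>With \<open>\<mu>\<close> the moment generating function of \<open>Y - a\<close> and
  \<open>\<nu>\<close> its version weighted by \<open>U\<close>, independence makes the transform of
  one summand \<open>\<nu> s * \<mu> s ^ (n - 1)\<close>, that is
  \<open>(\<nu> s / \<mu> s) * \<mu> s ^ n\<close>. The quotient \<open>\<nu> / \<mu>\<close> is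
  \<open>K\<^sub>\<gamma> s - K\<^sub>\<gamma> 0\<close>, so this factor enters with no correction
  depending on \<open>n\<close>, and every summand has the same expansion. The scale
  \<open>\<mu> \<eta> ^ n\<close> may itself be exponentially small. An absolute error bound is
  therefore useless: the tilt \<open>exp (\<eta> * T)\<close> has to be kept in every estimate,
  including that of the smoothing error. Derivatives in the statement are real iterated
  \<open>deriv\<close>, while Laplace's method works with complex power series; the two are linked
  through holomorphic extensions that agree with the real functions near the saddlepoint. The Taylor
  series \<open>H\<close> of \<open>(K\<^sub>\<gamma> s - K\<^sub>\<gamma> 0) / s\<close> at \<eta>
  is characterised by its product with \<eta> + X. For \<eta> nonzero these equations are solved by
  division; for \<eta> = 0 they say directly that the leading coefficient is the first derivative of
  \<open>K\<^sub>\<gamma>\<close>.\<close>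

lemmas bochner_bound = Bochner_Integration.integrable_bound
lemmas bochner_addI = Bochner_Integration.integrable_add
lemmas bochner_add = Bochner_Integration.integral_add
lemmas bochner_diff = Bochner_Integration.integral_diff
lemmas bochner_cong = Bochner_Integration.integral_cong
lemmas bochner_nonneg = Bochner_Integration.integral_nonneg

abbreviation fourier :: "(real \<Rightarrow> real) \<Rightarrow> real \<Rightarrow> complex" where
  "fourier f t \<equiv> \<integral>x. f x *\<^sub>R cis (t * x) \<partial>lborel"

lemma measurable_cis [measurable]: "cis \<in> borel_measurable borel"
  by (intro borel_measurable_continuous_onI continuous_intros)

lemma integrable_fourier:
  fixes f :: "real \<Rightarrow> real"
  assumes "integrable lborel f"
  shows "integrable lborel (\<lambda>x. f x *\<^sub>R cis (t * x))"
proof (rule bochner_bound[OF assms])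
  have [measurable]: "f \<in> borel_measurable borel" using assms by auto
  show "(\<lambda>x. f x *\<^sub>R cis (t * x)) \<in> borel_measurable lborel"
    by measurable
qed auto

lemma norm_fourier_le:
  fixes f :: "real \<Rightarrow> real"
  shows "norm (fourier f t) \<le> (\<integral>x. \<bar>f x\<bar> \<partial>lborel)"
  using integral_norm_bound[of lborel "\<lambda>x. f x *\<^sub>R cis (t * x)"] by simp

text \<open>The antiderivative \<open>cis (t * x) / (\<i> * t)\<close> has modulus 1 / |t| at each
  endpoint. Half-open intervals are used because they are what \<open>{..a}\<close> cuts out of
  \<open>{-N<..N}\<close>.\<close>

lemma norm_integral_cis_interval_le:
  assumes "t \<noteq> 0"
  shows "norm (\<integral>x. indicat_real {a<..b} x *\<^sub>R cis (t * x) \<partial>lborel) \<le> 2 / \<bar>t\<bar>"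
proof (cases "a \<le> b")
  case True
  define F where "F = (\<lambda>x. cis (t * x) / (\<i> * of_real t))"
  have F: "(F has_vector_derivative cis (t * x)) (at x within S)" for x S
    unfolding F_def cis_conv_exp using assms
    by (auto intro!: derivative_eq_intros has_vector_derivative_real_field simp: field_simps)
  have "(\<integral>x. indicat_real {a..b} x *\<^sub>R cis (t * x) \<partial>lborel) = F b - F a"
    by (rule integral_FTC_atLeastAtMost[OF True F]) (auto intro!: continuous_intros)
  moreover have "(\<integral>x. indicat_real {a<..b} x *\<^sub>R cis (t * x) \<partial>lborel)
      = (\<integral>x. indicat_real {a..b} x *\<^sub>R cis (t * x) \<partial>lborel)"
  proof (rule integral_cong_AE)
    show "AE x in lborel. indicat_real {a<..b} x *\<^sub>R cis (t * x) = indicat_real {a..b} x *\<^sub>R cis (t * x)"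
      using AE_lborel_singleton[of a] by eventually_elim (auto simp: indicator_def)
    show "(\<lambda>x. indicat_real {a<..b} x *\<^sub>R cis (t * x)) \<in> borel_measurable lborel"
      "(\<lambda>x. indicat_real {a..b} x *\<^sub>R cis (t * x)) \<in> borel_measurable lborel"
      by measurable
  qed
  moreover have "norm (F b - F a) \<le> norm (F b) + norm (F a)"
    by (rule norm_triangle_ineq4)
  ultimately show ?thesis by (simp add: F_def norm_divide norm_mult)
qed simp

text \<open>The conclusion of the Riemann-Lebesgue lemma as a predicate, so that it can be carried
  through a set induction and then through \<open>integrable_induct\<close>.\<close>

definition fourier_null :: "(real \<Rightarrow> real) \<Rightarrow> bool" where
  "fourier_null f \<longleftrightarrow> ((\<lambda>t. fourier f t) \<longlongrightarrow> 0) at_infinity"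

lemma fourier_null_add:
  assumes "integrable lborel f" "integrable lborel g" "fourier_null f" "fourier_null g"
  shows "fourier_null (\<lambda>x. f x + g x)"
proof -
  have "(\<lambda>t. \<integral>x. (f x + g x) *\<^sub>R cis (t * x) \<partial>lborel)
    = (\<lambda>t. (fourier f t) + (fourier g t))"
    using assms(1,2) by (simp add: scaleR_add_left integrable_fourier)
  then show ?thesis
    using tendsto_add[OF assms(3,4)[unfolded fourier_null_def]] by (simp add: fourier_null_def)
qed

lemma fourier_null_cmult:
  assumes "fourier_null f"
  shows "fourier_null (\<lambda>x. c * f x)"
proof -
  have "(\<lambda>t. \<integral>x. (c * f x) *\<^sub>R cis (t * x) \<partial>lborel) = (\<lambda>t. c *\<^sub>R (fourier f t))"
    by (simp flip: scaleR_scaleR)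
  then show ?thesis
    using tendsto_scaleR[OF tendsto_const assms[unfolded fourier_null_def], of c]
    by (simp add: fourier_null_def)
qed

text \<open>Dominated convergence gives convergence in L1, and the L1 distance bounds the difference
  of the Fourier transforms uniformly in \<open>t\<close>; one good \<open>k\<close> therefore
  settles all large \<open>t\<close>.\<close>

lemma fourier_null_dominated:
  fixes f :: "real \<Rightarrow> real" and s :: "nat \<Rightarrow> real \<Rightarrow> real"
  assumes s: "\<And>k. integrable lborel (s k)" "\<And>k. fourier_null (s k)"
    and f: "integrable lborel f"
    and lim: "\<And>x. (\<lambda>k. s k x) \<longlonglongrightarrow> f x"
    and w: "integrable lborel w" "\<And>k x. \<bar>s k x\<bar> \<le> w x"
  shows "fourier_null f"
  unfolding fourier_null_def
proof (rule tendstoI)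
  fix e :: real assume e: "e > 0"
  have "(\<lambda>k. \<integral>x. \<bar>f x - s k x\<bar> \<partial>lborel) \<longlonglongrightarrow> integral\<^sup>L lborel (\<lambda>x::real. 0::real)"
  proof (rule integral_dominated_convergence[where f="\<lambda>x. 0" and s="\<lambda>k x. \<bar>f x - s k x\<bar>" and w="\<lambda>x. \<bar>f x\<bar> + w x"])
    show "AE x in lborel. (\<lambda>k. \<bar>f x - s k x\<bar>) \<longlonglongrightarrow> 0"
    proof (rule AE_I2)
      fix x show "(\<lambda>k. \<bar>f x - s k x\<bar>) \<longlonglongrightarrow> 0"
        using tendsto_diff[OF tendsto_const[of "f x"] lim[of x]] by (simp add: tendsto_rabs_zero_iff)
    qed
    show "AE x in lborel. norm \<bar>f x - s k x\<bar> \<le> \<bar>f x\<bar> + w x" for k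
    proof (rule AE_I2)
      fix x show "norm \<bar>f x - s k x\<bar> \<le> \<bar>f x\<bar> + w x" using w(2)[of k x] by auto
    qed
  qed (use s f w in \<open>auto dest: borel_measurable_integrable\<close>)
  then have "\<forall>\<^sub>F k in sequentially. (\<integral>x. \<bar>f x - s k x\<bar> \<partial>lborel) < e / 2"
    using e by (auto dest!: order_tendstoD(2)[where a="e/2"])
  then obtain k where k: "(\<integral>x. \<bar>f x - s k x\<bar> \<partial>lborel) < e / 2"
    by (auto simp: eventually_sequentially)
  have "\<forall>\<^sub>F t in at_infinity. dist (\<integral>x. s k x *\<^sub>R cis (t * x) \<partial>lborel) 0 < e / 2"
    using s(2)[of k] e unfolding fourier_null_def by (auto dest!: tendstoD[where e="e/2"])
  then show "\<forall>\<^sub>F t in at_infinity. dist (fourier f t) 0 < e"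
  proof eventually_elim
    case (elim t)
    have "(fourier f t) =
      (\<integral>x. (f x - s k x) *\<^sub>R cis (t * x) \<partial>lborel) + (\<integral>x. s k x *\<^sub>R cis (t * x) \<partial>lborel)"
      using s f by (subst bochner_add[symmetric])
        (auto intro!: integrable_fourier simp flip: scaleR_add_left)
    moreover have "norm (\<integral>x. (f x - s k x) *\<^sub>R cis (t * x) \<partial>lborel) \<le> (\<integral>x. \<bar>f x - s k x\<bar> \<partial>lborel)"
      by (rule norm_fourier_le)
    ultimately show ?case using k elim
      by (smt (verit) dist_norm diff_zero field_sum_of_halves norm_triangle_ineq)
  qed
qed

lemma integrable_Int_interval:
  fixes A :: "real set"
  assumes "A \<in> sets borel"
  shows "integrable lborel (indicat_real (A \<inter> {-N<..N}))"
proof -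
  have "emeasure lborel (A \<inter> {-N<..N}) \<le> emeasure lborel {-N..N}"
    using assms by (intro emeasure_mono) auto
  also have "\<dots> < \<infinity>" by (simp add: emeasure_lborel_Icc_eq)
  finally show ?thesis using assms by (intro integrable_real_indicator) auto
qed

lemma fourier_null_interval: "fourier_null (indicat_real {a<..b})"
  unfolding fourier_null_def
proof (rule Lim_null_comparison)
  show "\<forall>\<^sub>F t in at_infinity. norm (\<integral>x. indicat_real {a<..b} x *\<^sub>R cis (t * x) \<partial>lborel) \<le> 2 / \<bar>t\<bar>"
    unfolding eventually_at_infinity by (intro exI[of _ 1] allI impI norm_integral_cis_interval_le) auto
  have "((\<lambda>t::real. 2 * norm (inverse t)) \<longlongrightarrow> 2 * norm (0::real)) at_infinity"
    by (intro tendsto_mult_left tendsto_norm tendsto_inverse_0)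
  then show "((\<lambda>t::real. 2 / \<bar>t\<bar>) \<longlongrightarrow> 0) at_infinity" by (simp add: divide_inverse)
qed

text \<open>A pi-lambda argument on the half-lines \<open>{..a}\<close>. The window
  \<open>{-N<..N}\<close> keeps complements integrable and turns the generators into bounded
  intervals; disjoint unions are limits of finite sums dominated by the window.\<close>

lemma fourier_null_indicator_bounded:
  assumes "A \<in> sets borel"
  shows "fourier_null (indicat_real (A \<inter> {-N<..N}))"
proof -
  have "Int_stable (range (\<lambda>a::real. {..a}))"
    by (auto simp: Int_stable_def)
  moreover have "range (\<lambda>a::real. {..a}) \<subseteq> Pow UNIV" by simp
  moreover have borel: "sets borel = sigma_sets UNIV (range (\<lambda>a::real. {..a}))"
    by (subst borel_eq_atMost) simp
  then have "A \<in> sigma_sets UNIV (range (\<lambda>a::real. {..a}))" using assms by simp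
  ultimately show ?thesis
  proof (induction rule: sigma_sets_induct_disjoint)
    case (basic A)
    then obtain a where "A = {..a}" by auto
    then have "A \<inter> {-N<..N} = {-N<..min a N}" by auto
    then show ?case by (simp add: fourier_null_interval)
  next
    case empty then show ?case by (simp add: fourier_null_def)
  next
    case (compl A)
    have "indicat_real ((UNIV - A) \<inter> {-N<..N}) =
      (\<lambda>x. indicat_real {-N<..N} x + (-1) * indicat_real (A \<inter> {-N<..N}) x)"
      by (auto simp: indicator_def)
    moreover have "fourier_null (\<lambda>x. indicat_real {-N<..N} x + (-1) * indicat_real (A \<inter> {-N<..N}) x)"
      using compl integrable_Int_interval[of A N] integrable_Int_interval[of UNIV N, simplified]
      by (intro fourier_null_add fourier_null_cmult fourier_null_interval) (auto simp: borel)
    ultimately show ?case by simp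
  next
    case (union A)
    have A[measurable]: "A i \<in> sets borel" for i using union borel by auto
    have sum: "fourier_null (\<lambda>x. \<Sum>i<k. indicat_real (A i \<inter> {-N<..N}) x)" for k
    proof (induction k)
      case 0 then show ?case by (simp add: fourier_null_def)
    next
      case (Suc k) then show ?case using union 
        by (auto intro!: fourier_null_add Bochner_Integration.integrable_sum integrable_Int_interval)
    qed
    have eq: "(\<Sum>i<k. indicat_real (A i \<inter> {-N<..N}) x) = indicat_real ((\<Union>i<k. A i) \<inter> {-N<..N}) x" for k x
    proof -
      have "(\<Sum>i<k. indicat_real (A i \<inter> {-N<..N}) x) = (\<Sum>i<k. indicat_real (A i) x) * indicator {-N<..N} x"
        by (simp add: indicator_inter_arith sum_distrib_right)
      also have "(\<Sum>i<k. indicat_real (A i) x) = indicat_real (\<Union>i<k. A i) x"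
        using \<open>disjoint_family A\<close> by (subst indicator_UN_disjoint) (auto simp: disjoint_family_on_def)
      finally show ?thesis by (simp add: indicator_inter_arith)
    qed
    show ?case
    proof (rule fourier_null_dominated[where s="\<lambda>k x. indicat_real ((\<Union>i<k. A i) \<inter> {-N<..N}) x" and w="indicat_real (UNIV \<inter> {-N<..N})"])
      show "(\<lambda>k. indicat_real ((\<Union>i<k. A i) \<inter> {-N<..N}) x) \<longlonglongrightarrow> indicat_real (\<Union> (range A) \<inter> {-N<..N}) x" for x
      proof (cases "\<exists>i. x \<in> A i")
        case True
        then obtain i where "x \<in> A i" by auto
        then have "\<forall>\<^sub>F k in sequentially. indicat_real ((\<Union>i<k. A i) \<inter> {-N<..N}) x = indicat_real (\<Union> (range A) \<inter> {-N<..N}) x"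
          unfolding eventually_sequentially by (intro exI[of _ "Suc i"]) (auto simp: indicator_def)
        then show ?thesis by (rule tendsto_eventually)
      qed (simp add: indicator_def)
      show "fourier_null (indicat_real ((\<Union>i<k. A i) \<inter> {-N<..N}))" for k
        using sum[of k] unfolding eq .
      show "\<bar>indicat_real ((\<Union>i<k. A i) \<inter> {-N<..N}) x\<bar> \<le> indicat_real (UNIV \<inter> {-N<..N}) x" for k x
        by (auto simp: indicator_def)
    qed (use integrable_Int_interval[of UNIV N] in \<open>auto intro!: integrable_Int_interval\<close>)
  qed
qed

lemma fourier_null_indicator:
  assumes "A \<in> sets lborel" "emeasure lborel A < \<infinity>"
  shows "fourier_null (indicat_real A)"
proof (rule fourier_null_dominated[where s="\<lambda>k x. indicat_real (A \<inter> {- real k<..real k}) x" and w="indicat_real A"])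
  fix x :: real
  obtain k where k: "\<bar>x\<bar> < real k" using reals_Archimedean2 by blast
  have "\<forall>\<^sub>F k in sequentially. indicat_real (A \<inter> {- real k<..real k}) x = indicat_real A x"
    unfolding eventually_sequentially using k by (intro exI[of _ k]) (auto simp: indicator_def)
  then show "(\<lambda>k. indicat_real (A \<inter> {- real k<..real k}) x) \<longlonglongrightarrow> indicat_real A x"
    by (rule tendsto_eventually)
qed (use assms in \<open>auto simp: indicator_le_1 split: split_indicator intro!: integrable_Int_interval fourier_null_indicator_bounded integrable_real_indicator\<close>)

theorem riemann_lebesgue:
  fixes f :: "real \<Rightarrow> real"
  assumes "integrable lborel f"
  shows "((\<lambda>t. fourier f t) \<longlongrightarrow> 0) at_infinity"
proof -
  have "fourier_null f"
    using assms
  proof (induction rule: integrable_induct)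
    case (base A c)
    then show ?case
      using fourier_null_cmult[OF fourier_null_indicator[of A], of c] by (simp add: mult.commute)
  next
    case (add f g) then show ?case by (intro fourier_null_add)
  next
    case (lim f s)
    \<comment> \<open>\<open>integrable_induct\<close> supplies approximants bounded by twice the
      norm of \<open>f\<close>, which is the majorant.\<close>
    then show ?case
      by (intro fourier_null_dominated[of s f "\<lambda>x. 2 * \<bar>f x\<bar>"]) auto
  qed
  then show ?thesis by (simp add: fourier_null_def)
qed


section \<open>Fourier transforms of nonnegative functions away from frequency 0\<close>

lemma isCont_fourier:
  fixes w :: "real \<Rightarrow> real"
  assumes "integrable lborel w"
  shows "isCont (\<lambda>t. fourier w t) t"
  unfolding continuous_at_sequentially
proof (intro allI impI)
  fix u assume u: "u \<longlonglongrightarrow> t"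
  have [measurable]: "w \<in> borel_measurable borel" using assms by auto
  show "((\<lambda>t. fourier w t) \<circ> u) \<longlonglongrightarrow> (fourier w t)"
    unfolding comp_def
  proof (rule integral_dominated_convergence[where w="\<lambda>x. \<bar>w x\<bar>"])
    show "AE x in lborel. (\<lambda>i. w x *\<^sub>R cis (u i * x)) \<longlonglongrightarrow> w x *\<^sub>R cis (t * x)"
      unfolding cis_conv_exp by (intro AE_I2 tendsto_intros u)
  qed (use assms in auto)
qed

text \<open>Equality in the triangle inequality would force a constant phase: after rotation by
  -\<theta> the integral of \<open>w x * (1 - cos (t * x - \<theta>))\<close> would be 0, so
  \<open>w\<close> would vanish almost everywhere off the countable set where the cosine is 1, hence
  almost everywhere.\<close>

lemma norm_fourier_less:
  fixes w :: "real \<Rightarrow> real"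
  assumes w: "integrable lborel w" "\<And>x. 0 \<le> w x" "0 < (\<integral>x. w x \<partial>lborel)" and t: "t \<noteq> 0"
  shows "norm (fourier w t) < (\<integral>x. w x \<partial>lborel)"
proof (rule ccontr)
  have [measurable]: "w \<in> borel_measurable borel" using w by auto
  define I where "I = (fourier w t)"
  define \<theta> where "\<theta> = Arg I"
  assume "\<not> ?thesis"
  then have ge: "(\<integral>x. w x \<partial>lborel) \<le> norm I" by (simp add: I_def)
  then have "I \<noteq> 0" using w(3) by auto
  then have "complex_of_real (norm I) = cis (-\<theta>) * I"
    by (metis Arg_eq \<theta>_def cis_conv_exp cis_inverse cis_neq_zero complex_norm_eq_1_exp_eq 
        left_inverse mult.assoc mult.commute mult.right_neutral)
  also have "\<dots> = (\<integral>x. cis (-\<theta>) * (w x *\<^sub>R cis (t * x)) \<partial>lborel)"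
    unfolding I_def by (rule integral_mult_right_zero[symmetric])
  also have "\<dots> = (\<integral>x. w x *\<^sub>R cis (t * x - \<theta>) \<partial>lborel)"
    by (simp add: cis_mult add.commute)
  finally have "norm I = Re (\<integral>x. w x *\<^sub>R cis (t * x - \<theta>) \<partial>lborel)"
    by (metis Re_complex_of_real)
  also have "\<dots> = (\<integral>x. Re (w x *\<^sub>R cis (t * x - \<theta>)) \<partial>lborel)"
  proof (rule integral_Re[symmetric])
    have "integrable lborel (\<lambda>x. cis (-\<theta>) * (w x *\<^sub>R cis (t * x)))"
      by (intro integrable_mult_right integrable_fourier w)
    then show "integrable lborel (\<lambda>x. w x *\<^sub>R cis (t * x - \<theta>))"
      by (simp add: cis_mult add.commute)
  qed
  finally have I: "norm I = (\<integral>x. w x * cos (t * x - \<theta>) \<partial>lborel)" by simp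
  have int: "integrable lborel (\<lambda>x. w x * cos (t * x - \<theta>))"
    by (rule bochner_bound[OF w(1)])
       (use w in \<open>auto simp: abs_mult intro!: AE_I2 mult_left_le\<close>)
  have int2: "integrable lborel (\<lambda>x. w x * (1 - cos (t * x - \<theta>)))"
    using Bochner_Integration.integrable_diff[OF w(1) int] by (simp add: algebra_simps)
  have nn: "0 \<le> w x * (1 - cos (t * x - \<theta>))" for x
    using w(2)[of x] cos_le_one[of "t * x - \<theta>"] by simp
  have "(\<integral>x. w x * (1 - cos (t * x - \<theta>)) \<partial>lborel) = (\<integral>x. w x \<partial>lborel) - norm I"
    unfolding I using int w(1) by (subst bochner_diff[symmetric]) (auto simp: algebra_simps)
  also have "\<dots> \<le> 0" using ge by simp
  finally have "(\<integral>x. w x * (1 - cos (t * x - \<theta>)) \<partial>lborel) = 0"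
    using nn by (intro antisym integral_nonneg) auto
  then have ae: "AE x in lborel. w x * (1 - cos (t * x - \<theta>)) = 0"
    using integral_nonneg_eq_0_iff_AE[OF int2] nn by auto
  define N where "N = range (\<lambda>k::int. (2 * pi * k + \<theta>) / t)"
  have "countable N" by (simp add: N_def)
  then have "AE x in lborel. x \<notin> N"
    by (intro AE_not_in countable_imp_null_set_lborel)
  with ae have "AE x in lborel. w x = 0"
  proof eventually_elim
    case (elim x)
    have "cos (t * x - \<theta>) \<noteq> 1"
    proof
      assume "cos (t * x - \<theta>) = 1"
      then obtain k :: int where "t * x - \<theta> = real_of_int k * 2 * pi" using cos_one_2pi_int by auto
      then have "x = (2 * pi * k + \<theta>) / t" using t by (auto simp: field_simps)
      with elim(2) show False by (auto simp: N_def)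
    qed
    with elim(1) show ?case by simp
  qed
  then have "(\<integral>x. w x \<partial>lborel) = 0" by (simp add: integral_eq_zero_AE)
  with w(3) show False by simp
qed

text \<open>Strict inequality at each nonzero frequency becomes uniform by compactness on a bounded
  range, and Riemann-Lebesgue handles the unbounded rest.\<close>

theorem cramer_condition:
  fixes w :: "real \<Rightarrow> real"
  assumes w: "integrable lborel w" "\<And>x. 0 \<le> w x" "0 < (\<integral>x. w x \<partial>lborel)" and \<delta>: "\<delta> > 0"
  obtains q where "0 < q" "q < 1"
    "\<And>t. \<bar>t\<bar> \<ge> \<delta> \<Longrightarrow> norm (fourier w t) \<le> q * (\<integral>x. w x \<partial>lborel)"
proof -
  define F where "F = (\<lambda>t. norm (fourier w t))"
  define W where "W = (\<integral>x. w x \<partial>lborel)"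
  have W: "W > 0" using w by (simp add: W_def)
  have "\<forall>\<^sub>F t in at_infinity. F t < W / 2"
    using tendstoD[OF riemann_lebesgue[OF w(1)], of "W / 2"] W by (simp add: F_def)
  then obtain B where B: "\<And>t. B \<le> \<bar>t\<bar> \<Longrightarrow> F t < W / 2"
    by (auto simp: eventually_at_infinity)
  define K where "K = {-B..-\<delta>} \<union> {\<delta>..B}"
  have K: "compact K" "continuous_on K F"
    unfolding F_def K_def
    by (auto intro!: continuous_at_imp_continuous_on continuous_norm isCont_fourier w)
  have "\<exists>m<W. \<forall>t\<in>K. F t \<le> m"
  proof (cases "K = {}")
    case True then show ?thesis by (intro exI[of _ 0]) (use W in auto)
  next
    case False
    then obtain s where s: "s \<in> K" "\<forall>t\<in>K. F t \<le> F s" using continuous_attains_sup[OF K(1) _ K(2)] by auto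
    moreover have "F s < W"
      unfolding F_def W_def using s(1) \<delta> by (intro norm_fourier_less w) (auto simp: K_def)
    ultimately show ?thesis by auto
  qed
  then obtain m where m: "m < W" "\<And>t. t \<in> K \<Longrightarrow> F t \<le> m" by auto
  show thesis
  \<comment> \<open>1/2 serves the range beyond \<open>B\<close>, and \<open>m / W\<close> serves
    the compact range; 1/2 also keeps the constant positive when \<open>m\<close> is 0 or
    negative.\<close>
  proof (rule that[of "max (1/2) (m / W)"])
    show "0 < max (1/2) (m / W)" "max (1/2) (m / W) < 1" using W m(1) by (auto simp: field_simps)
    fix t assume t: "\<bar>t\<bar> \<ge> \<delta>"
    have "F t \<le> max (1/2) (m / W) * W"
    proof (cases "B \<le> \<bar>t\<bar>")
      case True
      have "F t \<le> 1/2 * W" using B[OF True] by simp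
      also have "\<dots> \<le> max (1/2) (m / W) * W" using W by (intro mult_right_mono) auto
      finally show ?thesis .
    next
      case False
      then have "t \<in> K" using t by (auto simp: K_def abs_if split: if_splits)
      then have "F t \<le> m / W * W" using m W by auto
      also have "\<dots> \<le> max (1/2) (m / W) * W" using W by (intro mult_right_mono) auto
      finally show ?thesis .
    qed
    then show "norm (fourier w t) \<le> max (1/2) (m / W) * (\<integral>x. w x \<partial>lborel)"
      by (simp add: F_def W_def)
  qed
qed

section \<open>Analyticity of weighted moment generating functions\<close>

text \<open>The weight lets one theory serve the moment generating function (\<open>V = 1\<close>),
  its version weighted by \<open>U\<close>, and all their derivatives, each of which multiplies
  \<open>V\<close> by \<open>Y\<close>.\<close>

definition wmgf :: "'a measure \<Rightarrow> ('a \<Rightarrow> real) \<Rightarrow> ('a \<Rightarrow> real) \<Rightarrow> complex \<Rightarrow> complex" where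
  "wmgf M V Y s = (\<integral>x. V x *\<^sub>R exp (s * of_real (Y x)) \<partial>M)"

lemma norm_exp_of_real: "norm (exp (s * complex_of_real y)) = exp (Re s * y)"
  by (simp add: norm_exp_eq_Re)

lemma integrable_weighted_exp_iff:
  fixes V Y :: "'a \<Rightarrow> real"
  assumes [measurable]: "V \<in> borel_measurable M" "Y \<in> borel_measurable M"
  shows "integrable M (\<lambda>x. V x *\<^sub>R exp (s * of_real (Y x)))
    \<longleftrightarrow> integrable M (\<lambda>x. V x * exp (Re s * Y x))"
proof -
  have "integrable M (\<lambda>x. V x *\<^sub>R exp (s * of_real (Y x)))
    \<longleftrightarrow> integrable M (\<lambda>x. norm (V x *\<^sub>R exp (s * of_real (Y x))))"
    by (rule integrable_norm_iff[symmetric]) measurable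
  also have "\<dots> \<longleftrightarrow> integrable M (\<lambda>x. norm (V x * exp (Re s * Y x)))"
    by (simp add: norm_exp_of_real abs_mult)
  also have "\<dots> \<longleftrightarrow> integrable M (\<lambda>x. V x * exp (Re s * Y x))"
    by (rule integrable_norm_iff) measurable
  finally show ?thesis .
qed

text \<open>Two one-sided tilts dominate the two-sided factor
  \<open>exp (r * \<bar>y\<bar>)\<close>; in an open strip both of them are integrable for small
  \<open>r\<close>.\<close>

lemma exp_add_mult_abs_le: "exp (e * y + r * \<bar>y\<bar>) \<le> exp ((e + r) * y) + exp ((e - r) * (y::real))"
  by (cases "y \<ge> 0") (auto simp: algebra_simps)

lemma power_abs_div_fact_le_exp:
  assumes "r \<ge> 0"
  shows "(\<Sum>k<(n::nat). \<bar>y\<bar> ^ k * r ^ k / fact k) \<le> exp (r * \<bar>y\<bar> :: real)"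
proof -
  have "(\<lambda>k. (r * \<bar>y\<bar>) ^ k /\<^sub>R fact k) sums exp (r * \<bar>y\<bar>)" by (rule exp_converges)
  then have "(\<lambda>k. \<bar>y\<bar> ^ k * r ^ k / fact k) sums exp (r * \<bar>y\<bar>)"
    by (simp add: power_mult_distrib field_simps)
  then show ?thesis using assms
    by (metis (no_types, lifting) abs_ge_zero divide_nonneg_nonneg fact_ge_zero mult_nonneg_nonneg 
        sum_le_suminf sums_iff zero_le_power finite_lessThan)
qed

text \<open>Expanding \<open>exp (w * Y)\<close> and integrating termwise is allowed because all
  partial sums of norms lie below the single integrable function in the hypothesis.\<close>

lemma wmgf_sums:
  fixes V Y :: "'a \<Rightarrow> real"
  assumes [measurable]: "V \<in> borel_measurable M" "Y \<in> borel_measurable M"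
    and int: "integrable M (\<lambda>x. V x * exp (Re s * Y x + r * \<bar>Y x\<bar>))"
    and w: "norm w \<le> r"
  shows "(\<lambda>k. wmgf M (\<lambda>x. V x * Y x ^ k) Y s / fact k * w ^ k) sums wmgf M V Y (s + w)"
proof -
  define f where "f = (\<lambda>(k::nat) x. V x *\<^sub>R (exp (s * of_real (Y x)) * (w * Y x) ^ k /\<^sub>R fact k))"
  have r: "r \<ge> 0" using w norm_ge_zero order_trans by blast
  have nf: "norm (f k x) = \<bar>V x\<bar> * exp (Re s * Y x) * (\<bar>Y x\<bar> ^ k * norm w ^ k / fact k)" for k x
    by (simp add: f_def norm_mult norm_power norm_exp_of_real power_mult_distrib field_simps)
  have part: "(\<Sum>k<n. norm (f k x)) \<le> \<bar>V x * exp (Re s * Y x + r * \<bar>Y x\<bar>)\<bar>" for n x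
  proof -
    have "(\<Sum>k<n. norm (f k x)) = \<bar>V x\<bar> * exp (Re s * Y x) * (\<Sum>k<n. \<bar>Y x\<bar> ^ k * norm w ^ k / fact k)"
      by (simp add: nf sum_distrib_left)
    also have "\<dots> \<le> \<bar>V x\<bar> * exp (Re s * Y x) * exp (norm w * \<bar>Y x\<bar>)"
      by (intro mult_left_mono power_abs_div_fact_le_exp) auto
    also have "\<dots> \<le> \<bar>V x\<bar> * exp (Re s * Y x) * exp (r * \<bar>Y x\<bar>)"
      using w by (intro mult_left_mono) (auto intro!: mult_right_mono)
    finally show ?thesis by (simp add: exp_add abs_mult mult.assoc)
  qed
  have single: "norm (f k x) \<le> \<bar>V x * exp (Re s * Y x + r * \<bar>Y x\<bar>)\<bar>" for k x
    by (rule order_trans[OF _ part[where n="Suc k"]]) (simp add: sum_nonneg)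
  have intf: "integrable M (f k)" for k
    by (rule bochner_bound[OF int])
       (use single in \<open>auto simp: f_def\<close>)
  have "(\<lambda>k. integral\<^sup>L M (f k)) sums (\<integral>x. (\<Sum>k. f k x) \<partial>M)"
  proof (rule sums_integral[OF intf])
    show "AE x in M. summable (\<lambda>k. norm (f k x))"
      by (intro AE_I2 summableI_nonneg_bounded[OF _ part]) auto
    have "(\<Sum>k<n. \<integral>x. norm (f k x) \<partial>M) \<le> (\<integral>x. \<bar>V x * exp (Re s * Y x + r * \<bar>Y x\<bar>)\<bar> \<partial>M)" for n
    proof -
      have "(\<Sum>k<n. \<integral>x. norm (f k x) \<partial>M) = (\<integral>x. (\<Sum>k<n. norm (f k x)) \<partial>M)"
        by (rule Bochner_Integration.integral_sum[symmetric]) (use intf in auto)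
      also have "\<dots> \<le> (\<integral>x. \<bar>V x * exp (Re s * Y x + r * \<bar>Y x\<bar>)\<bar> \<partial>M)"
        using intf int part by (intro integral_mono Bochner_Integration.integrable_sum integrable_norm integrable_abs) auto
      finally show ?thesis .
    qed
    then show "summable (\<lambda>k. \<integral>x. norm (f k x) \<partial>M)"
      by (intro summableI_nonneg_bounded) auto
  qed
  moreover have "(\<Sum>k. f k x) = V x *\<^sub>R exp ((s + w) * of_real (Y x))" for x
  proof -
    have "(\<lambda>k. V x *\<^sub>R (exp (s * Y x) * ((w * Y x) ^ k /\<^sub>R fact k))) sums (V x *\<^sub>R (exp (s * Y x) * exp (w * Y x)))"
      by (intro sums_scaleR_right sums_mult exp_converges)
    then show ?thesis
      by (simp add: f_def sums_iff exp_add distrib_right)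
  qed
  moreover have "integral\<^sup>L M (f k) = wmgf M (\<lambda>x. V x * Y x ^ k) Y s / fact k * w ^ k" for k
  proof -
    have "integral\<^sup>L M (f k) = (\<integral>x. ((V x * Y x ^ k) *\<^sub>R exp (s * Y x)) * (w ^ k / fact k) \<partial>M)"
      by (rule bochner_cong)
         (auto simp: f_def scaleR_conv_of_real power_mult_distrib field_simps)
    also have "\<dots> = (\<integral>x. (V x * Y x ^ k) *\<^sub>R exp (s * Y x) \<partial>M) * (w ^ k / fact k)"
      by (rule integral_mult_left_zero)
    finally show ?thesis by (simp add: wmgf_def)
  qed
  ultimately show ?thesis by (simp add: wmgf_def)
qed

lemma integrable_weighted_exp_abs:
  fixes V Y :: "'a \<Rightarrow> real"
  assumes [measurable]: "V \<in> borel_measurable M" "Y \<in> borel_measurable M"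
    and int: "\<And>e. e \<in> {l<..<u} \<Longrightarrow> integrable M (\<lambda>x. V x * exp (e * Y x))"
    and e: "e \<in> {l<..<u}"
  obtains r where "r > 0" "integrable M (\<lambda>x. V x * exp (e * Y x + r * \<bar>Y x\<bar>))"
proof -
  define r where "r = min (u - e) (e - l) / 2"
  have r: "r > 0" "e + r \<in> {l<..<u}" "e - r \<in> {l<..<u}" using e by (auto simp: r_def min_def field_simps)
  show thesis
  proof (rule that[OF r(1)], rule bochner_bound)
    show "integrable M (\<lambda>x. \<bar>V x * exp ((e + r) * Y x)\<bar> + \<bar>V x * exp ((e - r) * Y x)\<bar>)"
      by (intro bochner_addI integrable_abs int r)
    show "AE x in M. norm (V x * exp (e * Y x + r * \<bar>Y x\<bar>))
      \<le> norm (\<bar>V x * exp ((e + r) * Y x)\<bar> + \<bar>V x * exp ((e - r) * Y x)\<bar>)"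
    proof (rule AE_I2)
      fix x
      have "\<bar>V x\<bar> * exp (e * Y x + r * \<bar>Y x\<bar>) \<le> \<bar>V x\<bar> * (exp ((e + r) * Y x) + exp ((e - r) * Y x))"
        by (intro mult_left_mono exp_add_mult_abs_le) auto
      then show "norm (V x * exp (e * Y x + r * \<bar>Y x\<bar>))
        \<le> norm (\<bar>V x * exp ((e + r) * Y x)\<bar> + \<bar>V x * exp ((e - r) * Y x)\<bar>)"
        by (simp add: abs_mult distrib_left)
    qed
  qed measurable
qed

text \<open>A factor \<open>Y\<close> costs only a small widening of the tilt, since
  \<open>r * \<bar>Y\<bar>\<close> is at most \<open>exp (r * \<bar>Y\<bar>)\<close>.\<close>

lemma integrable_exp_times:
  fixes V Y :: "'a \<Rightarrow> real"
  assumes [measurable]: "V \<in> borel_measurable M" "Y \<in> borel_measurable M"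
    and int: "\<And>e. e \<in> {l<..<u} \<Longrightarrow> integrable M (\<lambda>x. V x * exp (e * Y x))"
    and e: "e \<in> {l<..<u}"
  shows "integrable M (\<lambda>x. V x * Y x * exp (e * Y x))"
proof -
  obtain r where r: "r > 0" "integrable M (\<lambda>x. V x * exp (e * Y x + r * \<bar>Y x\<bar>))"
    using integrable_weighted_exp_abs[OF assms] by blast
  show ?thesis
  proof (rule bochner_bound)
    show "integrable M (\<lambda>x. V x * exp (e * Y x + r * \<bar>Y x\<bar>) / r)" using r by auto
    show "AE x in M. norm (V x * Y x * exp (e * Y x)) \<le> norm (V x * exp (e * Y x + r * \<bar>Y x\<bar>) / r)"
    proof (rule AE_I2)
      fix x
      have "r * \<bar>Y x\<bar> \<le> exp (r * \<bar>Y x\<bar>)"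
        using exp_ge_add_one_self[of "r * \<bar>Y x\<bar>"] by linarith
      then have "\<bar>Y x\<bar> \<le> exp (r * \<bar>Y x\<bar>) / r" using r by (simp add: field_simps)
      then have "(\<bar>V x\<bar> * exp (e * Y x)) * \<bar>Y x\<bar> \<le> (\<bar>V x\<bar> * exp (e * Y x)) * (exp (r * \<bar>Y x\<bar>) / r)"
        by (intro mult_left_mono) auto
      then show "norm (V x * Y x * exp (e * Y x)) \<le> norm (V x * exp (e * Y x + r * \<bar>Y x\<bar>) / r)"
        using r by (simp add: abs_mult exp_add mult_ac)
    qed
  qed measurable
qed

lemma has_field_derivative_wmgf:
  fixes V Y :: "'a \<Rightarrow> real"
  assumes [measurable]: "V \<in> borel_measurable M" "Y \<in> borel_measurable M"
    and int: "\<And>e. e \<in> {l<..<u} \<Longrightarrow> integrable M (\<lambda>x. V x * exp (e * Y x))"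
    and s: "Re s \<in> {l<..<u}"
  shows "(wmgf M V Y has_field_derivative wmgf M (\<lambda>x. V x * Y x) Y s) (at s)"
proof -
  obtain r where r: "r > 0" "integrable M (\<lambda>x. V x * exp (Re s * Y x + r * \<bar>Y x\<bar>))"
    using integrable_weighted_exp_abs[OF assms] by blast
  define c where "c = (\<lambda>k. wmgf M (\<lambda>x. V x * Y x ^ k) Y s / fact k)"
  have sums: "(\<lambda>k. c k * w ^ k) sums wmgf M V Y (s + w)" if "norm w \<le> r" for w
    unfolding c_def by (rule wmgf_sums) (use that r in auto)
  have "((\<lambda>w. \<Sum>k. c k * w ^ k) has_field_derivative (\<Sum>k. diffs c k * 0 ^ k)) (at 0)"
    by (rule termdiffs_strong[where K="complex_of_real r"])
       (use sums[of "complex_of_real r"] r in \<open>auto simp: sums_iff\<close>)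
  \<comment> \<open>Only \<open>k = 0\<close> survives, and \<open>diffs c 0\<close> is
    \<open>c 1\<close>, the first moment weighted by \<open>V\<close>.\<close>
  also have "(\<Sum>k. diffs c k * 0 ^ k) = wmgf M (\<lambda>x. V x * Y x) Y s"
    by (simp add: diffs_def c_def)
  finally have "((\<lambda>w. wmgf M V Y (s + w)) has_field_derivative wmgf M (\<lambda>x. V x * Y x) Y s) (at 0)"
    using r sums
    by (subst (asm) DERIV_cong_ev[OF refl _ refl, where g="\<lambda>w. wmgf M V Y (s + w)"])
       (auto simp: sums_iff eventually_nhds_metric intro!: exI[of _ r])
  then show ?thesis
    using DERIV_shift[of "wmgf M V Y" _ 0 s] by (simp add: add.commute)
qed

lemma wmgf_of_real:
  "wmgf M V Y (complex_of_real e) = complex_of_real (\<integral>x. V x * exp (e * Y x) \<partial>M)"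
  unfolding wmgf_def
  by (subst integral_complex_of_real[symmetric]) (simp add: exp_of_real scaleR_conv_of_real flip: of_real_mult)

lemma norm_wmgf_le:
  "norm (wmgf M V Y s) \<le> (\<integral>x. \<bar>V x\<bar> * exp (Re s * Y x) \<partial>M)"
  unfolding wmgf_def
  using integral_norm_bound[of M "\<lambda>x. V x *\<^sub>R exp (s * of_real (Y x))"]
  by (simp add: norm_exp_of_real)

section \<open>Gaussian smoothing of the Heaviside function\<close>

abbreviation gauss :: "real \<Rightarrow> real" where
  "gauss y \<equiv> exp (- y\<^sup>2 / 2)"

text \<open>The characteristic function of the standard normal law, rescaled by
  \<open>h\<close>.\<close>

lemma fourier_gaussian:
  assumes "h > 0"
  shows "has_bochner_integral lborel (\<lambda>t. complex_of_real (gauss (h * t)) * cis (t * x))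
    (complex_of_real (sqrt (2 * pi) / h * gauss (x / h)))"
proof -
  have i1: "integrable lborel (\<lambda>u. complex_of_real (std_normal_density u) * cis (u * (x / h)))"
    by (rule bochner_bound[OF integrable_normal_density[of 1 0]])
       (auto simp: norm_mult)
  have "(\<integral>u. complex_of_real (std_normal_density u) * cis (u * (x / h)) \<partial>lborel) = char std_normal_distribution (x / h)"
    unfolding char_def
    by (subst integral_density) (auto simp: cis_conv_exp scaleR_conv_of_real mult_ac)
  also have "\<dots> = complex_of_real (gauss (x / h))"
    by (simp add: char_std_normal_distribution)
  finally have "has_bochner_integral lborel (\<lambda>u. complex_of_real (std_normal_density u) * cis (u * (x / h)))
     (complex_of_real (gauss (x / h)))"
    using i1 by (simp add: has_bochner_integral_iff)
  then have "has_bochner_integral lborel (\<lambda>t. complex_of_real (std_normal_density (0 + h * t)) * cis ((0 + h * t) * (x / h)))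
     (complex_of_real (gauss (x / h)) /\<^sub>R \<bar>h\<bar>)"
    by (subst (asm) lborel_has_bochner_integral_real_affine_iff[where c=h and t=0]) (use assms in auto)
  then have "has_bochner_integral lborel (\<lambda>t. complex_of_real (sqrt (2 * pi)) * (complex_of_real (std_normal_density (0 + h * t)) * cis ((0 + h * t) * (x / h))))
     (complex_of_real (sqrt (2 * pi)) * (complex_of_real (gauss (x / h)) /\<^sub>R \<bar>h\<bar>))"
    by (rule has_bochner_integral_mult_right)
  moreover have "complex_of_real (sqrt (2 * pi)) * (complex_of_real (std_normal_density (0 + h * t)) * cis ((0 + h * t) * (x / h)))
    = complex_of_real (gauss (h * t)) * cis (t * x)" for t
  proof -
    have "complex_of_real (sqrt (2 * pi)) * complex_of_real (std_normal_density (h * t)) = complex_of_real (gauss (h * t))"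
      by (subst of_real_mult[symmetric]) (simp add: std_normal_density_def)
    then show ?thesis using assms by (simp flip: mult.assoc)
  qed
  moreover have "complex_of_real (sqrt (2 * pi)) * (complex_of_real (gauss (x / h)) /\<^sub>R \<bar>h\<bar>)
    = complex_of_real (sqrt (2 * pi) / h * gauss (x / h))"
    using assms by (simp add: scaleR_conv_of_real field_simps)
  ultimately show ?thesis by simp
qed

lemma integrable_gauss:
  assumes "h > 0"
  shows "integrable lborel (\<lambda>t::real. gauss (h * t))"
    and "(\<integral>t. gauss (h * t) \<partial>lborel) = sqrt (2 * pi) / h"
proof -
  have "has_bochner_integral lborel (\<lambda>t. Re (complex_of_real (gauss (h * t)) * cis (t * 0))) (Re (complex_of_real (sqrt (2 * pi) / h * gauss (0 / h))))"
    by (rule has_bochner_integral_bounded_linear[OF bounded_linear_Re fourier_gaussian[OF assms]])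
  then show "integrable lborel (\<lambda>t::real. gauss (h * t))"
    "(\<integral>t. gauss (h * t) \<partial>lborel) = sqrt (2 * pi) / h"
    by (auto simp: has_bochner_integral_iff)
qed

abbreviation vline :: "real \<Rightarrow> real \<Rightarrow> complex" where
  "vline \<eta> t \<equiv> complex_of_real \<eta> + \<i> * of_real t"

text \<open>The exponent \<open>(h s)\<^sup>2 / 2 + s x\<close> on the line splits into a real
  constant, a Gaussian in \<open>t\<close> and a phase of frequency
  \<open>x + h\<^sup>2 * \<eta>\<close>. The real-frequency formula then applies, no contour has to
  be moved, and \<eta> cancels from the value.\<close>

lemma fourier_gaussian_vline:
  assumes "h > 0"
  shows "has_bochner_integral lborel (\<lambda>t. exp ((h * vline \<eta> t)\<^sup>2 / 2) * exp (vline \<eta> t * x))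
    (complex_of_real (2 * pi * normal_density 0 h x))"
proof -
  have eq: "exp ((h * vline \<eta> t)\<^sup>2 / 2) * exp (vline \<eta> t * x) =
    complex_of_real (exp ((h * \<eta>)\<^sup>2 / 2 + \<eta> * x)) * (complex_of_real (gauss (h * t)) * cis (t * (x + h\<^sup>2 * \<eta>)))" for t
    unfolding cis_conv_exp exp_of_real[symmetric] exp_add[symmetric]
    by (rule arg_cong[where f=exp]) (simp add: field_simps power2_eq_square)
  have "exp ((h * \<eta>)\<^sup>2 / 2 + \<eta> * x) * (sqrt (2 * pi) / h * gauss ((x + h\<^sup>2 * \<eta>) / h)) = 
      sqrt (2 * pi) / h * exp ((h * \<eta>)\<^sup>2 / 2 + \<eta> * x + - ((x + h\<^sup>2 * \<eta>) / h)\<^sup>2 / 2)"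
    by (simp only: exp_add mult_ac)
  also have "(h * \<eta>)\<^sup>2 / 2 + \<eta> * x + - ((x + h\<^sup>2 * \<eta>) / h)\<^sup>2 / 2 = - x\<^sup>2 / (2 * h\<^sup>2)"
    using assms by (simp add: field_simps power2_eq_square)
  also have "sqrt (2 * pi) / h * exp (- x\<^sup>2 / (2 * h\<^sup>2)) = 2 * pi * normal_density 0 h x"
    using assms by (simp add: normal_density_def real_sqrt_mult field_simps)
  finally have "complex_of_real (2 * pi * normal_density 0 h x) =
     complex_of_real (exp ((h * \<eta>)\<^sup>2 / 2 + \<eta> * x)) * complex_of_real (sqrt (2 * pi) / h * gauss ((x + h\<^sup>2 * \<eta>) / h))"
    by (metis of_real_mult)
  then show ?thesis
    unfolding eq using has_bochner_integral_mult_right[OF fourier_gaussian[OF assms, of "x + h\<^sup>2 * \<eta>"]] by simp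
qed

lemma norm_exp_vline_square: "norm (exp ((h * vline \<eta> t)\<^sup>2 / 2)) = exp ((h * \<eta>)\<^sup>2 / 2) * gauss (h * t)"
  unfolding norm_exp_eq_Re exp_add[symmetric] by (simp add: power2_eq_square diff_divide_distrib)

text \<open>Kernel of the oriented integral from 0 to \<open>y\<close>, so that one formula covers
  both signs; at \<open>y = 0\<close> the two indicators cancel.\<close>

definition signed_interval :: "real \<Rightarrow> real \<Rightarrow> real" where
  "signed_interval y x = indicat_real {0..y} x - indicat_real {y..0} x"

lemma signed_interval_measurable [measurable]: "signed_interval y \<in> borel_measurable borel"
  unfolding signed_interval_def[abs_def] by measurable

lemma abs_signed_interval: "y \<noteq> 0 \<Longrightarrow> \<bar>signed_interval y x\<bar> = indicat_real {min 0 y..max 0 y} x"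
  by (auto simp: signed_interval_def indicator_def)

lemma signed_interval_exp_integral:
  assumes "s \<noteq> 0"
  shows "has_bochner_integral lborel (\<lambda>x. signed_interval y x *\<^sub>R exp (s * complex_of_real x)) ((exp (s * y) - 1) / s)"
proof -
  define F where "F = (\<lambda>x::real. exp (s * x) / s)"
  have "(F has_vector_derivative exp (s * x)) (at x within S)" for x S
    unfolding F_def using assms
    by (auto intro!: derivative_eq_intros has_vector_derivative_real_field simp: field_simps)
  then have F: "has_bochner_integral lborel (\<lambda>x. indicat_real {a..b} x *\<^sub>R exp (s * complex_of_real x)) (F b - F a)" if "a \<le> b" for a b
    using that by (intro has_bochner_integral_FTC_Icc) (auto intro!: continuous_intros)
  consider "y > 0" | "y < 0" | "y = 0" by linarith
  then show ?thesis
  proof cases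
    case 1
    then have "signed_interval y = indicat_real {0..y}" by (auto simp: signed_interval_def fun_eq_iff indicator_def)
    then show ?thesis using F[of 0 y] 1 by (simp add: F_def diff_divide_distrib)
  next
    case 2
    then have "signed_interval y = (\<lambda>x. - indicat_real {y..0} x)" by (auto simp: signed_interval_def fun_eq_iff indicator_def)
    then show ?thesis using has_bochner_integral_minus[OF F[of y 0]] 2 by (simp add: F_def diff_divide_distrib)
  qed (simp add: signed_interval_def has_bochner_integral_iff)
qed

text \<open>The quotient is the oriented integral of \<open>exp (s * x)\<close> from 0 to
  \<open>y\<close>. The bound depends on \<open>s\<close> only through its real part and does not
  blow up at \<open>s = 0\<close>, which is what Fubini needs on a line that may pass through the
  origin.\<close>

lemma norm_exp_minus_1_div_le:
  assumes "s \<noteq> 0"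
  shows "norm ((exp (s * complex_of_real y) - 1) / s) \<le> \<bar>y\<bar> * (1 + exp (Re s * y))"
proof (cases "y = 0")
  case False
  have "(exp (s * complex_of_real y) - 1) / s = (\<integral>x. signed_interval y x *\<^sub>R exp (s * complex_of_real x) \<partial>lborel)"
    using signed_interval_exp_integral[OF assms, of y] by (simp add: has_bochner_integral_iff)
  also have "norm \<dots> \<le> (\<integral>x. indicat_real {min 0 y..max 0 y} x * (1 + exp (Re s * y)) \<partial>lborel)"
  proof (rule order_trans[OF integral_norm_bound integral_mono])
    show "integrable lborel (\<lambda>x. norm (signed_interval y x *\<^sub>R exp (s * complex_of_real x)))"
      by (rule integrable_norm[OF has_bochner_integral_iff[THEN iffD1, THEN conjunct1, OF signed_interval_exp_integral[OF assms]]])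
    show "integrable lborel (\<lambda>x. indicat_real {min 0 y..max 0 y} x * (1 + exp (Re s * y)))"
      by (intro integrable_mult_left integrable_real_indicator) (auto simp: emeasure_lborel_Icc_eq)
    fix x :: real
    show "norm (signed_interval y x *\<^sub>R exp (s * complex_of_real x)) \<le> indicat_real {min 0 y..max 0 y} x * (1 + exp (Re s * y))"
    proof (cases "x \<in> {min 0 y..max 0 y}")
      case True
      \<comment> \<open>\<open>x\<close> lies between 0 and \<open>y\<close>, so
        \<open>Re s * x\<close> lies between 0 and \<open>Re s * y\<close>.\<close>
      have "Re s * x \<le> max 0 (Re s * y)"
      proof (cases "Re s \<ge> 0")
        case p: True
        have "Re s * x \<le> Re s * max 0 y" using p True by (intro mult_left_mono) auto
        then show ?thesis by (auto simp: max_def split: if_splits)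
      next
        case p: False
        have "Re s * x \<le> Re s * min 0 y" using p True by (intro mult_left_mono_neg) auto
        then show ?thesis by (auto simp: min_def split: if_splits)
      qed
      then have "exp (Re s * x) \<le> exp (max 0 (Re s * y))" by simp
      also have "\<dots> \<le> 1 + exp (Re s * y)" by (auto simp: max_def)
      finally show ?thesis using True by (simp add: norm_exp_of_real abs_signed_interval[OF False])
    qed (simp add: abs_signed_interval[OF False])
  qed
  also have "\<dots> = \<bar>y\<bar> * (1 + exp (Re s * y))" by (simp add: max_def min_def)
  finally show ?thesis .
qed simp

lemma (in pair_sigma_finite) integrable_prod_mult:
  fixes f :: "'a \<Rightarrow> real" and g :: "'b \<Rightarrow> real"
  assumes f: "integrable M1 f" and g: "integrable M2 g"
  shows "integrable (M1 \<Otimes>\<^sub>M M2) (\<lambda>(x, y). f x * g y)"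
proof (rule Fubini_integrable)
  have [measurable]: "f \<in> borel_measurable M1" "g \<in> borel_measurable M2" using assms by auto
  show "(\<lambda>(x, y). f x * g y) \<in> borel_measurable (M1 \<Otimes>\<^sub>M M2)" by measurable
  show "integrable M1 (\<lambda>x. \<integral>y. norm (case (x, y) of (x, y) \<Rightarrow> f x * g y) \<partial>M2)"
    using f by (simp add: abs_mult)
qed (use g in auto)

definition gauss_step :: "real \<Rightarrow> real \<Rightarrow> real" where
  "gauss_step h y = (\<integral>x. indicat_real {..y} x * normal_density 0 h x \<partial>lborel)"

lemma integrable_normal_part:
  assumes "A \<in> sets borel"
  shows "h > 0 \<Longrightarrow> integrable lborel (\<lambda>x. indicat_real A x * normal_density 0 h x)"
  by (rule bochner_bound[OF integrable_normal_density[of h 0]])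
     (use assms in \<open>auto simp: indicator_def\<close>)

lemma gauss_step_diff:
  assumes "h > 0"
  shows "gauss_step h y - gauss_step h 0 = (\<integral>x. signed_interval y x * normal_density 0 h x \<partial>lborel)"
proof -
  have "gauss_step h y - gauss_step h 0 =
      (\<integral>x. indicat_real {..y} x * normal_density 0 h x - indicat_real {..0} x * normal_density 0 h x \<partial>lborel)"
    unfolding gauss_step_def using assms
    by (intro bochner_diff[symmetric] integrable_normal_part) auto
  also have "\<dots> = (\<integral>x. signed_interval y x * normal_density 0 h x \<partial>lborel)"
  proof (rule integral_cong_AE)
    show "AE x in lborel. indicat_real {..y} x * normal_density 0 h x - indicat_real {..0} x * normal_density 0 h x = signed_interval y x * normal_density 0 h x"
      using AE_lborel_singleton[of 0] AE_lborel_singleton[of y]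
      by eventually_elim (auto simp: signed_interval_def indicator_def)
  qed measurable
  finally show ?thesis .
qed

text \<open>Writing the quotient as an oriented integral of \<open>exp (s * x)\<close> and
  exchanging the integrals leaves, for each \<open>x\<close>, the Fourier integral of a normal
  density. Subtracting 1 in the numerator is what produces the constant
  \<open>gauss_step h 0\<close>.\<close>

lemma gauss_step_fourier:
  assumes h: "h > 0"
  shows "(\<integral>t. exp ((h * vline \<eta> t)\<^sup>2 / 2) * ((exp (vline \<eta> t * y) - 1) / vline \<eta> t) \<partial>lborel)
    = complex_of_real (2 * pi * (gauss_step h y - gauss_step h 0))"
proof -
  define f where "f = (\<lambda>t x. exp ((h * vline \<eta> t)\<^sup>2 / 2) * (signed_interval y x *\<^sub>R exp (vline \<eta> t * of_real x)))"
  have "(\<integral>t. exp ((h * vline \<eta> t)\<^sup>2 / 2) * ((exp (vline \<eta> t * y) - 1) / vline \<eta> t) \<partial>lborel) = (\<integral>t. (\<integral>x. f t x \<partial>lborel) \<partial>lborel)"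
  proof (rule integral_cong_AE)
    \<comment> \<open>The point \<open>t = 0\<close> is excluded: for \<eta> = 0 the quotient there
      is 0 by the convention for division, not its limit \<open>y\<close>.\<close>
    show "AE t in lborel. exp ((h * vline \<eta> t)\<^sup>2 / 2) * ((exp (vline \<eta> t * y) - 1) / vline \<eta> t) = (\<integral>x. f t x \<partial>lborel)"
      using AE_lborel_singleton[of 0]
    proof eventually_elim
      case (elim t)
      then have "vline \<eta> t \<noteq> 0" by (auto simp: complex_eq_iff)
      then have "(\<integral>x. signed_interval y x *\<^sub>R exp (vline \<eta> t * of_real x) \<partial>lborel) = (exp (vline \<eta> t * y) - 1) / vline \<eta> t"
        by (intro has_bochner_integral_integral_eq signed_interval_exp_integral)
      then show ?case
        unfolding f_def integral_mult_right_zero by simp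
    qed
  qed (unfold f_def, measurable)
  also have "\<dots> = (\<integral>x. (\<integral>t. f t x \<partial>lborel) \<partial>lborel)"
  proof (rule lborel_pair.Fubini_integral[symmetric])
    have "integrable (lborel \<Otimes>\<^sub>M lborel) (\<lambda>(t, x). (exp ((h * \<eta>)\<^sup>2 / 2) * gauss (h * t)) * (signed_interval y x * exp (\<eta> * x)))"
    proof (intro lborel_pair.integrable_prod_mult integrable_mult_right integrable_gauss h)
      show "integrable lborel (\<lambda>x. signed_interval y x * exp (\<eta> * x))"
      proof (cases "y = 0")
        case False
        have "integrable lborel (\<lambda>x. indicat_real {min 0 y..max 0 y} x *\<^sub>R exp (\<eta> * x))"
          by (intro borel_integrable_compact) (auto intro!: continuous_intros)
        then show ?thesis
          by (rule bochner_bound) (auto simp: abs_mult abs_signed_interval[OF False])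
      qed (simp add: signed_interval_def)
    qed
    then show "integrable (lborel \<Otimes>\<^sub>M lborel) (\<lambda>(t, x). f t x)"
    proof (rule bochner_bound)
      show "(\<lambda>(t, x). f t x) \<in> borel_measurable (lborel \<Otimes>\<^sub>M lborel)" unfolding f_def by measurable
      show "AE p in lborel \<Otimes>\<^sub>M lborel. norm (case p of (t, x) \<Rightarrow> f t x)
        \<le> norm (case p of (t, x) \<Rightarrow> exp ((h * \<eta>)\<^sup>2 / 2) * gauss (h * t) * (signed_interval y x * exp (\<eta> * x)))"
        by (intro AE_I2) (simp only: f_def split_beta norm_mult norm_scaleR norm_exp_vline_square norm_exp_of_real, simp add: abs_mult)
    qed
  qed
  also have "\<dots> = (\<integral>x. complex_of_real (2 * pi * (signed_interval y x * normal_density 0 h x)) \<partial>lborel)"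
  proof (rule bochner_cong)
    fix x :: real
    have "f t x = signed_interval y x *\<^sub>R (exp ((h * vline \<eta> t)\<^sup>2 / 2) * exp (vline \<eta> t * x))" for t by (simp add: f_def)
    then have "(\<integral>t. f t x \<partial>lborel) = signed_interval y x *\<^sub>R (\<integral>t. exp ((h * vline \<eta> t)\<^sup>2 / 2) * exp (vline \<eta> t * x) \<partial>lborel)"
      by simp
    also have "(\<integral>t. exp ((h * vline \<eta> t)\<^sup>2 / 2) * exp (vline \<eta> t * x) \<partial>lborel) = complex_of_real (2 * pi * normal_density 0 h x)"
      using fourier_gaussian_vline[OF h] by (rule has_bochner_integral_integral_eq)
    finally show "(\<integral>t. f t x \<partial>lborel) = complex_of_real (2 * pi * (signed_interval y x * normal_density 0 h x))"
      by (simp add: scaleR_conv_of_real)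
  qed simp
  also have "\<dots> = complex_of_real (2 * pi * (gauss_step h y - gauss_step h 0))"
    unfolding gauss_step_diff[OF h] integral_complex_of_real by simp
  finally show ?thesis .
qed

text \<open>The smoothing width \<open>h\<close> will be exponentially small in the sample size. Outside a neighbourhood
  of the saddlepoint the characteristic function is only known to be bounded away from 1, not
  integrable, and the Gaussian factor supplies the missing integrability.\<close>

lemma gauss_step_error_le:
  assumes h: "h > 0"
  shows "\<bar>indicat_real {0..} y - gauss_step h y\<bar> \<le> gauss (y / h)"
proof -
  have dens: "(\<integral>x. normal_density 0 h x \<partial>lborel) = 1" using h by simp
  have shift: "(\<integral>x. normal_density 0 h (x - y) \<partial>lborel) = 1"
    using lborel_integral_real_affine[of 1 "\<lambda>x. normal_density 0 h (x - y)" y] dens by simp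
  have shifti: "integrable lborel (\<lambda>x. normal_density 0 h (x - y))"
  proof -
    have "(\<lambda>x. normal_density 0 h (x - y)) = normal_density y h" by (auto simp: normal_density_def)
    then show ?thesis using h by simp
  qed
  \<comment> \<open>For \<open>x\<close> beyond \<open>y\<close>, seen from 0, the square of
    \<open>x\<close> is at least the sum of the squares of \<open>y\<close> and
    \<open>x - y\<close>. The density is thus at most \<open>gauss (y / h)\<close> times a shifted
    normal density, whose mass is 1.\<close>
  have tail: "(\<integral>x. indicat_real A x * normal_density 0 h x \<partial>lborel) \<le> gauss (y / h)"
    if A: "A \<in> sets borel" "\<And>x. x \<in> A \<Longrightarrow> y * (x - y) \<ge> 0" for A
  proof -
    have "(\<integral>x. indicat_real A x * normal_density 0 h x \<partial>lborel) \<le> (\<integral>x. gauss (y / h) * normal_density 0 h (x - y) \<partial>lborel)"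
    proof (rule integral_mono)
      fix x :: real
      show "indicat_real A x * normal_density 0 h x \<le> gauss (y / h) * normal_density 0 h (x - y)"
      proof (cases "x \<in> A")
        case True
        have "y\<^sup>2 + (x - y)\<^sup>2 \<le> x\<^sup>2" using A(2)[OF True] by (simp add: power2_eq_square algebra_simps)
        then have "- x\<^sup>2 / (2 * h\<^sup>2) \<le> - (y\<^sup>2 + (x - y)\<^sup>2) / (2 * h\<^sup>2)"
          by (intro divide_right_mono) auto
        also have "\<dots> = - (y / h)\<^sup>2 / 2 + - (x - y)\<^sup>2 / (2 * h\<^sup>2)"
          by (simp add: power_divide add_divide_distrib diff_divide_distrib)
        finally have "exp (- x\<^sup>2 / (2 * h\<^sup>2)) \<le> gauss (y / h) * exp (- (x - y)\<^sup>2 / (2 * h\<^sup>2))"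
          unfolding exp_add[symmetric] by (subst exp_le_cancel_iff)
        then have "1 / sqrt (2 * pi * h\<^sup>2) * exp (- x\<^sup>2 / (2 * h\<^sup>2)) \<le> 1 / sqrt (2 * pi * h\<^sup>2) * (gauss (y / h) * exp (- (x - y)\<^sup>2 / (2 * h\<^sup>2)))"
          by (intro mult_left_mono) auto
        then show ?thesis using True by (simp add: normal_density_def mult_ac)
      qed auto
    qed (use h shifti A in \<open>auto intro!: integrable_normal_part\<close>)
    then show ?thesis using shift by simp
  qed
  show ?thesis
  proof (cases "y \<ge> 0")
    case True
    have "1 - gauss_step h y = (\<integral>x. normal_density 0 h x - indicat_real {..y} x * normal_density 0 h x \<partial>lborel)"
      unfolding gauss_step_def dens[symmetric] using h
      by (intro bochner_diff[symmetric] integrable_normal_part) auto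
    also have "\<dots> = (\<integral>x. indicat_real {y<..} x * normal_density 0 h x \<partial>lborel)"
      by (intro bochner_cong) (auto simp: indicator_def)
    finally have eq: "1 - gauss_step h y = (\<integral>x. indicat_real {y<..} x * normal_density 0 h x \<partial>lborel)" .
    moreover have "\<dots> \<le> gauss (y / h)" by (rule tail) (use True in auto)
    moreover have "0 \<le> (\<integral>x. indicat_real {y<..} x * normal_density 0 h x \<partial>lborel)" by (intro bochner_nonneg) auto
    ultimately show ?thesis using True by simp
  next
    case False
    have "gauss_step h y \<le> gauss (y / h)" unfolding gauss_step_def
      by (rule tail) (use False in \<open>auto simp: mult_nonpos_nonpos\<close>)
    moreover have "0 \<le> gauss_step h y" unfolding gauss_step_def by (intro bochner_nonneg) auto
    ultimately show ?thesis using False by simp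
  qed
qed

section \<open>Laplace expansion along the imaginary axis\<close>

lemma gaussian_moment:
  fixes c :: real
  assumes c: "c > 0"
  shows "has_bochner_integral lborel (\<lambda>t. exp (- (c * t\<^sup>2) / 2) * t ^ (2 * m))
           (sqrt (2 * pi / c) * (fact (2 * m) / ((2 * c) ^ m * fact m)))"
    and "has_bochner_integral lborel (\<lambda>t. exp (- (c * t\<^sup>2) / 2) * t ^ (2 * m + 1)) 0"
proof -
  define \<sigma> where "\<sigma> = 1 / sqrt c"
  have \<sigma>: "\<sigma> > 0" "\<sigma>\<^sup>2 = 1 / c" using c by (auto simp: \<sigma>_def power_divide)
  have eq: "exp (- (c * t\<^sup>2) / 2) = sqrt (2 * pi / c) * normal_density 0 \<sigma> t" for t
    using c by (simp add: normal_density_def \<sigma> real_sqrt_divide real_sqrt_mult field_simps)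
  have "has_bochner_integral lborel (\<lambda>t. sqrt (2 * pi / c) * (normal_density 0 \<sigma> t * (t - 0) ^ (2 * m)))
     (sqrt (2 * pi / c) * (fact (2 * m) / ((2 / \<sigma>\<^sup>2) ^ m * fact m)))"
    by (intro has_bochner_integral_mult_right normal_moment_even \<sigma>)
  then show "has_bochner_integral lborel (\<lambda>t. exp (- (c * t\<^sup>2) / 2) * t ^ (2 * m))
     (sqrt (2 * pi / c) * (fact (2 * m) / ((2 * c) ^ m * fact m)))"
    unfolding eq by (simp add: \<sigma> mult_ac)
  have "has_bochner_integral lborel (\<lambda>t. sqrt (2 * pi / c) * (normal_density 0 \<sigma> t * (t - 0) ^ (2 * m + 1)))
     (sqrt (2 * pi / c) * 0)"
    by (intro has_bochner_integral_mult_right normal_moment_odd \<sigma>)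
  then show "has_bochner_integral lborel (\<lambda>t. exp (- (c * t\<^sup>2) / 2) * t ^ (2 * m + 1)) 0"
    unfolding eq by (simp add: mult_ac)
qed

text \<open>The remainder is \<open>w ^ N\<close> times the value of the shifted series, which is
  continuous at 0 and hence bounded nearby by its norm at 0 plus 1.\<close>

lemma fps_taylor_bound:
  fixes f :: "complex \<Rightarrow> complex"
  assumes "f has_fps_expansion F"
  shows "\<exists>C. \<forall>\<^sub>F w in nhds 0. norm (f w - (\<Sum>k<N. fps_nth F k * w ^ k)) \<le> C * norm w ^ N"
proof -
  have R: "fps_conv_radius F > 0" and ev: "\<forall>\<^sub>F w in nhds 0. eval_fps F w = f w"
    using assms by (auto simp: has_fps_expansion_def)
  define g where "g = eval_fps (fps_shift N F)"
  have "g has_fps_expansion fps_shift N F"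
    unfolding g_def using R by (intro eval_fps_has_fps_expansion) auto
  then have "isCont g 0" using has_fps_expansion_imp_continuous by blast
  then have "\<forall>\<^sub>F w in at 0. dist (g w) (g 0) < 1" using tendstoD[of g "g 0" "at 0" 1] by (simp add: isCont_def)
  then have g: "\<forall>\<^sub>F w in nhds 0. dist (g w) (g 0) < 1"
    by (auto simp: eventually_at_filter elim: eventually_mono)
  have "\<forall>\<^sub>F w in nhds (0::complex). w \<in> eball 0 (fps_conv_radius F)"
    using R by (intro eventually_nhds_in_open) (auto simp: zero_ereal_def)
  with ev g have "\<forall>\<^sub>F w in nhds 0. norm (f w - (\<Sum>k<N. fps_nth F k * w ^ k)) \<le> (norm (g 0) + 1) * norm w ^ N"
  proof eventually_elim
    case (elim w)
    have w: "norm w < fps_conv_radius F" using elim(3) by (simp add: in_eball_iff)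
    have "f w = (\<Sum>k. fps_nth F k * w ^ k)" using elim(1) by (simp add: eval_fps_def)
    also have "\<dots> = (\<Sum>k. fps_nth F (k + N) * w ^ (k + N)) + (\<Sum>k<N. fps_nth F k * w ^ k)"
      by (rule suminf_split_initial_segment[OF summable_fps[OF w]])
    also have "(\<Sum>k. fps_nth F (k + N) * w ^ (k + N)) = (\<Sum>k. w ^ N * (fps_nth (fps_shift N F) k * w ^ k))"
      by (simp add: power_add mult_ac)
    also have "\<dots> = w ^ N * g w" unfolding g_def eval_fps_def
      by (rule suminf_mult[OF summable_fps]) (use w in auto)
    finally have "norm (f w - (\<Sum>k<N. fps_nth F k * w ^ k)) = norm (g w) * norm w ^ N"
      by (simp add: norm_mult norm_power mult.commute)
    also have "norm (g w) \<le> norm (g 0) + 1"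
      using elim(2) norm_triangle_ineq2[of "g w" "g 0"] by (simp add: dist_norm)
    finally show ?case by (simp add: mult_right_mono)
  qed
  then show ?thesis by blast
qed

abbreviation on_axis :: "real \<Rightarrow> (complex \<Rightarrow> complex) \<Rightarrow> real \<Rightarrow> complex" where
  "on_axis \<delta> G t \<equiv> indicat_real {-\<delta>..\<delta>} t *\<^sub>R G (\<i> * of_real t)"

text \<open>The correction of relative order 1/n. Its three terms come from the Gaussian moments of
  order 2, 4 and 6, which are 1, 3 and 15 times powers of 1/(nc); the alternating signs are those of
  the even powers of \<open>\<i>\<close>.\<close>

definition laplace_coeff :: "real \<Rightarrow> complex fps \<Rightarrow> complex fps \<Rightarrow> complex" where
  "laplace_coeff c F H = - fps_nth H 2 / of_real c
     + 3 * (fps_nth F 3 * fps_nth H 1 + fps_nth F 4 * fps_nth H 0) / of_real c ^ 2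
     - 15 * fps_nth F 3 ^ 2 * fps_nth H 0 / (2 * of_real c ^ 3)"

text \<open>With \<open>\<kappa> w = c w\<^sup>2 / 2 + w\<^sup>3 q w\<close>, the factor \<open>exp (n w\<^sup>3 q w)\<close> is expanded to third order and
  \<open>q ^ j * G\<close> to order \<open>4 - j\<close>; then every remainder is a Gaussian moment of the form
  \<open>n ^ j * t ^ (2 * j + 4)\<close>, of size \<open>n powr (-5/2)\<close>, and the odd terms vanish by symmetry.\<close>

theorem laplace_expansion:
  fixes \<kappa> G :: "complex \<Rightarrow> complex" and c \<epsilon> :: real
  assumes \<kappa>: "\<kappa> has_fps_expansion F" and G: "G has_fps_expansion H"
    and F: "fps_nth F 0 = 0" "fps_nth F 1 = 0" "fps_nth F 2 = of_real (c / 2)" and c: "c > 0"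
    and \<epsilon>: "\<epsilon> > 0"
  obtains \<delta> C :: real where "0 < \<delta>" "\<delta> \<le> \<epsilon>"
    "integrable lborel (\<lambda>t. on_axis \<delta> G t)"
    "\<And>n::nat. n \<ge> 1 \<Longrightarrow>
       norm ((\<integral>t. indicat_real {-\<delta>..\<delta>} t *\<^sub>R (exp (n * \<kappa> (\<i> * of_real t)) * G (\<i> * of_real t)) \<partial>lborel)
         - sqrt (2 * pi / (n * c)) *\<^sub>R (fps_nth H 0 + laplace_coeff c F H / n)) \<le> C * (1 / (n\<^sup>2 * sqrt n))"
proof -
  define Fq where "Fq = fps_shift 3 F"
  define q where "q = eval_fps Fq"
  have R: "fps_conv_radius F > 0" and evF: "\<forall>\<^sub>F w in nhds 0. eval_fps F w = \<kappa> w"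
    using \<kappa> by (auto simp: has_fps_expansion_def)
  have q: "q has_fps_expansion Fq"
    unfolding q_def Fq_def using R by (intro eval_fps_has_fps_expansion) auto
  have "\<forall>\<^sub>F w in nhds (0::complex). w \<in> eball 0 (fps_conv_radius F)"
    using R by (intro eventually_nhds_in_open) (auto simp: zero_ereal_def)
  with evF have ev\<kappa>: "\<forall>\<^sub>F w in nhds 0. \<kappa> w = of_real (c / 2) * w\<^sup>2 + w ^ 3 * q w"
  proof eventually_elim
    case (elim w)
    have w: "norm w < fps_conv_radius F" using elim(2) by (simp add: in_eball_iff)
    have "\<kappa> w = (\<Sum>k. fps_nth F k * w ^ k)" using elim(1) by (simp add: eval_fps_def)
    also have "\<dots> = (\<Sum>k. fps_nth F (k + 3) * w ^ (k + 3)) + (\<Sum>k<3. fps_nth F k * w ^ k)"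
      by (rule suminf_split_initial_segment[OF summable_fps[OF w]])
    also have "(\<Sum>k. fps_nth F (k + 3) * w ^ (k + 3)) = (\<Sum>k. w ^ 3 * (fps_nth Fq k * w ^ k))"
      by (simp add: Fq_def power_add mult_ac)
    also have "\<dots> = w ^ 3 * q w" unfolding q_def eval_fps_def
      by (rule suminf_mult[OF summable_fps]) (use w in \<open>auto simp: Fq_def\<close>)
    finally show ?case using F by (simp add: eval_nat_numeral)
  qed
  \<comment> \<open>\<open>B j\<close> is the coefficient of \<open>(n * w ^ 3) ^ j\<close> in the
    expansion of \<open>exp (n * w ^ 3 * q w) * G w\<close>.\<close>
  define B where "B = (\<lambda>(j::nat) w. q w ^ j * G w * (1 / fact j))"
  define FB where "FB = (\<lambda>j. Fq ^ j * H * fps_const (1 / fact j))"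
  have B: "B j has_fps_expansion FB j" for j
    unfolding B_def FB_def by (intro fps_expansion_intros q G)
  define b where "b = (\<lambda>j k. fps_nth (FB j) k)"
  have "\<forall>j. \<exists>C. \<forall>\<^sub>F w in nhds 0. norm (B j w - (\<Sum>k<4-j. b j k * w ^ k)) \<le> C * norm w ^ (4 - j)"
    unfolding b_def by (intro allI fps_taylor_bound[OF B])
  then obtain CB where CB: "\<And>j. \<forall>\<^sub>F w in nhds 0. norm (B j w - (\<Sum>k<4-j. b j k * w ^ k)) \<le> CB j * norm w ^ (4 - j)"
    unfolding choice_iff by blast
  obtain Q where Q: "\<forall>\<^sub>F w in nhds 0. norm (q w) \<le> Q"
    using fps_taylor_bound[OF q, of 0] by auto
  obtain \<Gamma> where \<Gamma>: "\<forall>\<^sub>F w in nhds 0. norm (G w) \<le> \<Gamma>"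
    using fps_taylor_bound[OF G, of 0] by auto
  obtain S where S: "open S" "0 \<in> S" "\<kappa> holomorphic_on S" using has_fps_expansion_imp_holomorphic[OF \<kappa>] by metis
  obtain S' where S': "open S'" "0 \<in> S'" "G holomorphic_on S'" using has_fps_expansion_imp_holomorphic[OF G] by metis
  have evS: "\<forall>\<^sub>F w in nhds 0. w \<in> S \<inter> S'"
    using S S' by (intro eventually_nhds_in_open) auto
  have "\<forall>\<^sub>F w in nhds 0. \<forall>j\<in>{..<4}. norm (B j w - (\<Sum>k<4-j. b j k * w ^ k)) \<le> CB j * norm w ^ (4 - j)"
    by (intro eventually_ball_finite CB ballI) auto
  from this evS Q \<Gamma> ev\<kappa> have "\<forall>\<^sub>F w in nhds 0. (\<forall>j<4. norm (B j w - (\<Sum>k<4-j. b j k * w ^ k)) \<le> CB j * norm w ^ (4 - j)) \<and>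
     norm (q w) \<le> Q \<and> norm (G w) \<le> \<Gamma> \<and> \<kappa> w = of_real (c / 2) * w\<^sup>2 + w ^ 3 * q w \<and> w \<in> S \<inter> S'"
    by eventually_elim auto
  then obtain \<delta>0 where \<delta>0: "\<delta>0 > 0" and near: "\<And>w. norm w < \<delta>0 \<Longrightarrow> 
     (\<forall>j<4. norm (B j w - (\<Sum>k<4-j. b j k * w ^ k)) \<le> CB j * norm w ^ (4 - j)) \<and>
     norm (q w) \<le> Q \<and> norm (G w) \<le> \<Gamma> \<and> \<kappa> w = of_real (c / 2) * w\<^sup>2 + w ^ 3 * q w \<and> w \<in> S \<inter> S'"
    unfolding eventually_nhds_metric by (auto simp: dist_norm)
  have Q0: "Q \<ge> 0" and \<Gamma>0: "\<Gamma> \<ge> 0"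
    using near[of 0] \<delta>0 norm_ge_zero order_trans by (metis norm_zero)+
  \<comment> \<open>\<open>\<delta>0 / 2\<close> keeps the closed window where the Taylor bounds
    hold. The last entry makes \<open>\<bar>t\<bar> * Q\<close> at most \<open>c / 4\<close>, so
    that the cubic remainder costs at most half of the Gaussian exponent; the summand 1 avoids
    division by 0.\<close>
  define \<delta> where "\<delta> = min \<epsilon> (min (\<delta>0 / 2) (c / (4 * (Q + 1))))"
  have \<delta>: "0 < \<delta>" "\<delta> \<le> \<epsilon>" "\<delta> < \<delta>0" using \<epsilon> \<delta>0 c Q0 by (auto simp: \<delta>_def)
  have \<delta>Q: "\<delta> * Q \<le> c / 4"
  proof -
    have "\<delta> * Q \<le> c / (4 * (Q + 1)) * (Q + 1)" using \<delta> Q0 c by (intro mult_mono) (auto simp: \<delta>_def)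
    also have "\<dots> = c / 4" using Q0 by (simp add: field_simps)
    finally show ?thesis .
  qed
  \<comment> \<open>Outside the window \<bar>t\<bar> / \<delta> is at least 1, so
    \<open>\<bar>t\<bar> ^ k\<close> is at most
    \<open>\<bar>t\<bar> ^ (4 - j) / \<delta> ^ (4 - j - k)\<close>. This lets the Taylor polynomial
    be charged there to the same powers of \<open>t\<close> as the remainder inside.\<close>
  define E where "E = (\<lambda>j. \<Sum>k<4-j. norm (b j k) / \<delta> ^ (4 - j - k))"
  define D where "D = (\<lambda>j. if j < 4 then \<bar>CB j\<bar> + E j else Q ^ 4 * \<Gamma>)"
  have E0: "E j \<ge> 0" for j unfolding E_def using \<delta> by (intro sum_nonneg) auto
  have D0: "D j \<ge> 0" for j using E0[of j] \<Gamma>0 Q0 by (auto simp: D_def)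
  define I where "I = (\<lambda>n::nat. \<lambda>t. indicat_real {-\<delta>..\<delta>} t *\<^sub>R (exp (n * \<kappa> (\<i> * t)) * G (\<i> * t)))"
  \<comment> \<open>The approximant lives on the whole line, so that its integral consists of exact
    Gaussian moments.\<close>
  define P where "P = (\<lambda>n::nat. \<lambda>t. \<Sum>j<4. \<Sum>k<4-j. (of_nat n ^ j * b j k * \<i> ^ (3 * j + k)) * of_real (exp (- (n * c * t\<^sup>2) / 2) * t ^ (3 * j + k)))"
  \<comment> \<open>The rate \<open>n * c / 2\<close> is what remains of \<open>n * c\<close> after
    \<open>exp (norm z)\<close> has consumed its half. The terms \<open>j < 4\<close> carry the
    Taylor errors, and \<open>j = 4\<close> the remainder of the exponential.\<close>
  define W where "W = (\<lambda>n::nat. \<lambda>t. \<Sum>j<5. D j * real n ^ j * (exp (- (n * c / 2 * t\<^sup>2) / 2) * t ^ (2 * (j + 2))))"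
  have bound: "norm (I n t - P n t) \<le> W n t" if n: "n \<ge> 1" for n :: nat and t :: real
  proof -
    have P_eq: "P n t = of_real (exp (- (n * c * t\<^sup>2) / 2)) * (\<Sum>j<4. of_nat n ^ j * (\<i> * t) ^ (3 * j) * (\<Sum>k<4-j. b j k * (\<i> * t) ^ k))"
      unfolding P_def sum_distrib_left
      by (intro sum.cong refl) (simp add: power_mult_distrib power_add mult_ac)
    have gle: "exp (- (n * c * t\<^sup>2) / 2) \<le> exp (- (n * c / 2 * t\<^sup>2) / 2)"
      using c by (simp add: field_simps)
    let ?e1 = "exp (- (n * c * t\<^sup>2) / 2)" and ?e2 = "exp (- (n * c / 2 * t\<^sup>2) / 2)"
    have ee: "?e1 * exp (n * c * t\<^sup>2 / 4) = ?e2"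
      unfolding exp_add[symmetric] by (rule arg_cong[where f=exp]) (simp add: field_simps)
    have pw: "t ^ (2 * (j + 2)) = \<bar>t\<bar> ^ (2 * j + 4)" for j
    proof -
      have e: "2 * (j + 2) = 2 * j + 4" by simp
      show ?thesis unfolding e by (rule power_even_abs[symmetric]) simp
    qed
    have W_eq: "W n t = ?e2 * (\<Sum>j<4. D j * real n ^ j * \<bar>t\<bar> ^ (2 * j + 4))
        + ?e2 * (D 4 * real n ^ 4 * \<bar>t\<bar> ^ 12)"
    proof -
      have "W n t = (\<Sum>j<Suc 4. D j * real n ^ j * (?e2 * \<bar>t\<bar> ^ (2 * j + 4)))"
        unfolding W_def pw by simp
      also have "\<dots> = (\<Sum>j<4. D j * real n ^ j * (?e2 * \<bar>t\<bar> ^ (2 * j + 4)))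
          + D 4 * real n ^ 4 * (?e2 * \<bar>t\<bar> ^ 12)"
        unfolding sum.lessThan_Suc by simp
      finally show ?thesis unfolding sum_distrib_left by (simp only: mult_ac)
    qed
    have pw0: "\<bar>t\<bar> ^ (2 * j + 4) = \<bar>t\<bar> ^ (3 * j) * \<bar>t\<bar> ^ (4 - j)" if "j < 4" for j :: nat
      using that by (simp flip: power_add)
    show ?thesis
    proof (cases "\<bar>t\<bar> \<le> \<delta>")
      case True
      define w where "w = \<i> * of_real t"
      have nw: "norm w = \<bar>t\<bar>" by (simp add: w_def norm_mult)
      have w2: "w\<^sup>2 = - (of_real (t\<^sup>2))" by (simp add: w_def power_mult_distrib)
      note nr = near[of w, unfolded nw]
      have nr': "\<bar>t\<bar> < \<delta>0" using True \<delta> by simp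
      define z where "z = of_nat n * w ^ 3 * q w"
      have zn: "norm z \<le> n * \<bar>t\<bar> ^ 3 * Q"
        unfolding z_def using nr nr' by (auto simp: norm_mult norm_power nw intro!: mult_mono)
      also have "\<dots> = n * t\<^sup>2 * (\<bar>t\<bar> * Q)" by (simp add: power3_eq_cube power2_eq_square)
      also have "\<dots> \<le> n * t\<^sup>2 * (c / 4)"
        using True \<delta>Q Q0 by (intro mult_left_mono order_trans[OF mult_right_mono[OF True] \<delta>Q]) auto
      finally have zn2: "norm z \<le> n * c * t\<^sup>2 / 4" by (simp add: mult_ac)
      have "\<kappa> w = of_real (c / 2) * w\<^sup>2 + w ^ 3 * q w" using nr nr' by blast
      then have "of_nat n * \<kappa> w = of_nat n * (of_real (c / 2) * w\<^sup>2 + w ^ 3 * q w)" by simp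
      also have "\<dots> = of_real (- (n * c * t\<^sup>2) / 2) + z"
        by (simp add: z_def w2 algebra_simps)
      finally have "of_nat n * \<kappa> w = of_real (- (n * c * t\<^sup>2) / 2) + z" .
      then have ex: "exp (n * \<kappa> w) = of_real (?e1) * exp z"
        by (simp only: exp_add exp_of_real)
      have I_eq: "I n t = of_real (?e1) * exp z * G w"
        using True ex by (simp add: I_def w_def indicator_def abs_le_iff)
      let ?B = "\<Sum>j<4. of_nat n ^ j * w ^ (3 * j) * B j w"
      let ?b = "\<Sum>j<4. of_nat n ^ j * w ^ (3 * j) * (\<Sum>k<4-j. b j k * w ^ k)"
      have Bz: "(\<Sum>j\<le>3. z ^ j / fact j) * G w = ?B"
        unfolding sum_distrib_right
        by (rule sum.cong) (auto simp: B_def z_def power_mult_distrib power_mult)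
      have t1: "norm (exp z * G w - ?B) \<le> exp (n * c * t\<^sup>2 / 4) * (real n ^ 4 * \<bar>t\<bar> ^ 12 * (Q ^ 4 * \<Gamma>))"
      proof -
        have "norm (exp z - (\<Sum>j\<le>3. z ^ j / fact j)) \<le> exp (norm z) * (norm z ^ Suc 3) / fact 3"
          by (rule Taylor_exp_field)
        also have "\<dots> \<le> exp (norm z) * norm z ^ 4" by (simp add: eval_nat_numeral fact_numeral)
        also have "\<dots> \<le> exp (n * c * t\<^sup>2 / 4) * (n * \<bar>t\<bar> ^ 3 * Q) ^ 4"
          using zn zn2 by (intro mult_mono power_mono) auto
        finally have "norm ((exp z - (\<Sum>j\<le>3. z ^ j / fact j)) * G w) \<le> exp (n * c * t\<^sup>2 / 4) * (n * \<bar>t\<bar> ^ 3 * Q) ^ 4 * \<Gamma>"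
          unfolding norm_mult using nr nr' by (intro mult_mono) auto
        then show ?thesis
          unfolding left_diff_distrib Bz by (simp add: power_mult_distrib mult_ac flip: power_mult)
      qed
      have t2: "norm (?B - ?b)
          \<le> (\<Sum>j<4. \<bar>CB j\<bar> * real n ^ j * \<bar>t\<bar> ^ (2 * j + 4))"
        unfolding sum_subtractf[symmetric] right_diff_distrib[symmetric]
      proof (rule sum_norm_le)
        fix j :: nat assume j: "j \<in> {..<4}"
        have "norm (B j w - (\<Sum>k<4-j. b j k * w ^ k)) \<le> \<bar>CB j\<bar> * \<bar>t\<bar> ^ (4 - j)"
          using nr nr' j by (auto intro: order_trans[OF _ mult_right_mono[OF abs_ge_self]])
        then have "real n ^ j * \<bar>t\<bar> ^ (3 * j) * norm (B j w - (\<Sum>k<4-j. b j k * w ^ k)) \<le> real n ^ j * \<bar>t\<bar> ^ (3 * j) * (\<bar>CB j\<bar> * \<bar>t\<bar> ^ (4 - j))"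
          by (intro mult_left_mono) auto
        then show "norm (of_nat n ^ j * w ^ (3 * j) * (B j w - (\<Sum>k<4-j. b j k * w ^ k))) \<le> \<bar>CB j\<bar> * real n ^ j * \<bar>t\<bar> ^ (2 * j + 4)"
          unfolding pw0[OF j[unfolded lessThan_iff]] by (simp add: norm_mult norm_power nw mult_ac)
      qed
      have dec: "I n t - P n t = of_real (?e1) * ((exp z * G w - ?B)
          + (?B - ?b))"
        unfolding I_eq P_eq w_def[symmetric] by (simp add: algebra_simps)
      have "norm (I n t - P n t) \<le> ?e1 * (exp (n * c * t\<^sup>2 / 4) * (real n ^ 4 * \<bar>t\<bar> ^ 12 * (Q ^ 4 * \<Gamma>))
          + (\<Sum>j<4. \<bar>CB j\<bar> * real n ^ j * \<bar>t\<bar> ^ (2 * j + 4)))"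
        unfolding dec norm_mult[of "complex_of_real _"] norm_of_real abs_exp_cancel
        by (rule mult_left_mono[OF norm_triangle_mono[OF t1 t2]]) simp
      also have "\<dots> = ?e2 * (real n ^ 4 * \<bar>t\<bar> ^ 12 * (Q ^ 4 * \<Gamma>))
          + ?e1 * (\<Sum>j<4. \<bar>CB j\<bar> * real n ^ j * \<bar>t\<bar> ^ (2 * j + 4))"
        by (simp only: distrib_left mult.assoc[symmetric] ee)
      also have "\<dots> \<le> ?e2 * (real n ^ 4 * \<bar>t\<bar> ^ 12 * (Q ^ 4 * \<Gamma>))
          + ?e2 * (\<Sum>j<4. D j * real n ^ j * \<bar>t\<bar> ^ (2 * j + 4))"
        using E0 by (intro add_left_mono mult_mono gle sum_mono mult_right_mono sum_nonneg) (auto simp: D_def)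
      also have "\<dots> = W n t"
        unfolding W_eq by (simp add: D_def mult_ac)
      finally show ?thesis .
    next
      case False
      then have I0: "I n t = 0" by (auto simp: I_def indicator_def abs_le_iff)
      have tp: "\<bar>t\<bar> \<ge> \<delta>" "\<bar>t\<bar> / \<delta> \<ge> 1" using False \<delta> by auto
      have "norm (P n t) \<le> ?e1 * (\<Sum>j<4. E j * real n ^ j * \<bar>t\<bar> ^ (2 * j + 4))"
        unfolding P_eq norm_mult norm_of_real abs_exp_cancel
      proof (intro mult_left_mono sum_norm_le)
        fix j :: nat assume j: "j \<in> {..<4}"
        have "norm (\<Sum>k<4-j. b j k * (\<i> * t) ^ k) \<le> (\<Sum>k<4-j. norm (b j k) / \<delta> ^ (4 - j - k) * \<bar>t\<bar> ^ (4 - j))"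
        proof (rule sum_norm_le)
          fix k assume k: "k \<in> {..<4-j}"
          have "\<bar>t\<bar> ^ k * 1 \<le> \<bar>t\<bar> ^ k * (\<bar>t\<bar> / \<delta>) ^ (4 - j - k)"
            using tp by (intro mult_left_mono one_le_power) auto
          also have "\<dots> = \<bar>t\<bar> ^ (k + (4 - j - k)) / \<delta> ^ (4 - j - k)" by (simp add: power_divide power_add)
          also have "k + (4 - j - k) = 4 - j" using k by auto
          finally have "norm (b j k) * \<bar>t\<bar> ^ k \<le> norm (b j k) * (\<bar>t\<bar> ^ (4 - j) / \<delta> ^ (4 - j - k))"
            by (intro mult_left_mono) auto
          then show "norm (b j k * (\<i> * t) ^ k) \<le> norm (b j k) / \<delta> ^ (4 - j - k) * \<bar>t\<bar> ^ (4 - j)"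
            by (simp add: norm_mult norm_power)
        qed
        also have "\<dots> = E j * \<bar>t\<bar> ^ (4 - j)" by (simp add: E_def sum_distrib_right)
        finally have "real n ^ j * \<bar>t\<bar> ^ (3 * j) * norm (\<Sum>k<4-j. b j k * (\<i> * t) ^ k) \<le> real n ^ j * \<bar>t\<bar> ^ (3 * j) * (E j * \<bar>t\<bar> ^ (4 - j))"
          by (intro mult_left_mono) auto
        then show "norm (of_nat n ^ j * (\<i> * t) ^ (3 * j) * (\<Sum>k<4-j. b j k * (\<i> * t) ^ k)) \<le> E j * real n ^ j * \<bar>t\<bar> ^ (2 * j + 4)"
          unfolding pw0[OF j[unfolded lessThan_iff]] by (simp add: norm_mult norm_power mult_ac)
      qed auto
      also have "\<dots> \<le> ?e2 * (\<Sum>j<4. D j * real n ^ j * \<bar>t\<bar> ^ (2 * j + 4))"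
        using E0 by (intro mult_mono gle sum_mono mult_right_mono sum_nonneg) (auto simp: D_def)
      also have "\<dots> \<le> \<dots> + ?e2 * (D 4 * real n ^ 4 * \<bar>t\<bar> ^ 12)"
        using D0[of 4] by simp
      also have "\<dots> = W n t"
        unfolding W_eq ..
      finally show ?thesis by (simp add: I0)
    qed
  qed
  define CW where "CW = (\<Sum>j<5. D j * (sqrt (4 * pi / c) * (fact (2 * (j + 2)) / (c ^ (j + 2) * fact (j + 2)))))"
  have W: "has_bochner_integral lborel (W n) (CW * (1 / (n\<^sup>2 * sqrt n)))" if n: "n \<ge> 1" for n :: nat
  proof -
    have "has_bochner_integral lborel (W n) (\<Sum>j<5. D j * real n ^ j * (sqrt (2 * pi / (n * c / 2)) * (fact (2 * (j + 2)) / ((2 * (n * c / 2)) ^ (j + 2) * fact (j + 2)))))"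
      unfolding W_def using n c by (intro has_bochner_integral_sum has_bochner_integral_mult_right gaussian_moment) auto
    also have "(\<Sum>j<5. D j * real n ^ j * (sqrt (2 * pi / (n * c / 2)) * (fact (2 * (j + 2)) / ((2 * (n * c / 2)) ^ (j + 2) * fact (j + 2)))))
        = CW * (1 / (n\<^sup>2 * sqrt n))"
      unfolding CW_def sum_distrib_right
    proof (rule sum.cong)
      fix j :: nat
      have s1: "sqrt (2 * pi / (n * c / 2)) = sqrt (4 * pi / c) * (1 / sqrt n)"
        by (simp add: real_sqrt_mult real_sqrt_divide)
      have s2: "real n ^ j / (2 * (n * c / 2)) ^ (j + 2) = 1 / c ^ (j + 2) * (1 / n\<^sup>2)"
        using n by (simp add: power_mult_distrib power_add power2_eq_square)
      have gen: "d * x * (s * (f / (y * g))) = d * s * (f / g) * (x / y)"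
        "d * (s * (1 / x)) * (f / g) * (1 / y * (1 / z)) = d * (s * (f / (y * g))) * (1 / (z * x))" for d x s f y g z :: real
        by (simp_all add: mult_ac)
      show "D j * real n ^ j * (sqrt (2 * pi / (n * c / 2)) * (fact (2 * (j + 2)) / ((2 * (n * c / 2)) ^ (j + 2) * fact (j + 2)))) =
         D j * (sqrt (4 * pi / c) * (fact (2 * (j + 2)) / (c ^ (j + 2) * fact (j + 2)))) * (1 / (n\<^sup>2 * sqrt n))"
        unfolding gen(1) s1 s2 by (rule gen(2))
    qed simp
    finally show ?thesis .
  qed
  \<comment> \<open>These are the only pairs in the double sum with \<open>3 * j + k\<close> even;
    the other moments vanish.\<close>
  have b_vals: "b 0 0 = fps_nth H 0" "b 0 2 = fps_nth H 2" "b 1 1 = fps_nth F 3 * fps_nth H 1 + fps_nth F 4 * fps_nth H 0"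
     "b 2 0 = fps_nth F 3 ^ 2 * fps_nth H 0 / 2"
    by (auto simp: b_def FB_def Fq_def fps_mult_nth power2_eq_square numeral_eq_Suc)
  have Pint: "has_bochner_integral lborel (P n) (sqrt (2 * pi / (n * c)) *\<^sub>R (fps_nth H 0 + laplace_coeff c F H / n))" if n: "n \<ge> 1" for n :: nat
  proof -
    define mom where "mom = (\<lambda>l. if even l then sqrt (2 * pi / (n * c)) * (fact l / ((2 * (n * c)) ^ (l div 2) * fact (l div 2))) else 0)"
    have mom: "has_bochner_integral lborel (\<lambda>t. exp (- (n * c * t\<^sup>2) / 2) * t ^ l) (mom l)" for l
    proof (cases "even l")
      case True
      then obtain m where "l = 2 * m" by auto
      then show ?thesis using gaussian_moment(1)[of "n * c" m] n c by (simp add: mom_def)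
    next
      case False
      then obtain m where "l = 2 * m + 1" using oddE by blast
      then show ?thesis using gaussian_moment(2)[of "n * c" m] n c by (simp add: mom_def)
    qed
    have expand: "(\<Sum>j<4. \<Sum>k<4-j. f j k) = f 0 0 + f 0 1 + f 0 2 + f 0 3 + f 1 0 + f 1 1 + f 1 2 + f 2 0 + f 2 1 + f 3 0"
      for f :: "nat \<Rightarrow> nat \<Rightarrow> complex"
      by (simp add: numeral_eq_Suc)
    have odd_mom: "mom 1 = 0" "mom (Suc 0) = 0" "mom 3 = 0" "mom 5 = 0" "mom 7 = 0" "mom 9 = 0"
      by (simp_all add: mom_def)
    have ipow: "\<i> ^ 2 = -1" "\<i> ^ 4 = 1" "\<i> ^ 6 = -1"
      by (simp_all add: eval_nat_numeral)
    have "has_bochner_integral lborel (P n) (\<Sum>j<4. \<Sum>k<4-j. (of_nat n ^ j * b j k * \<i> ^ (3 * j + k)) * of_real (mom (3 * j + k)))"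
      unfolding P_def
      by (intro has_bochner_integral_sum has_bochner_integral_mult_right has_bochner_integral_of_real mom)
    also have "(\<Sum>j<4. \<Sum>k<4-j. (of_nat n ^ j * b j k * \<i> ^ (3 * j + k)) * of_real (mom (3 * j + k)))
      = b 0 0 * of_real (mom 0) - b 0 2 * of_real (mom 2) + of_nat n * b 1 1 * of_real (mom 4) - of_nat n ^ 2 * b 2 0 * of_real (mom 6)"
      unfolding expand using odd_mom ipow by (simp add: numeral_2_eq_2[symmetric])
    also have "\<dots> = sqrt (2 * pi / (n * c)) *\<^sub>R (fps_nth H 0 + laplace_coeff c F H / n)"
    proof -
      define S where "S = complex_of_real (sqrt (2 * pi / (n * c)))"
      define N C where "N = complex_of_nat n" and "C = complex_of_real c"
      have NC: "N \<noteq> 0" "C \<noteq> 0" using n c by (auto simp: N_def C_def)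
      have m0: "complex_of_real (mom 0) = S" by (simp add: mom_def S_def)
      have m2: "complex_of_real (mom 2) = S * (1 / (N * C))"
        by (simp add: mom_def S_def N_def C_def fact_numeral)
      have m4: "complex_of_real (mom 4) = S * (3 / (N * C)\<^sup>2)"
      proof -
        have "mom 4 = sqrt (2 * pi / (n * c)) * (3 / (n * c)\<^sup>2)"
          by (simp add: mom_def fact_numeral power_mult_distrib)
        then show ?thesis by (simp add: S_def N_def C_def)
      qed
      have m6: "complex_of_real (mom 6) = S * (15 / (N * C) ^ 3)"
      proof -
        have "mom 6 = sqrt (2 * pi / (n * c)) * (15 / (n * c) ^ 3)"
          by (simp add: mom_def fact_numeral power_mult_distrib)
        then show ?thesis by (simp add: S_def N_def C_def)
      qed
      have e2: "1 / (N * C) = 1 / C / N" and e4: "N * (3 / (N * C)\<^sup>2) = 3 / C\<^sup>2 / N"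
        and e6: "N\<^sup>2 * (15 / (N * C) ^ 3) = 15 / C ^ 3 / N"
        using NC by (simp_all add: power2_eq_square power3_eq_cube)
      have "b 0 0 * S - b 0 2 * (S * (1 / (N * C))) + N * b 1 1 * (S * (3 / (N * C)\<^sup>2)) - N\<^sup>2 * b 2 0 * (S * (15 / (N * C) ^ 3))
        = S * (b 0 0 - b 0 2 * (1 / (N * C)) + b 1 1 * (N * (3 / (N * C)\<^sup>2)) - b 2 0 * (N\<^sup>2 * (15 / (N * C) ^ 3)))"
        by (simp only: right_diff_distrib distrib_left mult_ac)
      also have "\<dots> = S * (fps_nth H 0 + (- (fps_nth H 2 / C) + 3 * (fps_nth F 3 * fps_nth H 1 + fps_nth F 4 * fps_nth H 0) / C\<^sup>2
           - 15 * (fps_nth F 3)\<^sup>2 * fps_nth H 0 / (2 * C ^ 3)) / N)"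
        unfolding e2 e4 e6 b_vals by (simp add: add_divide_distrib diff_divide_distrib mult_ac)
      finally show ?thesis
        unfolding m0 m2 m4 m6 N_def[symmetric] by (simp add: laplace_coeff_def scaleR_conv_of_real S_def C_def N_def)
    qed
    finally show ?thesis .
  qed
  have inS: "\<i> * of_real t \<in> S \<inter> S'" if "t \<in> {-\<delta>..\<delta>}" for t
  proof -
    have "norm (\<i> * of_real t) < \<delta>0" using that \<delta> by (auto simp: norm_mult abs_less_iff)
    from near[OF this] show ?thesis by blast
  qed
  have sub: "(\<lambda>t. \<i> * of_real t) ` {-\<delta>..\<delta>} \<subseteq> S" "(\<lambda>t. \<i> * of_real t) ` {-\<delta>..\<delta>} \<subseteq> S'"
    using inS by blast+
  have lin: "continuous_on {-\<delta>..\<delta>} (\<lambda>t. \<i> * of_real t)" by (intro continuous_intros)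
  have cont: "continuous_on {-\<delta>..\<delta>} (\<lambda>t. \<kappa> (\<i> * t))" "continuous_on {-\<delta>..\<delta>} (\<lambda>t. G (\<i> * t))"
    by (rule continuous_on_compose2[OF holomorphic_on_imp_continuous_on[OF S(3)] lin sub(1)],
        rule continuous_on_compose2[OF holomorphic_on_imp_continuous_on[OF S'(3)] lin sub(2)])
  have Gint: "integrable lborel (\<lambda>t. on_axis \<delta> G t)"
    by (intro borel_integrable_compact cont) auto
  have Iint: "integrable lborel (I n)" for n
    unfolding I_def by (intro borel_integrable_compact continuous_intros cont) auto
  show thesis
  proof (rule that[OF \<delta>(1,2) Gint])
    fix n :: nat assume n: "n \<ge> 1"
    have "(\<integral>t. I n t \<partial>lborel) - sqrt (2 * pi / (n * c)) *\<^sub>R (fps_nth H 0 + laplace_coeff c F H / n) = (\<integral>t. I n t - P n t \<partial>lborel)"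
      using Pint[OF n] Iint[of n] by (simp add: has_bochner_integral_iff)
    also have "norm \<dots> \<le> (\<integral>t. norm (I n t - P n t) \<partial>lborel)" by (rule integral_norm_bound)
    also have "\<dots> \<le> (\<integral>t. W n t \<partial>lborel)"
      using Pint[OF n] Iint[of n] W[OF n] bound[OF n] by (intro integral_mono) (auto simp: has_bochner_integral_iff)
    also have "\<dots> = CW * (1 / (n\<^sup>2 * sqrt n))" using W[OF n] by (rule has_bochner_integral_integral_eq)
    finally show "norm ((\<integral>t. indicat_real {-\<delta>..\<delta>} t *\<^sub>R (exp (n * \<kappa> (\<i> * t)) * G (\<i> * t)) \<partial>lborel)
         - sqrt (2 * pi / (n * c)) *\<^sub>R (fps_nth H 0 + laplace_coeff c F H / n)) \<le> CW * (1 / (n\<^sup>2 * sqrt n))"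
      by (simp add: I_def)
  qed
qed

section \<open>Expectations of smoothed steps and Gaussians as integrals along a vertical
  line\<close>

lemma measurable_gauss_step [measurable]: "gauss_step h \<in> borel_measurable borel"
proof -
  have "gauss_step h = (\<lambda>y. \<integral>x. (if x \<le> y then normal_density 0 h x else 0) \<partial>lborel)"
    unfolding gauss_step_def[abs_def] by (intro ext bochner_cong) (auto simp: indicator_def)
  also have "\<dots> \<in> borel_measurable borel" by measurable
  finally show ?thesis .
qed

lemma abs_gauss_step_le:
  assumes "h > 0"
  shows "\<bar>gauss_step h y\<bar> \<le> 2"
proof -
  have "gauss (y / h) \<le> 1" by simp
  then have "\<bar>indicat_real {0..} y - gauss_step h y\<bar> \<le> 1"
    using gauss_step_error_le[OF assms, of y] by linarith
  then show ?thesis by (cases "y \<ge> 0") auto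
qed

text \<open>The mean of \<open>U\<close> being zero removes both the additive constant of \<open>gauss_step\<close> and the pole of
  the integrand at 0, so the formula is valid on every vertical line, whatever the sign of \<open>\<eta>\<close>.\<close>

lemma integral_gauss_step_fourier:
  fixes U T :: "'a \<Rightarrow> real"
  assumes M: "prob_space M" and [measurable]: "U \<in> borel_measurable M" "T \<in> borel_measurable M"
    and U: "integrable M U" "(\<integral>x. U x \<partial>M) = 0"
    and UT: "integrable M (\<lambda>x. U x * exp (\<eta> * T x))" "integrable M (\<lambda>x. U x * T x)"
      "integrable M (\<lambda>x. U x * T x * exp (\<eta> * T x))"
    and h: "h > 0"
  shows "complex_of_real (2 * pi * (\<integral>x. U x * gauss_step h (T x) \<partial>M))
    = (\<integral>t. exp ((h * vline \<eta> t)\<^sup>2 / 2) * (wmgf M U T (vline \<eta> t) / vline \<eta> t) \<partial>lborel)"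
proof -
  interpret prob_space M by fact
  interpret P: pair_sigma_finite M lborel ..
  define f where "f = (\<lambda>x t. exp ((h * vline \<eta> t)\<^sup>2 / 2) * (U x *\<^sub>R ((exp (vline \<eta> t * of_real (T x)) - 1) / vline \<eta> t)))"
  have "integrable M (\<lambda>x. \<bar>U x * T x\<bar> + \<bar>U x * T x * exp (\<eta> * T x)\<bar>)"
    using UT by (intro bochner_addI integrable_abs)
  then have "integrable (M \<Otimes>\<^sub>M lborel) (\<lambda>(x, t). (\<bar>U x * T x\<bar> + \<bar>U x * T x * exp (\<eta> * T x)\<bar>) * (exp ((h * \<eta>)\<^sup>2 / 2) * gauss (h * t)))"
    by (intro P.integrable_prod_mult integrable_mult_right integrable_gauss h)
  then have int: "integrable (M \<Otimes>\<^sub>M lborel) (\<lambda>(x, t). f x t)"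
  proof (rule bochner_bound)
    show "(\<lambda>(x, t). f x t) \<in> borel_measurable (M \<Otimes>\<^sub>M lborel)" unfolding f_def by measurable
    have "norm (f x t) \<le> (\<bar>U x * T x\<bar> + \<bar>U x * T x * exp (\<eta> * T x)\<bar>) * (exp ((h * \<eta>)\<^sup>2 / 2) * gauss (h * t))" for x t
    proof -
      have "norm ((exp (vline \<eta> t * of_real (T x)) - 1) / vline \<eta> t) \<le> \<bar>T x\<bar> * (1 + exp (\<eta> * T x))"
        using norm_exp_minus_1_div_le[of "vline \<eta> t" "T x"] by (cases "vline \<eta> t = 0") auto
      then have "(exp ((h * \<eta>)\<^sup>2 / 2) * gauss (h * t) * \<bar>U x\<bar>) * norm ((exp (vline \<eta> t * of_real (T x)) - 1) / vline \<eta> t)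
        \<le> (exp ((h * \<eta>)\<^sup>2 / 2) * gauss (h * t) * \<bar>U x\<bar>) * (\<bar>T x\<bar> * (1 + exp (\<eta> * T x)))"
        by (intro mult_left_mono) auto
      then show ?thesis
        unfolding f_def norm_mult norm_scaleR norm_exp_vline_square by (simp add: abs_mult algebra_simps)
    qed
    then show "AE p in M \<Otimes>\<^sub>M lborel. norm (case p of (x, t) \<Rightarrow> f x t)
       \<le> norm (case p of (x, t) \<Rightarrow> (\<bar>U x * T x\<bar> + \<bar>U x * T x * exp (\<eta> * T x)\<bar>) * (exp ((h * \<eta>)\<^sup>2 / 2) * gauss (h * t)))"
      by (intro AE_I2) (auto intro: order_trans[OF _ abs_ge_self])
  qed
  have Ugs: "integrable M (\<lambda>x. U x * gauss_step h (T x))"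
    by (rule bochner_bound[OF integrable_mult_left[OF U(1), of 2]])
       (auto simp: abs_mult intro!: mult_left_mono abs_gauss_step_le h)
  have "(\<integral>t. exp ((h * vline \<eta> t)\<^sup>2 / 2) * (wmgf M U T (vline \<eta> t) / vline \<eta> t) \<partial>lborel)
    = (\<integral>t. (\<integral>x. f x t \<partial>M) \<partial>lborel)"
  proof (rule bochner_cong)
    fix t :: real
    have "integrable M (\<lambda>x. U x *\<^sub>R exp (vline \<eta> t * of_real (T x)))"
      by (subst integrable_weighted_exp_iff) (use UT in auto)
    moreover have "(\<integral>x. U x *\<^sub>R (1::complex) \<partial>M) = 0"
      using U by (simp add: scaleR_conv_of_real)
    ultimately have "(\<integral>x. U x *\<^sub>R exp (vline \<eta> t * of_real (T x)) - U x *\<^sub>R 1 \<partial>M) = wmgf M U T (vline \<eta> t)"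
      using U by (subst bochner_diff) (auto simp: wmgf_def)
    moreover have "f x t = (U x *\<^sub>R exp (vline \<eta> t * of_real (T x)) - U x *\<^sub>R 1) * (exp ((h * vline \<eta> t)\<^sup>2 / 2) / vline \<eta> t)" for x
      by (simp add: f_def scaleR_conv_of_real divide_simps algebra_simps)
    ultimately show "exp ((h * vline \<eta> t)\<^sup>2 / 2) * (wmgf M U T (vline \<eta> t) / vline \<eta> t) = (\<integral>x. f x t \<partial>M)"
      by simp
  qed simp
  also have "\<dots> = (\<integral>x. (\<integral>t. f x t \<partial>lborel) \<partial>M)" by (rule P.Fubini_integral[OF int])
  also have "\<dots> = (\<integral>x. complex_of_real (2 * pi * (U x * gauss_step h (T x)) - 2 * pi * gauss_step h 0 * U x) \<partial>M)"
  proof (rule bochner_cong)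
    fix x
    have "f x t = U x *\<^sub>R (exp ((h * vline \<eta> t)\<^sup>2 / 2) * ((exp (vline \<eta> t * of_real (T x)) - 1) / vline \<eta> t))" for t
      by (simp add: f_def)
    then have "(\<integral>t. f x t \<partial>lborel) = U x *\<^sub>R complex_of_real (2 * pi * (gauss_step h (T x) - gauss_step h 0))"
      using gauss_step_fourier[OF h, of \<eta> "T x"] by simp
    then show "(\<integral>t. f x t \<partial>lborel) = complex_of_real (2 * pi * (U x * gauss_step h (T x)) - 2 * pi * gauss_step h 0 * U x)"
      by (simp add: scaleR_conv_of_real algebra_simps)
  qed simp
  also have "\<dots> = complex_of_real (2 * pi * (\<integral>x. U x * gauss_step h (T x) \<partial>M))"
    unfolding integral_complex_of_real using U Ugs by simp
  finally show ?thesis ..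
qed

text \<open>Fubini and the Gaussian Fourier integral. The formula turns the expectation that bounds
  the smoothing error into an integral over the line, where the decay of \<open>\<mu>\<close> can be
  used.\<close>

lemma integral_gaussian_fourier:
  fixes V T :: "'a \<Rightarrow> real"
  assumes M: "prob_space M" and [measurable]: "V \<in> borel_measurable M" "T \<in> borel_measurable M"
    and V: "integrable M (\<lambda>x. V x * exp (\<eta> * T x))" and h: "h > 0"
  shows "complex_of_real (sqrt (2 * pi) / h * (\<integral>x. V x * exp (\<eta> * T x) * gauss (T x / h) \<partial>M))
    = (\<integral>t. complex_of_real (gauss (h * t)) * wmgf M V T (vline \<eta> t) \<partial>lborel)"
proof -
  interpret prob_space M by fact
  interpret P: pair_sigma_finite M lborel ..
  define f where "f = (\<lambda>x t. complex_of_real (gauss (h * t)) * (V x *\<^sub>R exp (vline \<eta> t * of_real (T x))))"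
  have "integrable (M \<Otimes>\<^sub>M lborel) (\<lambda>(x, t). (V x * exp (\<eta> * T x)) * gauss (h * t))"
    by (intro P.integrable_prod_mult integrable_gauss h V)
  then have int: "integrable (M \<Otimes>\<^sub>M lborel) (\<lambda>(x, t). f x t)"
  proof (rule bochner_bound)
    show "(\<lambda>(x, t). f x t) \<in> borel_measurable (M \<Otimes>\<^sub>M lborel)" unfolding f_def by measurable
    show "AE p in M \<Otimes>\<^sub>M lborel. norm (case p of (x, t) \<Rightarrow> f x t)
       \<le> norm (case p of (x, t) \<Rightarrow> (V x * exp (\<eta> * T x)) * gauss (h * t))"
      by (intro AE_I2) (auto simp: f_def norm_mult norm_exp_of_real abs_mult)
  qed
  have "(\<integral>t. complex_of_real (gauss (h * t)) * wmgf M V T (vline \<eta> t) \<partial>lborel)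
    = (\<integral>t. (\<integral>x. f x t \<partial>M) \<partial>lborel)"
    unfolding f_def wmgf_def integral_mult_right_zero ..
  also have "\<dots> = (\<integral>x. (\<integral>t. f x t \<partial>lborel) \<partial>M)" by (rule P.Fubini_integral[OF int])
  also have "\<dots> = (\<integral>x. complex_of_real (sqrt (2 * pi) / h * (V x * exp (\<eta> * T x) * gauss (T x / h))) \<partial>M)"
  proof (rule bochner_cong)
    fix x
    have "exp (vline \<eta> t * of_real (T x)) = complex_of_real (exp (\<eta> * T x)) * cis (t * T x)" for t
      unfolding cis_conv_exp exp_of_real[symmetric] exp_add[symmetric]
      by (rule arg_cong[where f=exp]) (simp add: algebra_simps)
    then have "f x t = (V x * exp (\<eta> * T x)) *\<^sub>R (complex_of_real (gauss (h * t)) * cis (t * T x))" for t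
      by (simp add: f_def scaleR_conv_of_real mult_ac)
    then have "(\<integral>t. f x t \<partial>lborel) = (V x * exp (\<eta> * T x)) *\<^sub>R complex_of_real (sqrt (2 * pi) / h * gauss (T x / h))"
      using has_bochner_integral_integral_eq[OF fourier_gaussian[OF h, of "T x"]] by simp
    then show "(\<integral>t. f x t \<partial>lborel) = complex_of_real (sqrt (2 * pi) / h * (V x * exp (\<eta> * T x) * gauss (T x / h)))"
      by (simp add: scaleR_conv_of_real mult_ac)
  qed simp
  also have "\<dots> = complex_of_real (sqrt (2 * pi) / h * (\<integral>x. V x * exp (\<eta> * T x) * gauss (T x / h) \<partial>M))"
    unfolding integral_complex_of_real by simp
  finally show ?thesis ..
qed

text \<open>Completing the square trades half of the Gaussian decay for the exponential tilt
  \<open>exp (\<eta> * T)\<close>, which makes the error comparable with the (possibly exponentially small) main term.\<close>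

lemma smoothing_error_le:
  fixes U T :: "'a \<Rightarrow> real"
  assumes [measurable]: "U \<in> borel_measurable M" "T \<in> borel_measurable M"
    and U: "integrable M U" and UT: "integrable M (\<lambda>x. U x * exp (\<eta> * T x))" and h: "h > 0"
  shows "\<bar>(\<integral>x. U x * indicat_real {0..} (T x) \<partial>M) - (\<integral>x. U x * gauss_step h (T x) \<partial>M)\<bar>
    \<le> exp ((\<eta> * h)\<^sup>2) * (\<integral>x. \<bar>U x\<bar> * exp (\<eta> * T x) * gauss (T x / (sqrt 2 * h)) \<partial>M)"
proof -
  have pt: "\<bar>indicat_real {0..} y - gauss_step h y\<bar> \<le> exp ((\<eta> * h)\<^sup>2) * (exp (\<eta> * y) * gauss (y / (sqrt 2 * h)))" for y
  proof -
    \<comment> \<open>One half of the exponent \<open>(y / h)\<^sup>2 / 2\<close> is the Gaussian of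
      width \<open>sqrt 2 * h\<close>; the other half forms a complete square with
      \<open>\<eta> * y\<close> and \<open>(\<eta> * h)\<^sup>2\<close>.\<close>
    have "(\<eta> * h)\<^sup>2 + \<eta> * y + - (y / (sqrt 2 * h))\<^sup>2 / 2 - (- (y / h)\<^sup>2 / 2) = (\<eta> * h + y / (2 * h))\<^sup>2"
      using h by (simp add: power2_eq_square field_simps)
    then have "- (y / h)\<^sup>2 / 2 \<le> (\<eta> * h)\<^sup>2 + \<eta> * y + - (y / (sqrt 2 * h))\<^sup>2 / 2"
      using zero_le_power2[of "\<eta> * h + y / (2 * h)"] by linarith
    then have "gauss (y / h) \<le> exp ((\<eta> * h)\<^sup>2 + \<eta> * y + - (y / (sqrt 2 * h))\<^sup>2 / 2)" by simp
    then show ?thesis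
      using gauss_step_error_le[OF h, of y] unfolding exp_add by (simp add: mult.assoc)
  qed
  have Ugs: "integrable M (\<lambda>x. U x * gauss_step h (T x))"
    by (rule bochner_bound[OF integrable_mult_left[OF U(1), of 2]])
       (auto simp: abs_mult intro!: mult_left_mono abs_gauss_step_le h)
  have Ui: "integrable M (\<lambda>x. U x * indicat_real {0..} (T x))"
    by (rule bochner_bound[OF U(1)]) (auto simp: abs_mult indicator_def)
  have Ug: "integrable M (\<lambda>x. \<bar>U x\<bar> * exp (\<eta> * T x) * gauss (T x / (sqrt 2 * h)))"
    by (rule bochner_bound[OF UT]) (auto simp: abs_mult mult_left_le)
  have "\<bar>(\<integral>x. U x * indicat_real {0..} (T x) \<partial>M) - (\<integral>x. U x * gauss_step h (T x) \<partial>M)\<bar>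
    = norm (\<integral>x. U x * indicat_real {0..} (T x) - U x * gauss_step h (T x) \<partial>M)"
    using Ui Ugs by simp
  also have "\<dots> \<le> (\<integral>x. norm (U x * indicat_real {0..} (T x) - U x * gauss_step h (T x)) \<partial>M)"
    by (rule integral_norm_bound)
  also have "\<dots> \<le> (\<integral>x. exp ((\<eta> * h)\<^sup>2) * (\<bar>U x\<bar> * exp (\<eta> * T x) * gauss (T x / (sqrt 2 * h))) \<partial>M)"
  proof (rule integral_mono)
    fix x
    have "\<bar>U x\<bar> * \<bar>indicat_real {0..} (T x) - gauss_step h (T x)\<bar> \<le> \<bar>U x\<bar> * (exp ((\<eta> * h)\<^sup>2) * (exp (\<eta> * T x) * gauss (T x / (sqrt 2 * h))))"
      by (intro mult_left_mono pt) auto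
    then show "norm (U x * indicat_real {0..} (T x) - U x * gauss_step h (T x)) \<le> exp ((\<eta> * h)\<^sup>2) * (\<bar>U x\<bar> * exp (\<eta> * T x) * gauss (T x / (sqrt 2 * h)))"
      by (simp only: right_diff_distrib[symmetric] real_norm_def abs_mult mult_ac)
  qed (use Ui Ugs Ug in auto)
  finally show ?thesis by simp
qed

section \<open>Tail expectations of sums of independent pairs\<close>

text \<open>\<open>U\<close> and \<open>Z\<close> stand for \<open>X - E[X]\<close> and \<open>Y - a\<close>; the two intervals making up \<open>J\<close> are
  neighbourhoods of the saddlepoint and of the origin.\<close>

locale centred_pairs = prob_space M for M :: "'a measure" +
  fixes U Z :: "nat \<Rightarrow> 'a \<Rightarrow> real" and J :: "real set" and \<eta> l u l0 u0 :: real and fZ :: "real \<Rightarrow> ennreal"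
  assumes meas [measurable]: "\<And>i. U i \<in> borel_measurable M" "\<And>i. Z i \<in> borel_measurable M"
    and indep: "indep_vars (\<lambda>_. borel) (\<lambda>i x. (U i x, Z i x)) UNIV"
    and ident: "\<And>i. distr M borel (\<lambda>x. (U i x, Z i x)) = distr M borel (\<lambda>x. (U 0 x, Z 0 x))"
    and J: "J = {l<..<u} \<union> {l0<..<u0}" "\<eta> \<in> {l<..<u}" "0 \<in> {l0<..<u0}"
    and int_exp: "\<And>e. e \<in> J \<Longrightarrow> integrable M (\<lambda>x. exp (e * Z 0 x))"
    and int_U_exp: "\<And>e. e \<in> J \<Longrightarrow> integrable M (\<lambda>x. U 0 x * exp (e * Z 0 x))"
    and mean_U: "expectation (U 0) = 0"
    and dens: "distributed M lborel (Z 0) fZ"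
begin

abbreviation mgf :: "real \<Rightarrow> real" where
  "mgf e \<equiv> expectation (\<lambda>x. exp (e * Z 0 x))"

abbreviation U_mgf :: "real \<Rightarrow> real" where
  "U_mgf e \<equiv> expectation (\<lambda>x. U 0 x * exp (e * Z 0 x))"

definition T :: "nat \<Rightarrow> 'a \<Rightarrow> real" where "T n x = (\<Sum>i<n. Z i x)"

definition \<mu> :: "complex \<Rightarrow> complex" where "\<mu> = wmgf M (\<lambda>_. 1) (Z 0)"

definition \<nu> :: "complex \<Rightarrow> complex" where "\<nu> = wmgf M (U 0) (Z 0)"

definition \<mu>0 :: real where "\<mu>0 = mgf \<eta>"

definition N0 :: real where "N0 = expectation (\<lambda>x. \<bar>U 0 x\<bar> * exp (\<eta> * Z 0 x))"

abbreviation tail_prob :: "nat \<Rightarrow> real" where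
  "tail_prob n \<equiv> prob {x \<in> space M. 0 \<le> T n x}"

abbreviation tail :: "nat \<Rightarrow> nat \<Rightarrow> real" where
  "tail i n \<equiv> \<integral>x. U i x * indicat_real {0..} (T n x) \<partial>M"

abbreviation smooth_tail :: "real \<Rightarrow> nat \<Rightarrow> nat \<Rightarrow> real" where
  "smooth_tail h i n \<equiv> \<integral>x. U i x * gauss_step h (T n x) \<partial>M"

lemma J_mem: "\<eta> \<in> J" "0 \<in> J" using J by auto

lemma measurable_T [measurable]: "T n \<in> borel_measurable M"
  unfolding T_def[abs_def] by measurable

lemma integrable_pair_iff:
  fixes g :: "real \<times> real \<Rightarrow> 'b::{banach, second_countable_topology}"
  assumes [measurable]: "g \<in> borel_measurable borel"
  shows "integrable M (\<lambda>x. g (U i x, Z i x)) \<longleftrightarrow> integrable M (\<lambda>x. g (U 0 x, Z 0 x))"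
proof -
  have "integrable M (\<lambda>x. g (U i x, Z i x)) \<longleftrightarrow> integrable (distr M borel (\<lambda>x. (U i x, Z i x))) g" for i
    by (rule integrable_distr_eq[symmetric]) measurable
  then show ?thesis using ident[of i] by simp
qed

lemma integral_pair_eq:
  fixes g :: "real \<times> real \<Rightarrow> 'b::{banach, second_countable_topology}"
  assumes [measurable]: "g \<in> borel_measurable borel"
  shows "(\<integral>x. g (U i x, Z i x) \<partial>M) = (\<integral>x. g (U 0 x, Z 0 x) \<partial>M)"
proof -
  have "(\<integral>x. g (U i x, Z i x) \<partial>M) = integral\<^sup>L (distr M borel (\<lambda>x. (U i x, Z i x))) g" for i
    by (rule integral_distr[symmetric]) measurable
  then show ?thesis using ident[of i] by simp
qed

lemma integrable_U: "integrable M (U i)"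
  using integrable_pair_iff[of fst i] int_U_exp[OF J_mem(2)] by (simp add: borel_prod[symmetric])

lemma expectation_U: "expectation (U i) = 0"
  using integral_pair_eq[of fst i] mean_U by (simp add: borel_prod[symmetric])

text \<open>Independence factorises the transform: factor \<open>i\<close> carries the weight and
  the other \<open>n - 1\<close> are plain. \<phi> is taken to be the identity for the main term and
  \<open>abs\<close> for the smoothing error.\<close>

lemma
  fixes \<phi> :: "real \<Rightarrow> real"
  assumes [measurable]: "\<phi> \<in> borel_measurable borel" and \<phi>: "\<And>x. \<bar>\<phi> x\<bar> \<le> \<bar>x\<bar>"
    and i: "i < n" and s: "Re s \<in> J"
  shows wmgf_sum: "wmgf M (\<lambda>\<omega>. \<phi> (U i \<omega>)) (T n) s = wmgf M (\<lambda>\<omega>. \<phi> (U 0 \<omega>)) (Z 0) s * \<mu> s ^ (n - 1)"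
    and integrable_weighted_exp_sum: "integrable M (\<lambda>\<omega>. \<phi> (U i \<omega>) * exp (Re s * T n \<omega>))"
proof -
  define g where "g = (\<lambda>j (p :: real \<times> real). (if j = i then \<phi> (fst p) else 1) *\<^sub>R exp (s * complex_of_real (snd p)))"
  have [measurable]: "g j \<in> borel_measurable borel" for j
    unfolding g_def borel_prod[symmetric] by measurable
  define W where "W = (\<lambda>j \<omega>. g j (U j \<omega>, Z j \<omega>))"
  have ind: "indep_vars (\<lambda>_. borel) W {..<n}"
    unfolding W_def
    by (rule indep_vars_compose2[OF indep_vars_subset[OF indep]]) auto
  have int: "integrable M (W j)" for j
  proof -
    have "integrable M (\<lambda>\<omega>. (if j = i then \<phi> (U 0 \<omega>) else 1) *\<^sub>R exp (s * complex_of_real (Z 0 \<omega>)))"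
    proof (subst integrable_weighted_exp_iff)
      have "integrable M (\<lambda>\<omega>. \<phi> (U 0 \<omega>) * exp (Re s * Z 0 \<omega>))"
        by (rule bochner_bound[OF int_U_exp[OF s]])
           (auto simp: abs_mult intro!: mult_right_mono \<phi>)
      then show "integrable M (\<lambda>\<omega>. (if j = i then \<phi> (U 0 \<omega>) else 1) * exp (Re s * Z 0 \<omega>))"
        using int_exp[OF s] by (cases "j = i") auto
    qed measurable
    then have "integrable M (\<lambda>\<omega>. g j (U 0 \<omega>, Z 0 \<omega>))" by (simp add: g_def cong: if_cong)
    then show ?thesis unfolding W_def by (subst integrable_pair_iff) auto
  qed
  have prod: "(\<Prod>j<n. W j \<omega>) = \<phi> (U i \<omega>) *\<^sub>R exp (s * complex_of_real (T n \<omega>))" for \<omega>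
  proof -
    have "(\<Prod>j<n. W j \<omega>) = (\<Prod>j<n. complex_of_real (if j = i then \<phi> (U j \<omega>) else 1)) * (\<Prod>j<n. exp (s * complex_of_real (Z j \<omega>)))"
      unfolding W_def g_def scaleR_conv_of_real fst_conv snd_conv by (rule prod.distrib)
    also have "(\<Prod>j<n. complex_of_real (if j = i then \<phi> (U j \<omega>) else 1)) = (\<Prod>j<n. (if j = i then complex_of_real (\<phi> (U j \<omega>)) else 1))"
      by (intro prod.cong) auto
    also have "\<dots> = complex_of_real (\<phi> (U i \<omega>))" using i by (simp add: prod.delta)
    also have "(\<Prod>j<n. exp (s * complex_of_real (Z j \<omega>))) = exp (s * complex_of_real (T n \<omega>))"
      by (simp add: T_def exp_sum[symmetric] sum_distrib_left)
    finally show ?thesis by (simp add: scaleR_conv_of_real)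
  qed
  have "wmgf M (\<lambda>\<omega>. \<phi> (U i \<omega>)) (T n) s = (\<Prod>j<n. \<integral>\<omega>. W j \<omega> \<partial>M)"
    unfolding wmgf_def prod[symmetric] by (rule indep_vars_lebesgue_integral[OF _ ind int]) simp
  also have "\<dots> = (\<Prod>j<n. if j = i then wmgf M (\<lambda>\<omega>. \<phi> (U 0 \<omega>)) (Z 0) s else \<mu> s)"
  proof (rule prod.cong)
    fix j
    have "(\<integral>\<omega>. W j \<omega> \<partial>M) = (\<integral>\<omega>. g j (U 0 \<omega>, Z 0 \<omega>) \<partial>M)" unfolding W_def by (rule integral_pair_eq) measurable
    then show "(\<integral>\<omega>. W j \<omega> \<partial>M) = (if j = i then wmgf M (\<lambda>\<omega>. \<phi> (U 0 \<omega>)) (Z 0) s else \<mu> s)"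
      by (simp add: g_def wmgf_def \<mu>_def)
  qed simp
  also have "\<dots> = wmgf M (\<lambda>\<omega>. \<phi> (U 0 \<omega>)) (Z 0) s * (\<Prod>j\<in>{..<n} - {i}. \<mu> s)"
    using i by (subst prod.remove[of _ i]) (auto intro!: prod.cong)
  finally show "wmgf M (\<lambda>\<omega>. \<phi> (U i \<omega>)) (T n) s = wmgf M (\<lambda>\<omega>. \<phi> (U 0 \<omega>)) (Z 0) s * \<mu> s ^ (n - 1)"
    using i by simp
  have "integrable M (\<lambda>\<omega>. \<phi> (U i \<omega>) *\<^sub>R exp (s * complex_of_real (T n \<omega>)))"
    unfolding prod[symmetric] by (rule indep_vars_integrable[OF _ ind int]) simp
  then show "integrable M (\<lambda>\<omega>. \<phi> (U i \<omega>) * exp (Re s * T n \<omega>))"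
    by (subst (asm) integrable_weighted_exp_iff) measurable
qed

lemma integrable_U_exp_T:
  assumes "i < n" "e \<in> J"
  shows "integrable M (\<lambda>\<omega>. U i \<omega> * exp (e * T n \<omega>))"
  using integrable_weighted_exp_sum[of "\<lambda>x. x" i n "of_real e"] assms by simp

text \<open>Absorbing the factor \<open>T n\<close> needs an open interval around \<open>e\<close>,
  so the argument is made in whichever component of \<open>J\<close> contains \<open>e\<close>; the
  values used are \<eta> and 0.\<close>

lemma integrable_U_T_exp_T:
  assumes i: "i < n" and e: "e \<in> J"
  shows "integrable M (\<lambda>x. U i x * T n x * exp (e * T n x))"
proof -
  consider "e \<in> {l<..<u}" | "e \<in> {l0<..<u0}" using e J by auto
  then show ?thesis
  proof cases
    case 1
    show ?thesis
      by (rule integrable_exp_times[OF _ _ _ 1]) (use integrable_U_exp_T[OF i] J in auto)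
  next
    case 2
    show ?thesis
      by (rule integrable_exp_times[OF _ _ _ 2]) (use integrable_U_exp_T[OF i] J in auto)
  qed
qed

lemma mgf_pos:
  assumes "e \<in> J"
  shows "mgf e > 0"
proof -
  have "mgf e \<noteq> 0"
  proof
    assume "mgf e = 0"
    then have "AE x in M. exp (e * Z 0 x) = 0"
      using integral_nonneg_eq_0_iff_AE[OF int_exp[OF assms]] by simp
    then show False by simp
  qed
  then show ?thesis by (simp add: less_le)
qed

lemma \<mu>0_pos: "\<mu>0 > 0"
  unfolding \<mu>0_def by (rule mgf_pos[OF J_mem(1)])

lemma \<mu>_\<eta>: "\<mu> (complex_of_real \<eta>) = complex_of_real \<mu>0"
  by (simp add: \<mu>_def \<mu>0_def wmgf_of_real)

lemma norm_\<mu>_le: "norm (\<mu> (vline \<eta> t)) \<le> \<mu>0"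
  using norm_wmgf_le[of M "\<lambda>_. 1" "Z 0" "vline \<eta> t"] by (simp add: \<mu>_def \<mu>0_def)

lemma norm_\<nu>_le: "norm (\<nu> (vline \<eta> t)) \<le> N0"
  using norm_wmgf_le[of M "U 0" "Z 0" "vline \<eta> t"] by (simp add: \<nu>_def N0_def)

lemma N0_nonneg: "N0 \<ge> 0" by (simp add: N0_def)

text \<open>On the line \<open>\<mu>\<close> is the Fourier transform of the tilted density
  \<open>p z * exp (\<eta> * z)\<close>, whose mass is \<open>\<mu>0\<close>, so
  \<open>cramer_condition\<close> applies.\<close>

lemma \<mu>_decay:
  assumes "\<delta> > 0"
  obtains q where "0 < q" "q < 1" "\<And>t. \<bar>t\<bar> \<ge> \<delta> \<Longrightarrow> norm (\<mu> (vline \<eta> t)) \<le> q * \<mu>0"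
proof -
  define p where "p = (\<lambda>z. enn2real (fZ z))"
  have fZ [measurable]: "fZ \<in> borel_measurable borel" using dens by (simp add: distributed_def)
  have dist: "distr M lborel (Z 0) = density lborel fZ" using dens by (simp add: distributed_def)
  have [measurable]: "p \<in> borel_measurable borel" unfolding p_def by measurable
  have "integral\<^sup>N lborel fZ = emeasure (density lborel fZ) UNIV"
    by (simp add: emeasure_density)
  also have "\<dots> = 1"
    unfolding dist[symmetric] by (simp add: emeasure_distr emeasure_space_1)
  finally have "integral\<^sup>N lborel fZ \<noteq> \<infinity>" by simp
  \<comment> \<open>The density is extended-real valued; having integral 1, it is finite almost
    everywhere and may be replaced by a real function.\<close>
  then have "AE z in lborel. fZ z \<noteq> \<infinity>" by (intro nn_integral_PInf_AE) auto
  then have ae: "AE z in lborel. fZ z = ennreal (p z)"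
    by eventually_elim (auto simp: p_def less_top)
  have dist': "distr M lborel (Z 0) = density lborel (\<lambda>z. ennreal (p z))"
    unfolding dist using ae by (intro density_cong) auto
  have Zm: "Z 0 \<in> measurable M lborel" by simp
  have intd: "(\<integral>x. g (Z 0 x) \<partial>M) = (\<integral>z. p z *\<^sub>R g z \<partial>lborel)"
    and intgd: "integrable M (\<lambda>x. g (Z 0 x)) \<longleftrightarrow> integrable lborel (\<lambda>z. p z *\<^sub>R g z)"
    if [measurable]: "g \<in> borel_measurable borel" for g :: "real \<Rightarrow> 'b::{banach, second_countable_topology}"
  proof -
    have "(\<integral>x. g (Z 0 x) \<partial>M) = integral\<^sup>L (distr M lborel (Z 0)) g"
      by (rule integral_distr[symmetric, OF Zm]) simp
    also have "\<dots> = (\<integral>z. p z *\<^sub>R g z \<partial>lborel)"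
      unfolding dist' by (rule integral_density) (auto simp: p_def)
    finally show "(\<integral>x. g (Z 0 x) \<partial>M) = (\<integral>z. p z *\<^sub>R g z \<partial>lborel)" .
    have "integrable M (\<lambda>x. g (Z 0 x)) \<longleftrightarrow> integrable (distr M lborel (Z 0)) g"
      by (rule integrable_distr_eq[symmetric, OF Zm]) simp
    also have "\<dots> \<longleftrightarrow> integrable lborel (\<lambda>z. p z *\<^sub>R g z)"
      unfolding dist' by (rule integrable_density) (auto simp: p_def)
    finally show "integrable M (\<lambda>x. g (Z 0 x)) \<longleftrightarrow> integrable lborel (\<lambda>z. p z *\<^sub>R g z)" .
  qed
  define w where "w = (\<lambda>z. p z * exp (\<eta> * z))"
  have w: "integrable lborel w" "\<mu>0 = (\<integral>z. w z \<partial>lborel)"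
    using intgd[of "\<lambda>z. exp (\<eta> * z)"] intd[of "\<lambda>z. exp (\<eta> * z)"] int_exp[OF J_mem(1)]
    by (simp_all add: w_def \<mu>0_def)
  have \<mu>w: "\<mu> (vline \<eta> t) = (fourier w t)" for t
  proof -
    have "exp (vline \<eta> t * of_real z) = complex_of_real (exp (\<eta> * z)) * cis (t * z)" for z
      unfolding cis_conv_exp exp_of_real[symmetric] exp_add[symmetric]
      by (rule arg_cong[where f=exp]) (simp add: algebra_simps)
    then show ?thesis
      using intd[of "\<lambda>z. exp (vline \<eta> t * of_real z)"]
      by (simp add: \<mu>_def wmgf_def w_def scaleR_conv_of_real mult_ac)
  qed
  obtain q where "0 < q" "q < 1" "\<And>t. \<bar>t\<bar> \<ge> \<delta> \<Longrightarrow> norm (fourier w t) \<le> q * (\<integral>z. w z \<partial>lborel)"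
    using cramer_condition[OF w(1) _ _ assms] \<mu>0_pos w(2) by (auto simp: w_def p_def)
  then show thesis using that by (simp add: \<mu>w w(2))
qed

section \<open>Errors of the smoothing and of the restriction to a window around the
  saddlepoint\<close>

lemma measurable_wmgf_vline [measurable]:
  assumes [measurable]: "V \<in> borel_measurable M" "Y \<in> borel_measurable M"
  shows "(\<lambda>t. wmgf M V Y (vline \<eta> t)) \<in> borel_measurable borel"
  unfolding wmgf_def by measurable

text \<open>A Gaussian of width of order \<open>h\<close> in \<open>T\<close> is \<open>h\<close>
  times an average over frequencies up to about 1/h. Frequencies outside the window contribute
  \<open>q ^ (n - 1)\<close>, and the window itself contributes its length
  \<open>2 * \<delta>\<close> times \<open>h\<close>.\<close>

lemma smoothing_error:
  assumes i: "i < n" and h: "h > 0" and q: "q \<ge> 0" and \<delta>: "\<delta> > 0"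
    and decay: "\<And>t. \<bar>t\<bar> \<ge> \<delta> \<Longrightarrow> norm (\<mu> (vline \<eta> t)) \<le> q * \<mu>0"
  shows "\<bar>tail i n - smooth_tail h i n\<bar>
    \<le> exp ((\<eta> * h)\<^sup>2) * (N0 * \<mu>0 ^ (n - 1) * (q ^ (n - 1) + 2 * \<delta> * h))"
proof -
  define k where "k = sqrt 2 * h"
  define X where "X = (\<integral>x. \<bar>U i x\<bar> * exp (\<eta> * T n x) * gauss (T n x / k) \<partial>M)"
  define V where "V = (\<lambda>t. wmgf M (\<lambda>x. \<bar>U i x\<bar>) (T n) (vline \<eta> t))"
  have k: "k > 0" using h by (simp add: k_def)
  have X0: "X \<ge> 0" unfolding X_def by (intro bochner_nonneg) auto
  have intV: "integrable M (\<lambda>x. \<bar>U i x\<bar> * exp (\<eta> * T n x))"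
    using integrable_weighted_exp_sum[of abs i n "of_real \<eta>"] i J_mem by simp
  have V: "norm (V t) \<le> N0 * \<mu>0 ^ (n - 1) * (q ^ (n - 1) + indicat_real {-\<delta>..\<delta>} t)" for t
  proof -
    have "V t = wmgf M (\<lambda>x. \<bar>U 0 x\<bar>) (Z 0) (vline \<eta> t) * \<mu> (vline \<eta> t) ^ (n - 1)"
      unfolding V_def by (rule wmgf_sum) (use i J_mem in auto)
    moreover have "norm (wmgf M (\<lambda>x. \<bar>U 0 x\<bar>) (Z 0) (vline \<eta> t)) \<le> N0"
      using norm_wmgf_le[of M "\<lambda>x. \<bar>U 0 x\<bar>" "Z 0" "vline \<eta> t"] by (simp add: N0_def)
    moreover have "norm (\<mu> (vline \<eta> t)) ^ (n - 1) \<le> \<mu>0 ^ (n - 1) * (q ^ (n - 1) + indicat_real {-\<delta>..\<delta>} t)"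
    proof (cases "\<bar>t\<bar> \<ge> \<delta>")
      case True
      have "norm (\<mu> (vline \<eta> t)) ^ (n - 1) \<le> (q * \<mu>0) ^ (n - 1)" by (intro power_mono decay True) auto
      also have "\<dots> = \<mu>0 ^ (n - 1) * q ^ (n - 1)" by (simp add: power_mult_distrib mult.commute)
      also have "\<dots> \<le> \<mu>0 ^ (n - 1) * (q ^ (n - 1) + indicat_real {-\<delta>..\<delta>} t)"
        using \<mu>0_pos by (intro mult_left_mono) auto
      finally show ?thesis .
    next
      case False
      have "norm (\<mu> (vline \<eta> t)) ^ (n - 1) \<le> \<mu>0 ^ (n - 1) * 1" using norm_\<mu>_le by (auto intro: power_mono)
      also have "\<dots> \<le> \<mu>0 ^ (n - 1) * (q ^ (n - 1) + indicat_real {-\<delta>..\<delta>} t)"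
        using \<mu>0_pos q False by (intro mult_left_mono) (auto simp: indicator_def)
      finally show ?thesis .
    qed
    ultimately show ?thesis
      using N0_nonneg by (simp add: norm_mult norm_power mult.assoc mult_mono)
  qed
  have "sqrt (2 * pi) / k * X = norm (complex_of_real (sqrt (2 * pi) / k * X))"
    unfolding norm_of_real using k X0 by simp
  also have "complex_of_real (sqrt (2 * pi) / k * X) = (\<integral>t. complex_of_real (gauss (k * t)) * V t \<partial>lborel)"
    unfolding X_def V_def by (rule integral_gaussian_fourier) (use intV k prob_space_axioms in auto)
  also have "norm \<dots> \<le> (\<integral>t. norm (complex_of_real (gauss (k * t)) * V t) \<partial>lborel)"
    by (rule integral_norm_bound)
  \<comment> \<open>The \<open>q ^ (n - 1)\<close> term keeps the Gaussian for integrability; on the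
    window the Gaussian is bounded by 1, which gives a length free of 1/h.\<close>
  also have "\<dots> \<le> (\<integral>t. N0 * \<mu>0 ^ (n - 1) * (q ^ (n - 1) * gauss (k * t) + indicat_real {-\<delta>..\<delta>} t) \<partial>lborel)"
  proof (rule integral_mono')
    show "integrable lborel (\<lambda>t. N0 * \<mu>0 ^ (n - 1) * (q ^ (n - 1) * gauss (k * t) + indicat_real {-\<delta>..\<delta>} t))"
      by (intro integrable_mult_right bochner_addI integrable_gauss k integrable_real_indicator) (auto simp: emeasure_lborel_Icc_eq)
    fix t :: real
    have "gauss (k * t) * norm (V t) \<le> gauss (k * t) * (N0 * \<mu>0 ^ (n - 1) * (q ^ (n - 1) + indicat_real {-\<delta>..\<delta>} t))"
      by (intro mult_left_mono V) auto
    also have "\<dots> = N0 * \<mu>0 ^ (n - 1) * (q ^ (n - 1) * gauss (k * t) + gauss (k * t) * indicat_real {-\<delta>..\<delta>} t)"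
      by (simp add: algebra_simps)
    also have "\<dots> \<le> N0 * \<mu>0 ^ (n - 1) * (q ^ (n - 1) * gauss (k * t) + 1 * indicat_real {-\<delta>..\<delta>} t)"
      using N0_nonneg \<mu>0_pos by (intro mult_left_mono add_left_mono mult_right_mono) auto
    finally show "norm (complex_of_real (gauss (k * t)) * V t) \<le> N0 * \<mu>0 ^ (n - 1) * (q ^ (n - 1) * gauss (k * t) + indicat_real {-\<delta>..\<delta>} t)"
      by (simp add: norm_mult)
  qed (use q N0_nonneg \<mu>0_pos in auto)
  also have "\<dots> = N0 * \<mu>0 ^ (n - 1) * (q ^ (n - 1) * (sqrt (2 * pi) / k) + 2 * \<delta>)"
    using integrable_gauss[OF k] \<delta>
    by (subst integral_mult_right_zero, subst bochner_add) (auto simp: emeasure_lborel_Icc_eq)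
  finally have "k / sqrt (2 * pi) * (sqrt (2 * pi) / k * X)
      \<le> k / sqrt (2 * pi) * (N0 * \<mu>0 ^ (n - 1) * (q ^ (n - 1) * (sqrt (2 * pi) / k) + 2 * \<delta>))"
    using k by (intro mult_left_mono) auto
  then have "X \<le> k / sqrt (2 * pi) * (N0 * \<mu>0 ^ (n - 1) * (q ^ (n - 1) * (sqrt (2 * pi) / k) + 2 * \<delta>))"
    using k by simp
  also have "\<dots> = N0 * \<mu>0 ^ (n - 1) * (q ^ (n - 1) + 2 * \<delta> * (k / sqrt (2 * pi)))"
    using k by (simp add: field_simps)
  \<comment> \<open>The left side equals \<open>h / sqrt pi\<close>.\<close>
  also have "k / sqrt (2 * pi) \<le> h"
    using h pi_gt3 by (simp add: k_def real_sqrt_mult field_simps)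
  then have "N0 * \<mu>0 ^ (n - 1) * (q ^ (n - 1) + 2 * \<delta> * (k / sqrt (2 * pi))) \<le> N0 * \<mu>0 ^ (n - 1) * (q ^ (n - 1) + 2 * \<delta> * h)"
    using N0_nonneg \<mu>0_pos \<delta> by (intro mult_left_mono add_left_mono) auto
  finally have X: "X \<le> N0 * \<mu>0 ^ (n - 1) * (q ^ (n - 1) + 2 * \<delta> * h)" .
  have "\<bar>tail i n - smooth_tail h i n\<bar> \<le> exp ((\<eta> * h)\<^sup>2) * X"
    unfolding X_def k_def
    by (rule smoothing_error_le) (use integrable_U integrable_U_exp_T[OF i J_mem(1)] h in auto)
  also have "\<dots> \<le> exp ((\<eta> * h)\<^sup>2) * (N0 * \<mu>0 ^ (n - 1) * (q ^ (n - 1) + 2 * \<delta> * h))"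
    by (intro mult_left_mono X) auto
  finally show ?thesis .
qed

text \<open>Inside the window, replacing \<open>exp ((h * s)\<^sup>2 / 2)\<close> by 1 costs a
  factor of order \<open>h\<^sup>2\<close>. Outside, 1/|s| is at most 1 / \<delta>,
  \<open>\<mu>\<close> has its geometric decay, and the Gaussian contributes the effective length
  \<open>sqrt (2 * pi) / h\<close>.\<close>

lemma contour_error:
  fixes G :: "complex \<Rightarrow> complex"
  assumes i: "i < n" and h: "0 < h" "h \<le> 1" and q: "q \<ge> 0" and \<delta>: "\<delta> > 0"
    and decay: "\<And>t. \<bar>t\<bar> \<ge> \<delta> \<Longrightarrow> norm (\<mu> (vline \<eta> t)) \<le> q * \<mu>0"
    and G: "integrable lborel (\<lambda>t. on_axis \<delta> G t)"
    and rel: "\<And>t. \<bar>t\<bar> \<le> \<delta> \<Longrightarrow> G (\<i> * t) * vline \<eta> t * \<mu> (vline \<eta> t) = \<nu> (vline \<eta> t)"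
  shows "norm (complex_of_real (2 * pi * smooth_tail h i n)
      - (\<integral>t. indicat_real {-\<delta>..\<delta>} t *\<^sub>R (\<mu> (vline \<eta> t) ^ n * G (\<i> * t)) \<partial>lborel))
    \<le> h\<^sup>2 * (exp (\<eta>\<^sup>2 + \<delta>\<^sup>2) * (\<eta>\<^sup>2 + \<delta>\<^sup>2)) * \<mu>0 ^ n * (\<integral>t. norm (on_axis \<delta> G t) \<partial>lborel)
      + exp (\<eta>\<^sup>2) * N0 * (q * \<mu>0) ^ (n - 1) / \<delta> * (sqrt (2 * pi) / h)"
proof -
  define a where "a = (\<lambda>t. exp ((h * vline \<eta> t)\<^sup>2 / 2) * (wmgf M (U i) (T n) (vline \<eta> t) / vline \<eta> t))"
  define b where "b = (\<lambda>t. indicat_real {-\<delta>..\<delta>} t *\<^sub>R (\<mu> (vline \<eta> t) ^ n * G (\<i> * t)))"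
  define C where "C = exp (\<eta>\<^sup>2 + \<delta>\<^sup>2) * (\<eta>\<^sup>2 + \<delta>\<^sup>2)"
  define W where "W = (\<lambda>t. h\<^sup>2 * C * \<mu>0 ^ n * norm (on_axis \<delta> G t)
     + exp (\<eta>\<^sup>2) * N0 * (q * \<mu>0) ^ (n - 1) / \<delta> * gauss (h * t))"
  have [measurable]: "(\<lambda>t. \<mu> (vline \<eta> t)) \<in> borel_measurable borel" unfolding \<mu>_def by measurable
  have [measurable]: "(\<lambda>t. on_axis \<delta> G t) \<in> borel_measurable borel" using G by auto
  have b_alt: "b = (\<lambda>t. \<mu> (vline \<eta> t) ^ n * (on_axis \<delta> G t))"
    by (auto simp: b_def)
  have am: "a \<in> borel_measurable lborel" unfolding a_def by measurable
  have bi: "integrable lborel b"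
  proof (rule bochner_bound)
    show "integrable lborel (\<lambda>t. \<mu>0 ^ n * norm (on_axis \<delta> G t))"
      by (intro integrable_mult_right integrable_norm G)
    show "b \<in> borel_measurable lborel" unfolding b_alt by measurable
    show "AE t in lborel. norm (b t) \<le> norm (\<mu>0 ^ n * norm (on_axis \<delta> G t))"
      unfolding b_alt norm_mult norm_power using norm_\<mu>_le
      by (intro AE_I2 mult_mono) (auto intro!: power_mono order_trans[OF _ abs_ge_self])
  qed
  have Wi: "integrable lborel W"
    unfolding W_def by (intro bochner_addI integrable_mult_right integrable_norm G integrable_gauss h)
  have mgf: "wmgf M (U i) (T n) (vline \<eta> t) = \<nu> (vline \<eta> t) * \<mu> (vline \<eta> t) ^ (n - 1)" for t
    using wmgf_sum[of "\<lambda>x. x" i n "vline \<eta> t"] i J_mem by (simp add: \<nu>_def)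
  \<comment> \<open>\<open>t = 0\<close> is left out because for \<eta> = 0 it gives
    \<open>s = 0\<close>, where the factor \<open>s\<close> in \<open>rel\<close> cannot be
    cancelled.\<close>
  have bound: "AE t in lborel. norm (a t - b t) \<le> W t"
    using AE_lborel_singleton[of 0]
  proof eventually_elim
    case (elim t)
    define s where "s = vline \<eta> t"
    have s0: "s \<noteq> 0" using elim by (auto simp: s_def complex_eq_iff)
    have hs: "h\<^sup>2 \<le> 1" using h by (simp add: power_le_one)
    show ?case
    proof (cases "\<bar>t\<bar> \<le> \<delta>")
      case True
      have "a t = exp ((h * s)\<^sup>2 / 2) * (G (\<i> * t) * s * \<mu> s * \<mu> s ^ (n - 1) / s)"
        unfolding a_def mgf rel[OF True, symmetric] s_def ..
      also have "\<dots> = exp ((h * s)\<^sup>2 / 2) * (\<mu> s ^ n * G (\<i> * t))"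
        using s0 i by (cases n) auto
      finally have "a t - b t = (exp ((h * s)\<^sup>2 / 2) - 1) * (\<mu> s ^ n * G (\<i> * t))"
        using True by (simp add: b_def s_def indicator_def abs_le_iff algebra_simps)
      then have "norm (a t - b t) = norm (exp ((h * s)\<^sup>2 / 2) - 1) * (norm (\<mu> s) ^ n * norm (G (\<i> * t)))"
        by (simp add: norm_mult norm_power)
      also have "\<dots> \<le> (h\<^sup>2 * C) * (\<mu>0 ^ n * norm (G (\<i> * t)))"
      proof (intro mult_mono power_mono)
        have "norm s ^ 2 = \<eta>\<^sup>2 + t\<^sup>2" by (simp add: s_def cmod_power2)
        also have "\<dots> \<le> \<eta>\<^sup>2 + \<delta>\<^sup>2" using True power_mono[of "\<bar>t\<bar>" \<delta> 2] by simp
        finally have ns: "norm s ^ 2 \<le> \<eta>\<^sup>2 + \<delta>\<^sup>2" .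
        have nz: "norm ((h * s)\<^sup>2 / 2) = h\<^sup>2 * norm s ^ 2 / 2"
          by (simp add: norm_mult norm_divide norm_power power_mult_distrib)
        also have "\<dots> \<le> h\<^sup>2 * (\<eta>\<^sup>2 + \<delta>\<^sup>2)"
          using ns mult_left_mono[OF ns, of "h\<^sup>2"] by (simp add: field_simps) (smt (verit) zero_le_power2 mult_nonneg_nonneg)
        finally have nz1: "norm ((h * s)\<^sup>2 / 2) \<le> h\<^sup>2 * (\<eta>\<^sup>2 + \<delta>\<^sup>2)" .
        also have "\<dots> \<le> 1 * (\<eta>\<^sup>2 + \<delta>\<^sup>2)" using hs by (intro mult_right_mono) auto
        finally have nz2: "norm ((h * s)\<^sup>2 / 2) \<le> \<eta>\<^sup>2 + \<delta>\<^sup>2" by simp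
        have "norm (exp ((h * s)\<^sup>2 / 2) - 1) \<le> exp (norm ((h * s)\<^sup>2 / 2)) * norm ((h * s)\<^sup>2 / 2)"
          using Taylor_exp_field[of "(h * s)\<^sup>2 / 2" 0] by simp
        also have "\<dots> \<le> exp (\<eta>\<^sup>2 + \<delta>\<^sup>2) * (h\<^sup>2 * (\<eta>\<^sup>2 + \<delta>\<^sup>2))"
          using nz1 nz2 by (intro mult_mono) auto
        finally show "norm (exp ((h * s)\<^sup>2 / 2) - 1) \<le> h\<^sup>2 * C" by (simp add: C_def mult_ac)
        show "norm (\<mu> s) \<le> \<mu>0" unfolding s_def by (rule norm_\<mu>_le)
      qed (use \<mu>0_pos in \<open>auto simp: C_def\<close>)
      also have "\<dots> \<le> W t"
      proof -
        have "0 \<le> exp (\<eta>\<^sup>2) * N0 * (q * \<mu>0) ^ (n - 1) / \<delta> * gauss (h * t)"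
          using N0_nonneg q \<mu>0_pos \<delta> by (intro mult_nonneg_nonneg divide_nonneg_nonneg zero_le_power) auto
        then show ?thesis using True by (simp add: W_def mult.assoc abs_le_iff)
      qed
      finally show ?thesis .
    next
      case False
      then have "b t = 0" by (auto simp: b_def indicator_def abs_le_iff)
      then have "norm (a t - b t) = exp ((h * \<eta>)\<^sup>2 / 2) * gauss (h * t) * (norm (\<nu> s) * norm (\<mu> s) ^ (n - 1) / norm s)"
        by (simp only: a_def mgf norm_mult norm_divide norm_power norm_exp_vline_square s_def diff_zero)
      also have "\<dots> \<le> exp (\<eta>\<^sup>2) * gauss (h * t) * (N0 * (q * \<mu>0) ^ (n - 1) / \<delta>)"
      proof (intro mult_mono frac_le power_mono)
        have "(h * \<eta>)\<^sup>2 \<le> 1 * \<eta>\<^sup>2" unfolding power_mult_distrib using hs by (intro mult_right_mono) auto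
        then have "(h * \<eta>)\<^sup>2 / 2 \<le> \<eta>\<^sup>2" using zero_le_power2[of "h * \<eta>"] by linarith
        then show "exp ((h * \<eta>)\<^sup>2 / 2) \<le> exp (\<eta>\<^sup>2)" by simp
        show "\<delta> \<le> norm s" using False abs_Im_le_cmod[of s] by (simp add: s_def)
        show "norm (\<mu> s) \<le> q * \<mu>0" unfolding s_def using False by (intro decay) auto
        show "norm (\<nu> s) \<le> N0" unfolding s_def by (rule norm_\<nu>_le)
      qed (use N0_nonneg q \<mu>0_pos \<delta> in auto)
      also have "\<dots> \<le> W t"
      proof -
        have "0 \<le> h\<^sup>2 * C * \<mu>0 ^ n * norm (on_axis \<delta> G t)"
          using \<mu>0_pos by (intro mult_nonneg_nonneg) (auto simp: C_def)
        then show ?thesis by (simp add: W_def mult_ac)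
      qed
      finally show ?thesis .
    qed
  qed
  have di: "integrable lborel (\<lambda>t. a t - b t)"
    by (rule bochner_bound[OF Wi])
       (use am bi bound in \<open>auto elim!: eventually_mono intro: order_trans[OF _ abs_ge_self]\<close>)
  have ai: "integrable lborel a" using bochner_addI[OF di bi] by simp
  have "complex_of_real (2 * pi * smooth_tail h i n) = (\<integral>t. a t \<partial>lborel)"
    unfolding a_def
    by (rule integral_gauss_step_fourier)
       (use i h integrable_U expectation_U integrable_U_exp_T[OF i J_mem(1)] integrable_U_T_exp_T[OF i J_mem(1)]
         integrable_U_T_exp_T[OF i J_mem(2)] prob_space_axioms in auto)
  then have "complex_of_real (2 * pi * smooth_tail h i n) - (\<integral>t. b t \<partial>lborel) = (\<integral>t. a t - b t \<partial>lborel)"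
    using ai bi by simp
  also have "norm \<dots> \<le> (\<integral>t. norm (a t - b t) \<partial>lborel)" by (rule integral_norm_bound)
  also have "\<dots> \<le> (\<integral>t. W t \<partial>lborel)"
    by (rule integral_mono_AE) (use di Wi bound in auto)
  also have "\<dots> = h\<^sup>2 * C * \<mu>0 ^ n * (\<integral>t. norm (on_axis \<delta> G t) \<partial>lborel)
      + exp (\<eta>\<^sup>2) * N0 * (q * \<mu>0) ^ (n - 1) / \<delta> * (sqrt (2 * pi) / h)"
    unfolding W_def
    by (subst bochner_add)
       (use integrable_gauss[OF h(1)] integrable_norm[OF G] in \<open>auto simp del: norm_scaleR\<close>)
  finally show ?thesis by (simp only: C_def b_def)
qed

end

text \<open>With \<open>r\<close> the cube root of \<theta>, \<open>n * r ^ n\<close> tends to 0;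
  its cube shows that \<open>n ^ 3 * \<theta> ^ n\<close> is bounded, and the third power exceeds
  the exponent 5/2.\<close>

lemma power_le_inverse_power_sqrt:
  fixes \<theta> :: real
  assumes "0 < \<theta>" "\<theta> < 1"
  obtains B where "B \<ge> 0" "\<And>n::nat. n \<ge> 1 \<Longrightarrow> \<theta> ^ n \<le> B * (1 / (n\<^sup>2 * sqrt n))"
proof -
  define r where "r = root 3 \<theta>"
  have r: "0 < r" "r < 1" "r ^ 3 = \<theta>" using assms by (auto simp: r_def)
  have "(\<lambda>n. (of_nat n * r ^ n) ^ 3) \<longlonglongrightarrow> 0 ^ 3"
    using r by (intro tendsto_power powser_times_n_limit_0) auto
  moreover have "(of_nat n * r ^ n) ^ 3 = of_nat n ^ 3 * \<theta> ^ n" for n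
    unfolding power_mult_distrib r(3)[symmetric] by (simp add: mult.commute flip: power_mult)
  ultimately have "(\<lambda>n. of_nat n ^ 3 * \<theta> ^ n) \<longlonglongrightarrow> 0" by simp
  then have "Bseq (\<lambda>n. real n ^ 3 * \<theta> ^ n)" by (intro convergent_imp_Bseq) (auto simp: convergent_def)
  then obtain B where B: "B > 0" "\<And>n. norm (real n ^ 3 * \<theta> ^ n) \<le> B" by (auto simp: Bseq_def)
  show thesis
  proof (rule that[of B])
    fix n :: nat assume n: "n \<ge> 1"
    have "sqrt n \<le> n" using n by (intro real_le_lsqrt self_le_power) auto
    then have le: "(real n)\<^sup>2 * sqrt n \<le> real n ^ 3" by (simp add: power3_eq_cube power2_eq_square mult_left_mono)
    have "real n ^ 3 * \<theta> ^ n \<le> B" using B(2)[of n] by (auto dest: abs_le_D1)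
    then have "(real n)\<^sup>2 * sqrt n * \<theta> ^ n \<le> B"
      using order_trans[OF mult_right_mono[OF le, of "\<theta> ^ n"]] assms by simp
    then show "\<theta> ^ n \<le> B * (1 / (n\<^sup>2 * sqrt n))" using n by (simp add: field_simps)
  qed (use B in auto)
qed

context centred_pairs begin

text \<open>The choice \<open>h = sqrt q ^ n\<close> balances the smoothing error \<open>q ^ n + h\<close> against the tail
  \<open>q ^ n / h\<close> of the contour integral.\<close>

theorem weighted_tail_expansion:
  fixes \<kappa> G :: "complex \<Rightarrow> complex" and c :: real
  assumes \<kappa>: "\<kappa> has_fps_expansion F" and G: "G has_fps_expansion H"
    and F: "fps_nth F 0 = 0" "fps_nth F 1 = 0" "fps_nth F 2 = of_real (c / 2)" and c: "c > 0"
    and rel\<kappa>: "\<forall>\<^sub>F w in nhds 0. \<mu> (of_real \<eta> + w) = of_real \<mu>0 * exp (\<kappa> w)"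
    and relG: "\<forall>\<^sub>F w in nhds 0. G w * (of_real \<eta> + w) * \<mu> (of_real \<eta> + w) = \<nu> (of_real \<eta> + w)"
  obtains C where "\<And>n i. i < n \<Longrightarrow>
    norm (complex_of_real (sqrt (2 * pi * n * c) * tail i n / \<mu>0 ^ n)
      - (fps_nth H 0 + laplace_coeff c F H / n)) \<le> C / (real n)\<^sup>2"
proof -
  have "\<forall>\<^sub>F w in nhds 0. \<mu> (of_real \<eta> + w) = of_real \<mu>0 * exp (\<kappa> w)
      \<and> G w * (of_real \<eta> + w) * \<mu> (of_real \<eta> + w) = \<nu> (of_real \<eta> + w)"
    using rel\<kappa> relG by (rule eventually_conj)
  then obtain \<epsilon> where \<epsilon>: "\<epsilon> > 0" and rel: "\<And>w. dist w 0 < \<epsilon> \<Longrightarrow> \<mu> (of_real \<eta> + w) = of_real \<mu>0 * exp (\<kappa> w)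
      \<and> G w * (of_real \<eta> + w) * \<mu> (of_real \<eta> + w) = \<nu> (of_real \<eta> + w)"
    unfolding eventually_nhds_metric by blast
  \<comment> \<open>Halving places the closed window inside the open disc where the relations
    hold.\<close>
  have \<epsilon>2: "\<epsilon> / 2 > 0" using \<epsilon> by simp
  obtain \<delta> C1 :: real where \<delta>: "0 < \<delta>" "\<delta> \<le> \<epsilon> / 2"
    and Gint: "integrable lborel (\<lambda>t. on_axis \<delta> G t)"
    and C1: "\<And>n::nat. n \<ge> 1 \<Longrightarrow>
       norm ((\<integral>t. indicat_real {-\<delta>..\<delta>} t *\<^sub>R (exp (n * \<kappa> (\<i> * of_real t)) * G (\<i> * of_real t)) \<partial>lborel)
         - sqrt (2 * pi / (n * c)) *\<^sub>R (fps_nth H 0 + laplace_coeff c F H / n)) \<le> C1 * (1 / (n\<^sup>2 * sqrt n))"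
    by (rule laplace_expansion[OF \<kappa> G F c \<epsilon>2]) (rule that; assumption)
  have near: "dist (\<i> * of_real t) 0 < \<epsilon>" if "\<bar>t\<bar> \<le> \<delta>" for t
    using that \<delta> \<epsilon> by (simp add: norm_mult)
  have rel1: "\<mu> (vline \<eta> t) = of_real \<mu>0 * exp (\<kappa> (\<i> * of_real t))" if "\<bar>t\<bar> \<le> \<delta>" for t
    using rel[OF near[OF that]] by (rule conjunct1)
  have rel2: "G (\<i> * of_real t) * vline \<eta> t * \<mu> (vline \<eta> t) = \<nu> (vline \<eta> t)" if "\<bar>t\<bar> \<le> \<delta>" for t
    using rel[OF near[OF that]] by (rule conjunct2)
  obtain q where q: "0 < q" "q < 1" and decay: "\<And>t. \<bar>t\<bar> \<ge> \<delta> \<Longrightarrow> norm (\<mu> (vline \<eta> t)) \<le> q * \<mu>0"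
    using \<mu>_decay[OF \<delta>(1)] by blast
  define \<theta> where "\<theta> = sqrt q"
  have \<theta>: "0 < \<theta>" "\<theta> < 1" "q = \<theta>\<^sup>2" using q by (auto simp: \<theta>_def)
  obtain B where B: "B \<ge> 0" "\<And>n::nat. n \<ge> 1 \<Longrightarrow> \<theta> ^ n \<le> B * (1 / (n\<^sup>2 * sqrt n))"
    using power_le_inverse_power_sqrt[OF \<theta>(1,2)] by blast
  define \<Gamma> where "\<Gamma> = (\<integral>t. norm (on_axis \<delta> G t) \<partial>lborel)"
  have \<Gamma>: "\<Gamma> \<ge> 0" unfolding \<Gamma>_def by (intro bochner_nonneg) auto
  \<comment> \<open>\<open>A1\<close> collects the smoothing error, \<open>A2\<close> the Gaussian
    factor inside the window and \<open>A3\<close> the contour outside it, each relative to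
    \<open>h * \<mu>0 ^ n\<close>.\<close>
  define A1 where "A1 = exp (\<eta>\<^sup>2) * (N0 / \<mu>0 * (1 / q + 2 * \<delta>))"
  define A2 where "A2 = exp (\<eta>\<^sup>2 + \<delta>\<^sup>2) * (\<eta>\<^sup>2 + \<delta>\<^sup>2) * \<Gamma>"
  define A3 where "A3 = exp (\<eta>\<^sup>2) * N0 / \<mu>0 / q / \<delta> * sqrt (2 * pi)"
  define A where "A = 2 * pi * A1 + A2 + A3"
  have A0: "A1 \<ge> 0" "A2 \<ge> 0" "A3 \<ge> 0"
    using N0_nonneg \<mu>0_pos q \<delta> \<Gamma> by (auto simp: A1_def A2_def A3_def)
  have main: "norm (complex_of_real (2 * pi * tail i n / \<mu>0 ^ n)
      - sqrt (2 * pi / (n * c)) *\<^sub>R (fps_nth H 0 + laplace_coeff c F H / n)) \<le> (A * B + C1) * (1 / (n\<^sup>2 * sqrt n))"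
    if i: "i < n" for i n
  proof -
    let ?Q = "sqrt (2 * pi / (n * c)) *\<^sub>R (fps_nth H 0 + laplace_coeff c F H / n)"
    define h where "h = \<theta> ^ n"
    have n: "n \<ge> 1" using i by simp
    have h: "0 < h" "h \<le> 1" using \<theta> by (auto simp: h_def power_le_one)
    \<comment> \<open>By the choice of \<open>h\<close>, \<open>h\<^sup>2\<close> is
      \<open>q ^ n\<close>; the 1/q pays for the one factor taken by the weight
      \<open>U i\<close>.\<close>
    have qh: "q ^ (n - 1) = h\<^sup>2 / q"
    proof -
      have "h\<^sup>2 = q ^ n" by (simp add: h_def \<theta>(3) power_mult[symmetric] mult.commute)
      also have "\<dots> = q * q ^ (n - 1)" using n by (cases n) auto
      finally show ?thesis using q by simp
    qed
    have \<mu>n: "\<mu>0 ^ (n - 1) = \<mu>0 ^ n / \<mu>0" using n \<mu>0_pos by (cases n) auto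
    have h2: "h\<^sup>2 \<le> h" using h by (simp add: power2_eq_square mult_left_le)
    define E where "E = tail i n"
    define S where "S = smooth_tail h i n"
    define L where "L = (\<integral>t. indicat_real {-\<delta>..\<delta>} t *\<^sub>R (exp (n * \<kappa> (\<i> * of_real t)) * G (\<i> * of_real t)) \<partial>lborel)"
    have "\<bar>E - S\<bar> \<le> exp ((\<eta> * h)\<^sup>2) * (N0 * \<mu>0 ^ (n - 1) * (q ^ (n - 1) + 2 * \<delta> * h))"
      unfolding E_def S_def by (rule smoothing_error) (use i h q \<delta> decay in auto)
    also have "\<dots> \<le> exp (\<eta>\<^sup>2) * (N0 * \<mu>0 ^ (n - 1) * (h / q + 2 * \<delta> * h))"
    proof -
      have "(\<eta> * h)\<^sup>2 \<le> \<eta>\<^sup>2 * 1" unfolding power_mult_distrib using h by (intro mult_left_mono) (auto simp: power_le_one)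
      moreover have "q ^ (n - 1) \<le> h / q" unfolding qh using h2 q by (intro divide_right_mono) auto
      ultimately show ?thesis
        using N0_nonneg \<mu>0_pos q \<delta> h by (intro mult_mono add_right_mono) auto
    qed
    also have "\<dots> = A1 * h * \<mu>0 ^ n" unfolding A1_def \<mu>n by (simp add: algebra_simps add_divide_distrib)
    finally have e1: "\<bar>E - S\<bar> \<le> A1 * h * \<mu>0 ^ n" .
    have "(\<integral>t. indicat_real {-\<delta>..\<delta>} t *\<^sub>R (\<mu> (vline \<eta> t) ^ n * G (\<i> * of_real t)) \<partial>lborel)
      = (\<integral>t. of_real (\<mu>0 ^ n) * (indicat_real {-\<delta>..\<delta>} t *\<^sub>R (exp (n * \<kappa> (\<i> * of_real t)) * G (\<i> * of_real t))) \<partial>lborel)"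
    proof (rule bochner_cong)
      fix t :: real
      show "indicat_real {-\<delta>..\<delta>} t *\<^sub>R (\<mu> (vline \<eta> t) ^ n * G (\<i> * of_real t)) = of_real (\<mu>0 ^ n) * (indicat_real {-\<delta>..\<delta>} t *\<^sub>R (exp (n * \<kappa> (\<i> * of_real t)) * G (\<i> * of_real t)))"
      proof (cases "\<bar>t\<bar> \<le> \<delta>")
        case True
        then show ?thesis unfolding rel1[OF True] by (simp add: power_mult_distrib exp_of_nat_mult)
      qed (auto simp: indicator_def abs_le_iff)
    qed simp
    also have "\<dots> = of_real (\<mu>0 ^ n) * L" unfolding L_def by (rule integral_mult_right_zero)
    finally have intL: "(\<integral>t. indicat_real {-\<delta>..\<delta>} t *\<^sub>R (\<mu> (vline \<eta> t) ^ n * G (\<i> * of_real t)) \<partial>lborel) = of_real (\<mu>0 ^ n) * L" .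
    have "norm (complex_of_real (2 * pi * S) - of_real (\<mu>0 ^ n) * L)
      \<le> h\<^sup>2 * (exp (\<eta>\<^sup>2 + \<delta>\<^sup>2) * (\<eta>\<^sup>2 + \<delta>\<^sup>2)) * \<mu>0 ^ n * \<Gamma> + exp (\<eta>\<^sup>2) * N0 * (q * \<mu>0) ^ (n - 1) / \<delta> * (sqrt (2 * pi) / h)"
      unfolding S_def \<Gamma>_def intL[symmetric] by (rule contour_error) (use i h q \<delta> decay Gint rel2 in auto)
    also have "h\<^sup>2 * (exp (\<eta>\<^sup>2 + \<delta>\<^sup>2) * (\<eta>\<^sup>2 + \<delta>\<^sup>2)) * \<mu>0 ^ n * \<Gamma> = h\<^sup>2 * A2 * \<mu>0 ^ n" by (simp add: A2_def)
    also have "\<dots> \<le> h * A2 * \<mu>0 ^ n" using h2 A0 \<mu>0_pos by (intro mult_right_mono) auto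
    also have "exp (\<eta>\<^sup>2) * N0 * (q * \<mu>0) ^ (n - 1) / \<delta> * (sqrt (2 * pi) / h) = h * A3 * \<mu>0 ^ n"
    proof -
      have qm: "(q * \<mu>0) ^ (n - 1) = h * (h * (\<mu>0 ^ n / (q * \<mu>0)))"
        unfolding power_mult_distrib qh \<mu>n by (simp add: power2_eq_square)
      show ?thesis unfolding qm A3_def using h by (simp add: mult_ac)
    qed
    finally have e2: "norm (complex_of_real (2 * pi * S) - of_real (\<mu>0 ^ n) * L) \<le> h * A2 * \<mu>0 ^ n + h * A3 * \<mu>0 ^ n" by simp
    have "norm (complex_of_real (2 * pi * E) - of_real (\<mu>0 ^ n) * L)
       \<le> norm (complex_of_real (2 * pi * E) - complex_of_real (2 * pi * S)) + norm (complex_of_real (2 * pi * S) - of_real (\<mu>0 ^ n) * L)"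
      using norm_triangle_ineq[of "complex_of_real (2 * pi * E) - complex_of_real (2 * pi * S)" "complex_of_real (2 * pi * S) - of_real (\<mu>0 ^ n) * L"]
      by simp
    also have "norm (complex_of_real (2 * pi * E) - complex_of_real (2 * pi * S)) = 2 * pi * \<bar>E - S\<bar>"
      unfolding of_real_diff[symmetric] norm_of_real by (simp add: abs_mult flip: right_diff_distrib)
    also have "2 * pi * \<bar>E - S\<bar> \<le> 2 * pi * (A1 * h * \<mu>0 ^ n)" using e1 by (intro mult_left_mono) auto
    also note e2
    finally have "norm (complex_of_real (2 * pi * E) - of_real (\<mu>0 ^ n) * L) \<le> A * h * \<mu>0 ^ n"
      by (simp add: A_def algebra_simps)
    moreover have "complex_of_real (2 * pi * E) - of_real (\<mu>0 ^ n) * L = of_real (\<mu>0 ^ n) * (complex_of_real (2 * pi * E / \<mu>0 ^ n) - L)"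
      using \<mu>0_pos by (simp add: field_simps)
    ultimately have "norm (complex_of_real (2 * pi * E / \<mu>0 ^ n) - L) \<le> A * h"
      using \<mu>0_pos by (simp add: norm_mult norm_power mult.commute)
    also have "\<dots> \<le> A * (B * (1 / (n\<^sup>2 * sqrt n)))"
      unfolding h_def using A0 by (intro mult_left_mono B n) (auto simp: A_def)
    finally have "norm (complex_of_real (2 * pi * E / \<mu>0 ^ n) - L) + norm (L - ?Q)
        \<le> A * (B * (1 / (n\<^sup>2 * sqrt n))) + C1 * (1 / (n\<^sup>2 * sqrt n))"
      using C1[OF n] unfolding L_def by (intro add_mono)
    note fin = this
    have "norm (complex_of_real (2 * pi * E / \<mu>0 ^ n) - ?Q)
      \<le> norm (complex_of_real (2 * pi * E / \<mu>0 ^ n) - L) + norm (L - ?Q)"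
      using norm_triangle_ineq[of "complex_of_real (2 * pi * E / \<mu>0 ^ n) - L" "L - ?Q"]
      by simp
    also note fin
    finally show ?thesis
      unfolding E_def by (simp only: distrib_right mult.assoc of_nat_power)
  qed
  show thesis
  proof (rule that)
    fix n i :: nat assume i: "i < n"
    \<comment> \<open>The reciprocal of the Laplace prefactor. Multiplying by it turns
      \<open>2 * pi\<close> into \<open>sqrt (2 * pi * n * c)\<close> and the error of order
      \<open>n powr (-5/2)\<close> into one of order 1/n^2.\<close>
    define r where "r = sqrt (n * c / (2 * pi))"
    define Q where "Q = fps_nth H 0 + laplace_coeff c F H / n"
    have n: "n \<ge> 1" using i by simp
    have r: "r > 0" "r * sqrt (2 * pi / (n * c)) = 1" using n c by (auto simp: r_def simp flip: real_sqrt_mult)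
    have r2: "r * (2 * pi) = sqrt (2 * pi * n * c)"
    proof -
      have "r * (2 * pi) = sqrt (n * c / (2 * pi)) * sqrt ((2 * pi)\<^sup>2)"
        unfolding r_def by (simp only: real_sqrt_abs) simp
      also have "\<dots> = sqrt (2 * pi * n * c)" unfolding real_sqrt_mult[symmetric] by (simp add: power2_eq_square mult_ac)
      finally show ?thesis .
    qed
    define E where "E = tail i n"
    have "complex_of_real (sqrt (2 * pi * n * c) * E / \<mu>0 ^ n) - Q = of_real r * (complex_of_real (2 * pi * E / \<mu>0 ^ n) - sqrt (2 * pi / (n * c)) *\<^sub>R Q)"
    proof -
      have "of_real r * (complex_of_real (2 * pi * E / \<mu>0 ^ n) - sqrt (2 * pi / (n * c)) *\<^sub>R Q)
         = complex_of_real (r * (2 * pi) * E / \<mu>0 ^ n) - complex_of_real (r * sqrt (2 * pi / (n * c))) * Q"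
        by (simp add: scaleR_conv_of_real right_diff_distrib mult_ac)
      then show ?thesis unfolding r2 r(2) by simp
    qed
    also have "norm \<dots> \<le> r * ((A * B + C1) * (1 / (n\<^sup>2 * sqrt n)))"
      unfolding norm_mult norm_of_real Q_def E_def using main[OF i] r by (intro mult_mono) auto
    also have "\<dots> = (A * B + C1) * sqrt (c / (2 * pi)) / (real n)\<^sup>2"
    proof -
      have "r = sqrt n * sqrt (c / (2 * pi))" by (simp add: r_def flip: real_sqrt_mult)
      then show ?thesis using n by (simp add: field_simps)
    qed
    finally show "norm (complex_of_real (sqrt (2 * pi * n * c) * tail i n / \<mu>0 ^ n)
      - (fps_nth H 0 + laplace_coeff c F H / n)) \<le> (A * B + C1) * sqrt (c / (2 * pi)) / (real n)\<^sup>2"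
      unfolding E_def Q_def .
  qed
qed

end

section \<open>Identification of the coefficients\<close>

text \<open>Along the real axis the complex derivative is a vector derivative of a curve whose
  imaginary part is locally 0, so the imaginary part of \<open>D\<close> vanishes.\<close>

lemma has_real_derivative_of_complex:
  fixes f :: "complex \<Rightarrow> complex" and g :: "real \<Rightarrow> real"
  assumes f: "(f has_field_derivative D) (at (of_real x))"
    and eq: "\<forall>\<^sub>F y in nhds x. f (of_real y) = of_real (g y)"
  shows "(g has_real_derivative Re D) (at x)" "D = of_real (Re D)"
proof -
  have "((\<lambda>y. f (of_real y)) has_vector_derivative D) (at x)"
    using has_vector_derivative_real_field[OF f] by simp
  then have der: "((\<lambda>y. complex_of_real (g y)) has_vector_derivative D) (at x)"
    using eq eventually_nhds_x_imp_x[OF eq]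
    by (subst (asm) has_vector_derivative_cong_ev) (auto elim: eventually_mono)
  have "((\<lambda>y. Re (complex_of_real (g y))) has_vector_derivative Re D) (at x)"
    by (rule bounded_linear.has_vector_derivative[OF bounded_linear_Re der])
  then show "(g has_real_derivative Re D) (at x)"
    by (simp add: has_real_derivative_iff_has_vector_derivative)
  have "((\<lambda>y. Im (complex_of_real (g y))) has_vector_derivative Im D) (at x)"
    by (rule bounded_linear.has_vector_derivative[OF bounded_linear_Im der])
  then have "((\<lambda>y. 0::real) has_vector_derivative Im D) (at x)" by simp
  then have "Im D = 0" using vector_derivative_unique_at has_vector_derivative_const by blast
  then show "D = of_real (Re D)" by (simp add: complex_eq_iff)
qed

text \<open>The induction is on equality in a neighbourhood, since equality at one point would not
  survive differentiation. This identifies Taylor coefficients of the complex extensions with the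
  real iterated \<open>deriv\<close>.\<close>

lemma higher_deriv_of_real:
  fixes f :: "complex \<Rightarrow> complex" and g :: "real \<Rightarrow> real"
  assumes an: "f analytic_on {of_real x0}"
    and eq: "\<forall>\<^sub>F x in nhds x0. f (of_real x) = of_real (g x)"
  shows "(deriv ^^ n) f (of_real x0) = of_real ((deriv ^^ n) g x0)"
proof -
  obtain S where S: "open S" "of_real x0 \<in> S" "f holomorphic_on S" using an by (auto simp: analytic_at)
  have "continuous_on UNIV complex_of_real" by (intro continuous_intros)
  then have "open (complex_of_real -` S)" using S by (intro open_vimage)
  then have evS: "\<forall>\<^sub>F x in nhds x0. complex_of_real x \<in> S"
    using S eventually_nhds_in_open[of "complex_of_real -` S" x0] by simp
  have "\<forall>\<^sub>F x in nhds x0. (deriv ^^ n) f (of_real x) = of_real ((deriv ^^ n) g x)"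
  proof (induction n)
    case 0 then show ?case using eq by simp
  next
    case (Suc n)
    then have "\<forall>\<^sub>F x in nhds x0. \<forall>\<^sub>F y in nhds x. (deriv ^^ n) f (of_real y) = of_real ((deriv ^^ n) g y)"
      by (simp add: eventually_eventually)
    with evS show ?case
    proof eventually_elim
      case (elim x)
      have "((deriv ^^ n) f has_field_derivative deriv ((deriv ^^ n) f) (of_real x)) (at (of_real x))"
        using S elim(1) by (intro holomorphic_derivI[where S=S] holomorphic_higher_deriv) auto
      from has_real_derivative_of_complex[OF this elim(2)]
      show ?case by (simp add: DERIV_imp_deriv)
    qed
  qed
  then show ?thesis by (rule eventually_nhds_x_imp_x)
qed

lemma has_real_derivative_mgf:
  fixes V Y :: "'a \<Rightarrow> real"
  assumes "V \<in> borel_measurable M" "Y \<in> borel_measurable M"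
    and "\<And>e. e \<in> {l<..<u} \<Longrightarrow> integrable M (\<lambda>x. V x * exp (e * Y x))" and "e \<in> {l<..<u}"
  shows "((\<lambda>e. \<integral>x. V x * exp (e * Y x) \<partial>M) has_real_derivative (\<integral>x. V x * Y x * exp (e * Y x) \<partial>M)) (at e)"
proof -
  have "(wmgf M V Y has_field_derivative wmgf M (\<lambda>x. V x * Y x) Y (of_real e)) (at (of_real e))"
    by (rule has_field_derivative_wmgf) (use assms in auto)
  from has_real_derivative_of_complex(1)[OF this, of "\<lambda>e. \<integral>x. V x * exp (e * Y x) \<partial>M"]
  show ?thesis by (simp add: wmgf_of_real)
qed

context centred_pairs begin

lemma analytic_wmgf:
  assumes "V \<in> borel_measurable M" "\<And>e. e \<in> {l<..<u} \<Longrightarrow> integrable M (\<lambda>x. V x * exp (e * Z 0 x))"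
  shows "wmgf M V (Z 0) analytic_on {of_real \<eta>}"
proof -
  have "open {s. l < Re s \<and> Re s < u}"
    by (intro open_Collect_conj open_Collect_less continuous_intros)
  moreover have "wmgf M V (Z 0) holomorphic_on {s. l < Re s \<and> Re s < u}"
    unfolding holomorphic_on_def field_differentiable_def
  proof
    fix s assume "s \<in> {s. l < Re s \<and> Re s < u}"
    then have "(wmgf M V (Z 0) has_field_derivative wmgf M (\<lambda>x. V x * Z 0 x) (Z 0) s) (at s)"
      by (intro has_field_derivative_wmgf[where l=l and u=u]) (use assms in auto)
    then show "\<exists>f'. (wmgf M V (Z 0) has_field_derivative f') (at s within {s. l < Re s \<and> Re s < u})"
      by (blast intro: has_field_derivative_at_within)
  qed
  ultimately show ?thesis using J by (auto simp: analytic_at intro!: exI[of _ "{s. l < Re s \<and> Re s < u}"])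
qed

lemma int_exp_strip: "e \<in> {l<..<u} \<Longrightarrow> integrable M (\<lambda>x. 1 * exp (e * Z 0 x))"
  "e \<in> {l<..<u} \<Longrightarrow> integrable M (\<lambda>x. U 0 x * exp (e * Z 0 x))"
  using int_exp[of e] int_U_exp[of e] J by auto

lemma analytic_\<mu>: "\<mu> analytic_on {of_real \<eta>}" and analytic_\<nu>: "\<nu> analytic_on {of_real \<eta>}"
  unfolding \<mu>_def \<nu>_def by (intro analytic_wmgf; use int_exp_strip in simp)+

text \<open>A law with a density has no atom at 0. This makes the second moments of
  \<open>Z 0\<close>, tilted or not, strictly positive.\<close>

lemma Z_not_AE_zero: "\<not> (AE x in M. Z 0 x = 0)"
proof
  assume ae: "AE x in M. Z 0 x = 0"
  have dist: "distr M lborel (Z 0) = density lborel fZ" and [measurable]: "fZ \<in> borel_measurable borel"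
    using dens by (auto simp: distributed_def)
  have "AE z in distr M lborel (Z 0). z = 0"
    using ae by (subst AE_distr_iff) auto
  then have "AE z in density lborel fZ. z = 0" unfolding dist .
  moreover have "AE z in density lborel fZ. z \<noteq> 0"
    by (subst AE_density) (auto intro: AE_mp[OF AE_lborel_singleton[of 0]])
  ultimately have "AE z in density lborel fZ. False" by eventually_elim simp
  then have "AE z in distr M lborel (Z 0). False" unfolding dist .
  then have "AE x in M. False" by (subst (asm) AE_distr_iff) auto
  then show False by simp
qed

text \<open>\<open>H0\<close>, \<open>H1\<close>, \<open>H2\<close> are the first Taylor
  coefficients at \<eta> of \<open>(Kg s - c0) / s\<close>. They are given by the equations of
  multiplication by \<eta> + X rather than by quotients, so that \<eta> = 0 is included. The summand
  \<open>e * a\<close> in \<open>K\<close> undoes the shift from \<open>Y\<close> to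
  \<open>Y - a\<close>.\<close>

theorem cumulant_tail_expansion:
  fixes K Kg :: "real \<Rightarrow> real" and a c0 :: real
  defines "K2 \<equiv> deriv (deriv K) \<eta>" and "K3 \<equiv> (deriv ^^ 3) K \<eta>" and "K4 \<equiv> (deriv ^^ 4) K \<eta>"
  assumes K: "\<forall>\<^sub>F e in nhds \<eta>. K e = ln (mgf e) + e * a"
    and Kg: "\<forall>\<^sub>F e in nhds \<eta>. Kg e = c0 + U_mgf e / mgf e"
    and saddle: "(K has_real_derivative a) (at \<eta>)"
  shows "K2 > 0"
    and "\<exists>H0 H1 H2 C. of_real \<eta> * H0 = complex_of_real (Kg \<eta> - c0)
      \<and> of_real \<eta> * H1 + H0 = complex_of_real (deriv Kg \<eta>)
      \<and> of_real \<eta> * H2 + H1 = complex_of_real (deriv (deriv Kg) \<eta> / 2)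
      \<and> (\<forall>n i. i < n \<longrightarrow>
           norm (complex_of_real (sqrt (2 * pi * n * K2) * tail i n
              / exp (n * (K \<eta> - \<eta> * a)))
            - (H0 + (- H2 / of_real K2 + 3 * (of_real (K3 / 6) * H1 + of_real (K4 / 24) * H0) / of_real K2 ^ 2
                - 15 * of_real (K3 / 6) ^ 2 * H0 / (2 * of_real K2 ^ 3)) / n)) \<le> C / (real n)\<^sup>2)" (is ?expansion)
proof -
  let ?v = "expectation (\<lambda>x. Z 0 x * Z 0 x * exp (\<eta> * Z 0 x))"
  have \<eta>: "\<eta> \<in> {l<..<u}" using J by simp
  have ev_strip: "\<forall>\<^sub>F e in nhds \<eta>. e \<in> {l<..<u}" using \<eta> by (intro eventually_nhds_in_open) auto
  have \<mu>_real: "\<mu> (of_real e) = of_real (mgf e)" for e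
    by (simp add: \<mu>_def wmgf_of_real)
  have \<nu>_real: "\<nu> (of_real e) = of_real (U_mgf e)" for e
    by (simp add: \<nu>_def wmgf_of_real)
  have K\<eta>: "K \<eta> = ln \<mu>0 + \<eta> * a" using eventually_nhds_x_imp_x[OF K] by (simp add: \<mu>0_def)
  have exp_K: "exp (n * (K \<eta> - \<eta> * a)) = \<mu>0 ^ n" for n :: nat
    using \<mu>0_pos by (simp add: K\<eta> exp_of_nat_mult)
  have \<mu>\<eta>: "\<mu> (of_real \<eta>) / of_real \<mu>0 = 1" using \<mu>0_pos by (simp add: \<mu>_\<eta>)
  \<comment> \<open>Dividing by \<open>\<mu>0\<close> puts the argument of the complex logarithm at
    1 at the saddlepoint, away from the branch cut; \<open>ln \<mu>0\<close> is restored as a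
    constant.\<close>
  define f where "f = (\<lambda>s. ln (\<mu> s / of_real \<mu>0) + (s * of_real a + of_real (ln \<mu>0)))"
  have f_an: "f analytic_on {of_real \<eta>}"
    unfolding f_def by (intro analytic_intros analytic_\<mu>) (use \<mu>\<eta> \<mu>0_pos in auto)
  have f_real: "\<forall>\<^sub>F e in nhds \<eta>. f (of_real e) = of_real (K e)"
    using K ev_strip
  proof eventually_elim
    case (elim e)
    define m where "m = mgf e"
    have m: "m > 0" unfolding m_def by (rule mgf_pos) (use elim J in auto)
    have "ln (\<mu> (of_real e) / of_real \<mu>0) = of_real (ln (m / \<mu>0))"
      unfolding \<mu>_real m_def[symmetric] of_real_divide[symmetric] by (rule Ln_of_real) (use m \<mu>0_pos in auto)
    also have "ln (m / \<mu>0) = ln m - ln \<mu>0" using m \<mu>0_pos by (simp add: ln_div)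
    finally show ?case using elim(1) by (simp add: f_def m_def)
  qed
  note f_deriv = higher_deriv_of_real[OF f_an f_real]
  have "isCont \<mu> (of_real \<eta>)" using analytic_\<mu> analytic_at_imp_isCont by blast
  then have "((\<lambda>s. \<mu> s / of_real \<mu>0) \<longlongrightarrow> 1) (nhds (of_real \<eta>))"
    using \<mu>\<eta> \<mu>0_pos unfolding isCont_def tendsto_at_iff_tendsto_nhds
    by (auto intro!: tendsto_eq_intros)
  then have "\<forall>\<^sub>F s in nhds (of_real \<eta>). dist (\<mu> s / of_real \<mu>0) 1 < 1" by (rule tendstoD) simp
  then have ev_good: "\<forall>\<^sub>F s in nhds (of_real \<eta>). \<mu> s \<noteq> 0 \<and> \<mu> s / of_real \<mu>0 \<notin> \<real>\<^sub>\<le>\<^sub>0"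
  proof eventually_elim
    case (elim s)
    have "Re (1 - \<mu> s / of_real \<mu>0) \<le> norm (1 - \<mu> s / of_real \<mu>0)" by (rule complex_Re_le_cmod)
    also have "\<dots> < 1" using elim by (simp add: dist_norm norm_minus_commute)
    finally have "Re (\<mu> s / of_real \<mu>0) > 0" by simp
    then show ?case by (auto simp: complex_nonpos_Reals_iff)
  qed
  have "open {s. l < Re s \<and> Re s < u}"
    by (intro open_Collect_conj open_Collect_less continuous_intros)
  then have ev_strip': "\<forall>\<^sub>F s in nhds (complex_of_real \<eta>). l < Re s \<and> Re s < u"
    using eventually_nhds_in_open[of "{s. l < Re s \<and> Re s < u}" "of_real \<eta>"] \<eta> by simp
  define \<mu>' where "\<mu>' = wmgf M (\<lambda>x. 1 * Z 0 x) (Z 0)"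
  define \<mu>'' where "\<mu>'' = wmgf M (\<lambda>x. 1 * Z 0 x * Z 0 x) (Z 0)"
  have d1: "(\<mu> has_field_derivative \<mu>' s) (at s)" if "l < Re s" "Re s < u" for s
    unfolding \<mu>_def \<mu>'_def using that int_exp_strip
    by (intro has_field_derivative_wmgf[where l=l and u=u]) auto
  have intZ: "integrable M (\<lambda>x. 1 * Z 0 x * exp (e * Z 0 x))" if "e \<in> {l<..<u}" for e
    by (rule integrable_exp_times[OF _ _ _ that]) (use int_exp_strip in auto)
  have d2: "(\<mu>' has_field_derivative \<mu>'' s) (at s)" if "l < Re s" "Re s < u" for s
    unfolding \<mu>'_def \<mu>''_def using that intZ
    by (intro has_field_derivative_wmgf[where l=l and u=u]) auto
  have "\<forall>\<^sub>F s in nhds (of_real \<eta>). deriv f s = \<mu>' s / \<mu> s + of_real a"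
    using ev_good ev_strip'
  proof eventually_elim
    case (elim s)
    have "(f has_field_derivative \<mu>' s / \<mu> s + of_real a) (at s)"
      unfolding f_def using elim \<mu>0_pos
      by (auto intro!: derivative_eq_intros d1 simp: field_simps)
    then show ?case by (rule DERIV_imp_deriv)
  qed
  note ev_df = this
  have df\<eta>: "deriv f (of_real \<eta>) = of_real a"
    using f_deriv[of 1] DERIV_imp_deriv[OF saddle] by simp
  \<comment> \<open>The saddlepoint equation: the tilted mean of \<open>Y - a\<close> is 0. It also
    removes the square of \<open>\<mu>'\<close> from the quotient rule below.\<close>
  have \<mu>'0: "\<mu>' (of_real \<eta>) = 0"
    using eventually_nhds_x_imp_x[OF ev_df] df\<eta> \<mu>0_pos by (simp add: \<mu>_\<eta>)
  have "deriv (deriv f) (of_real \<eta>) = deriv (\<lambda>s. \<mu>' s / \<mu> s + of_real a) (of_real \<eta>)"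
    using ev_df by (intro deriv_cong_ev) auto
  also have "\<dots> = \<mu>'' (of_real \<eta>) / of_real \<mu>0"
  proof (rule DERIV_imp_deriv)
    have "\<mu> (of_real \<eta>) \<noteq> 0" using \<mu>0_pos by (simp add: \<mu>_\<eta>)
    then show "((\<lambda>s. \<mu>' s / \<mu> s + of_real a) has_field_derivative \<mu>'' (of_real \<eta>) / of_real \<mu>0) (at (of_real \<eta>))"
      using \<eta> \<mu>0_pos
      by (auto intro!: derivative_eq_intros d1 d2 simp: \<mu>'0 \<mu>_\<eta>)
  qed
  also have "\<mu>'' (of_real \<eta>) = of_real ?v"
    by (simp add: \<mu>''_def wmgf_of_real)
  finally have "complex_of_real K2 = of_real (?v / \<mu>0)"
    using f_deriv[of 2] by (simp add: K2_def numeral_2_eq_2)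
  then have K2_eq: "K2 = ?v / \<mu>0"
    by (simp only: of_real_eq_iff)
  have "?v \<noteq> 0"
  proof
    assume z: "?v = 0"
    have "integrable M (\<lambda>x. 1 * Z 0 x * Z 0 x * exp (\<eta> * Z 0 x))"
      by (rule integrable_exp_times[OF _ _ _ \<eta>]) (use intZ in auto)
    then have "AE x in M. Z 0 x * Z 0 x * exp (\<eta> * Z 0 x) = 0"
      using z by (subst (asm) integral_nonneg_eq_0_iff_AE) auto
    then show False using Z_not_AE_zero by simp
  qed
  moreover have "?v \<ge> 0"
    by (intro bochner_nonneg) auto
  ultimately have "?v > 0" by (simp add: less_le)
  then show K2_pos: "K2 > 0" unfolding K2_eq using \<mu>0_pos by simp

  \<comment> \<open>Removing the value and the linear part at the saddlepoint leaves a series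
    starting with \<open>K2 / 2 * w\<^sup>2\<close>, as Laplace's method requires.\<close>
  define \<kappa> where "\<kappa> = (\<lambda>w. f (of_real \<eta> + w) - of_real (K \<eta>) - of_real a * w)"
  define F where "F = fps_expansion f (of_real \<eta>) - fps_const (of_real (K \<eta>)) - fps_const (of_real a) * fps_X"
  have \<kappa>F: "\<kappa> has_fps_expansion F"
    unfolding \<kappa>_def F_def
    by (intro fps_expansion_intros analytic_at_imp_has_fps_expansion f_an)
  have fn: "fps_nth (fps_expansion f (of_real \<eta>)) k = of_real ((deriv ^^ k) K \<eta> / fact k)" for k
    unfolding fps_expansion_def by (simp add: f_deriv)
  have F: "fps_nth F 0 = 0" "fps_nth F 1 = 0" "fps_nth F 2 = of_real (K2 / 2)" "fps_nth F 3 = of_real (K3 / 6)"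
    "fps_nth F 4 = of_real (K4 / 24)"
    using DERIV_imp_deriv[OF saddle]
    by (simp_all add: F_def fn K2_def K3_def K4_def fact_numeral) (simp add: numeral_2_eq_2)?
  have shift: "\<forall>\<^sub>F w in nhds 0. P (of_real \<eta> + w)" if "\<forall>\<^sub>F s in nhds (of_real \<eta>). P s" for P :: "complex \<Rightarrow> bool"
  proof -
    have "filterlim (\<lambda>w. of_real \<eta> + w) (nhds (of_real \<eta> + 0)) (nhds (0::complex))"
      by (intro tendsto_intros filterlim_ident)
    then show ?thesis using that by (simp add: filterlim_iff)
  qed
  have rel\<kappa>: "\<forall>\<^sub>F w in nhds 0. \<mu> (of_real \<eta> + w) = of_real \<mu>0 * exp (\<kappa> w)"
    using shift[OF ev_good]
  proof eventually_elim
    case (elim w)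
    have "\<kappa> w = ln (\<mu> (of_real \<eta> + w) / of_real \<mu>0)"
      by (simp add: \<kappa>_def f_def K\<eta> algebra_simps)
    then show ?case using elim \<mu>0_pos by simp
  qed
  define R where "R = (\<lambda>s. of_real c0 + \<nu> s / \<mu> s)"
  have R_an: "R analytic_on {of_real \<eta>}"
    unfolding R_def by (intro analytic_intros analytic_\<mu> analytic_\<nu>) (use \<mu>0_pos in \<open>auto simp: \<mu>_\<eta>\<close>)
  have R_real: "\<forall>\<^sub>F e in nhds \<eta>. R (of_real e) = of_real (Kg e)"
    using Kg by eventually_elim (simp add: R_def \<mu>_real \<nu>_real)
  note R_deriv = higher_deriv_of_real[OF R_an R_real]
  define FR where "FR = fps_expansion R (of_real \<eta>) - fps_const (of_real c0)"
  have FR: "(\<lambda>w. R (of_real \<eta> + w) - of_real c0) has_fps_expansion FR"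
    unfolding FR_def by (intro fps_expansion_intros analytic_at_imp_has_fps_expansion R_an)
  have Rn: "fps_nth (fps_expansion R (of_real \<eta>)) k = of_real ((deriv ^^ k) Kg \<eta> / fact k)" for k
    unfolding fps_expansion_def by (simp add: R_deriv)
  have FRn: "fps_nth FR 0 = of_real (Kg \<eta> - c0)" "fps_nth FR 1 = of_real (deriv Kg \<eta>)"
    "fps_nth FR 2 = of_real (deriv (deriv Kg) \<eta> / 2)"
    by (simp_all add: FR_def Rn) (simp add: numeral_2_eq_2)?
  \<comment> \<open>For \<eta> nonzero the series of \<eta> + w is invertible. For \<eta> = 0 the
    zero mean of \<open>U 0\<close> kills the constant term of \<open>FR\<close>, and division by
    \<open>w\<close> is a shift of the series.\<close>
  obtain G H where GH: "G has_fps_expansion H" and HF: "H * (fps_const (of_real \<eta>) + fps_X) = FR"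
    and G: "\<And>w. of_real \<eta> + w \<noteq> 0 \<Longrightarrow> G w = (R (of_real \<eta> + w) - of_real c0) / (of_real \<eta> + w)"
  proof (cases "\<eta> = 0")
    case False
    have "(\<lambda>w. complex_of_real \<eta> + w) has_fps_expansion fps_const (complex_of_real \<eta>) + fps_X"
      by (intro fps_expansion_intros)
    then have "(\<lambda>w. inverse (complex_of_real \<eta> + w)) has_fps_expansion inverse (fps_const (complex_of_real \<eta>) + fps_X)"
      using False by (intro has_fps_expansion_inverse) auto
    then have "(\<lambda>w. (R (of_real \<eta> + w) - of_real c0) * inverse (complex_of_real \<eta> + w)) has_fps_expansion FR * inverse (fps_const (complex_of_real \<eta>) + fps_X)"
      by (intro has_fps_expansion_mult FR)
    moreover have "inverse (fps_const (complex_of_real \<eta>) + fps_X) * (fps_const (of_real \<eta>) + fps_X) = 1"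
      using False by (intro inverse_mult_eq_1) auto
    ultimately show thesis by (intro that[of _ "FR * inverse (fps_const (of_real \<eta>) + fps_X)"]) (auto simp: divide_inverse mult.assoc)
  next
    case True
    have "fps_nth FR 0 = 0"
      using eventually_nhds_x_imp_x[OF Kg] mean_U True by (simp add: FRn prob_space)
    \<comment> \<open>The zero series has subdegree 0 by convention and is therefore treated
      separately.\<close>
    then have sub: "FR = 0 \<or> 1 \<le> subdegree FR" using subdegree_geI[of FR 1] by force
    have shiftX: "fps_shift 1 FR * fps_X = FR"
      using \<open>fps_nth FR 0 = 0\<close> by (intro fps_ext) (simp add: fps_X_mult_right_nth)
    have fps: "(\<lambda>w. if w = 0 then fps_nth FR 1 else (R (of_real \<eta> + w) - of_real c0) / w ^ 1) has_fps_expansion fps_shift 1 FR"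
    proof (cases "FR = 0")
      case True
      then have "\<forall>\<^sub>F w in nhds 0. R (of_real \<eta> + w) - of_real c0 = 0" using FR by (simp add: has_fps_expansion_0_iff)
      then have "\<forall>\<^sub>F w in nhds 0. (if w = 0 then fps_nth FR 1 else (R (of_real \<eta> + w) - of_real c0) / w ^ 1) = 0"
        by eventually_elim (simp add: True)
      then show ?thesis unfolding True by (simp add: has_fps_expansion_0_iff True)
    next
      case False
      then show ?thesis using sub by (intro has_fps_expansion_shift FR) auto
    qed
    show thesis
    proof (rule that[OF fps])
      show "fps_shift 1 FR * (fps_const (of_real \<eta>) + fps_X) = FR" using shiftX True by simp
    qed (use True in auto)
  qed
  have relG: "\<forall>\<^sub>F w in nhds 0. G w * (of_real \<eta> + w) * \<mu> (of_real \<eta> + w) = \<nu> (of_real \<eta> + w)"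
    using shift[OF ev_good]
  proof eventually_elim
    case (elim w)
    show ?case
    proof (cases "of_real \<eta> + w = 0")
      case True
      \<comment> \<open>At the origin \<open>\<nu>\<close> equals the mean of \<open>U 0\<close>,
        which is 0, so the product form holds whatever value \<open>G\<close> takes there.\<close>
      then have "\<nu> (of_real \<eta> + w) = 0" using \<nu>_real[of 0] mean_U by simp
      then show ?thesis using True by simp
    next
      case False
      then show ?thesis using elim by (simp add: G R_def)
    qed
  qed
  obtain C where C: "\<And>n i. i < n \<Longrightarrow>
    norm (complex_of_real (sqrt (2 * pi * n * K2) * tail i n / \<mu>0 ^ n)
      - (fps_nth H 0 + laplace_coeff K2 F H / n)) \<le> C / (real n)\<^sup>2"
    by (rule weighted_tail_expansion[OF \<kappa>F GH F(1,2,3) K2_pos rel\<kappa> relG]) (rule that)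
  have Hn: "fps_nth (H * (fps_const (of_real \<eta>) + fps_X)) k = of_real \<eta> * fps_nth H k + (if k = 0 then 0 else fps_nth H (k - 1))" for k
    by (simp add: distrib_left fps_X_mult_right_nth mult.commute)
  have H: "of_real \<eta> * fps_nth H 0 = of_real (Kg \<eta> - c0)" "of_real \<eta> * fps_nth H 1 + fps_nth H 0 = of_real (deriv Kg \<eta>)"
    "of_real \<eta> * fps_nth H 2 + fps_nth H 1 = of_real (deriv (deriv Kg) \<eta> / 2)"
    using Hn[of 0] Hn[of 1] Hn[of 2] unfolding HF FRn by simp_all
  show ?expansion
    unfolding exp_K
    by (rule exI[of _ "fps_nth H 0"], rule exI[of _ "fps_nth H 1"], rule exI[of _ "fps_nth H 2"], rule exI[of _ C],
        intro conjI H allI impI, rule C[unfolded laplace_coeff_def F])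
qed

end

section \<open>Lower bounds for the tail probability and averaging over the summands\<close>

context centred_pairs begin

text \<open>Differentiating \<open>ln (mgf e) + e * a\<close> gives the tilted mean divided by
  \<open>mgf\<close>, plus \<open>a\<close>; comparison with the saddlepoint equation leaves tilted
  mean 0.\<close>

lemma tilted_mean_zero:
  fixes K :: "real \<Rightarrow> real" and a :: real
  assumes K: "\<forall>\<^sub>F e in nhds \<eta>. K e = ln (mgf e) + e * a"
    and saddle: "(K has_real_derivative a) (at \<eta>)"
  shows "expectation (\<lambda>x. Z 0 x * exp (\<eta> * Z 0 x)) = 0"
proof -
  define m where "m = (\<lambda>e. mgf e)"
  have "((\<lambda>e. \<integral>x. 1 * exp (e * Z 0 x) \<partial>M) has_real_derivative (\<integral>x. 1 * Z 0 x * exp (\<eta> * Z 0 x) \<partial>M)) (at \<eta>)"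
    by (rule has_real_derivative_mgf[where l=l and u=u]) (use int_exp_strip J in auto)
  then have m: "(m has_real_derivative expectation (\<lambda>x. Z 0 x * exp (\<eta> * Z 0 x))) (at \<eta>)"
    by (simp add: m_def)
  have "m \<eta> > 0" unfolding m_def by (rule mgf_pos[OF J_mem(1)])
  then have "((\<lambda>e. ln (m e) + e * a) has_real_derivative expectation (\<lambda>x. Z 0 x * exp (\<eta> * Z 0 x)) / m \<eta> + a) (at \<eta>)"
    by (auto intro!: derivative_eq_intros m)
  then have "(K has_real_derivative expectation (\<lambda>x. Z 0 x * exp (\<eta> * Z 0 x)) / m \<eta> + a) (at \<eta>)"
    using K by (subst DERIV_cong_ev[OF refl _ refl]) (auto simp: m_def)
  from DERIV_unique[OF this saddle] \<open>m \<eta> > 0\<close> show ?thesis by simp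
qed

lemma indep_Z: "indep_vars (\<lambda>_. borel) Z UNIV"
proof -
  have "indep_vars (\<lambda>_. borel) (\<lambda>i x. snd (U i x, Z i x)) UNIV"
    by (rule indep_vars_compose2[OF indep]) (simp add: borel_prod[symmetric])
  then show ?thesis by simp
qed

lemma distr_Z: "distr M borel (Z i) = distr M borel (Z 0)"
proof -
  have "distr M borel (Z i) = distr (distr M borel (\<lambda>x. (U i x, Z i x))) borel snd" for i
    by (subst distr_distr) (auto simp: comp_def borel_prod[symmetric])
  then show ?thesis using ident[of i] by simp
qed

text \<open>If \<open>Z 0\<close> were almost surely negative its tilted mean could not be 0. So
  each summand is nonnegative with a common positive probability, and by independence all of them
  are at once. This legitimises dividing by the tail probability.\<close>

lemma prob_T_nonneg_pos:
  assumes zero: "expectation (\<lambda>x. Z 0 x * exp (\<eta> * Z 0 x)) = 0"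
  shows "tail_prob n > 0"
proof (cases "n = 0")
  case True
  then show ?thesis by (simp add: T_def prob_space)
next
  case n: False
  have int: "integrable M (\<lambda>x. 1 * Z 0 x * exp (\<eta> * Z 0 x))"
    by (rule integrable_exp_times[where l=l and u=u]) (use int_exp_strip J in auto)
  have "prob (Z 0 -` {0..} \<inter> space M) \<noteq> 0"
  proof
    assume p0: "prob (Z 0 -` {0..} \<inter> space M) = 0"
    have "AE x in M. x \<notin> Z 0 -` {0..} \<inter> space M"
      by (rule AE_not_in) (use p0 in \<open>auto simp: null_sets_def emeasure_eq_measure\<close>)
    then have neg: "AE x in M. Z 0 x < 0"
      by (rule AE_mp) (auto intro!: AE_I2)
    then have "AE x in M. 0 \<le> - (Z 0 x * exp (\<eta> * Z 0 x))"
      by eventually_elim (simp add: mult_nonpos_nonneg)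
    moreover have "integrable M (\<lambda>x. - (Z 0 x * exp (\<eta> * Z 0 x)))" using int by simp
    moreover have "(\<integral>x. - (Z 0 x * exp (\<eta> * Z 0 x)) \<partial>M) = 0" using zero by simp
    ultimately have "AE x in M. - (Z 0 x * exp (\<eta> * Z 0 x)) = 0"
      by (subst (asm) integral_nonneg_eq_0_iff_AE)
    with neg have "AE x in M. False" by eventually_elim simp
    then show False by simp
  qed
  then have p: "prob (Z 0 -` {0..} \<inter> space M) > 0" by (simp add: zero_less_measure_iff)
  have "prob (Z i -` {0..} \<inter> space M) = prob (Z 0 -` {0..} \<inter> space M)" for i
    using arg_cong[OF distr_Z[of i], of "\<lambda>\<mu>. measure \<mu> {0..}"] by (simp add: measure_distr)
  then have "(\<Prod>i<n. prob (Z i -` {0..} \<inter> space M)) = (\<Prod>i<n. prob (Z 0 -` {0..} \<inter> space M))"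
    by (intro prod.cong refl)
  then have "(\<Prod>i<n. prob (Z i -` {0..} \<inter> space M)) = prob (Z 0 -` {0..} \<inter> space M) ^ n" by simp
  moreover have "prob (\<Inter>i\<in>{..<n}. Z i -` {0..} \<inter> space M) = (\<Prod>i<n. prob (Z i -` {0..} \<inter> space M))"
    by (rule indep_varsD[OF indep_Z]) (use n in auto)
  moreover have "prob (\<Inter>i\<in>{..<n}. Z i -` {0..} \<inter> space M) \<le> tail_prob n"
    using n by (intro finite_measure_mono) (auto simp: T_def intro!: sum_nonneg)
  ultimately show ?thesis using zero_less_power[OF p, of n] by linarith
qed

text \<open>For \<eta> = 0 the remainder of the final formula stands outside the factor
  \<open>1 / P n\<close>, so positivity does not suffice and a bound uniform in \<open>n\<close> is
  taken from the central limit theorem.\<close>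

lemma prob_T_nonneg_bounded_below:
  assumes \<eta>0: "\<eta> = 0" and zero: "expectation (Z 0) = 0"
  obtains p where "p > 0" "\<forall>\<^sub>F n in sequentially. p \<le> tail_prob n"
proof -
  have intZ: "integrable M (\<lambda>\<omega>. 1 * Z 0 \<omega> * exp (e * Z 0 \<omega>))" if "e \<in> {l<..<u}" for e
    by (rule integrable_exp_times[OF _ _ _ that]) (use int_exp_strip in auto)
  have "integrable M (\<lambda>\<omega>. 1 * Z 0 \<omega> * Z 0 \<omega> * exp (\<eta> * Z 0 \<omega>))"
    by (rule integrable_exp_times[where l=l and u=u]) (use intZ J in auto)
  then have sq0: "integrable M (\<lambda>\<omega>. (Z 0 \<omega>)\<^sup>2)" by (simp add: \<eta>0 power2_eq_square)
  define v where "v = expectation (\<lambda>\<omega>. (Z 0 \<omega>)\<^sup>2)"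
  have "v \<noteq> 0"
  proof
    assume "v = 0"
    then have "AE \<omega> in M. (Z 0 \<omega>)\<^sup>2 = 0"
      using sq0 by (subst (asm) v_def, subst (asm) integral_nonneg_eq_0_iff_AE) auto
    then show False using Z_not_AE_zero by simp
  qed
  then have v: "v > 0" by (simp add: v_def less_le)
  have expZ: "expectation (\<lambda>\<omega>. g (Z i \<omega>)) = expectation (\<lambda>\<omega>. g (Z 0 \<omega>))"
    and intgZ: "integrable M (\<lambda>\<omega>. g (Z i \<omega>)) \<longleftrightarrow> integrable M (\<lambda>\<omega>. g (Z 0 \<omega>))"
    if [measurable]: "g \<in> borel_measurable borel" for g :: "real \<Rightarrow> real" and i
    using integral_pair_eq[of "\<lambda>p. g (snd p)" i] integrable_pair_iff[of "\<lambda>p. g (snd p)" i] by (simp_all add: borel_prod[symmetric])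
  have mean: "expectation (Z i) = 0" for i using expZ[of "\<lambda>z. z" i] zero by simp
  have "weak_conv_m (\<lambda>n. distr M borel (\<lambda>\<omega>. (\<Sum>i<n. Z i \<omega>) / sqrt (n * (sqrt v)\<^sup>2))) std_normal_distribution"
  proof (rule central_limit_theorem_zero_mean[OF indep_Z mean])
    show "integrable M (\<lambda>\<omega>. (Z n \<omega>)\<^sup>2)" for n using intgZ[of "\<lambda>z. z\<^sup>2" n] sq0 by simp
    show "variance (Z n) = (sqrt v)\<^sup>2" for n
      using expZ[of "\<lambda>z. z\<^sup>2" n] v by (simp add: mean v_def)
    show "distr M borel (Z n) = distr M borel (Z 0)" for n by (rule distr_Z)
  qed (use v in simp)
  then have wc: "weak_conv_m (\<lambda>n. distr M borel (\<lambda>\<omega>. T n \<omega> / sqrt (n * v))) std_normal_distribution"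
    using v by (simp add: T_def)
  interpret N: real_distribution std_normal_distribution by (rule real_dist_normal_dist)
  have null: "measure std_normal_distribution {0} = 0"
    by (simp add: measure_def emeasure_density nn_integral_cmult_indicator)
  then have "isCont (cdf std_normal_distribution) 0" by (simp add: N.isCont_cdf)
  then have lim: "(\<lambda>n. cdf (distr M borel (\<lambda>\<omega>. T n \<omega> / sqrt (n * v))) 0) \<longlonglongrightarrow> cdf std_normal_distribution 0"
    using wc by (simp add: weak_conv_m_def weak_conv_def)
  define c where "c = cdf std_normal_distribution 0"
  \<comment> \<open>If \<open>c\<close> were 1 the positive normal density would force almost every
    real to be nonpositive, against the length of \<open>{0<..1}\<close>. Then
    \<open>(1 - c) / 2\<close> is a positive lower bound.\<close>
  have "c \<noteq> 1"
  proof
    assume "c = 1"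
    then have "N.prob {..0} = 1" by (simp add: c_def cdf_def)
    then have "AE x in std_normal_distribution. x \<in> {..0}" by (subst (asm) N.prob_eq_1) auto
    then have "AE x in lborel. 0 < ennreal (std_normal_density x) \<longrightarrow> x \<in> {..0}"
      by (subst (asm) AE_density) auto
    then have "AE x in lborel. (x::real) \<le> 0"
      by eventually_elim (simp add: normal_density_pos)
    then have "emeasure lborel {x::real. \<not> x \<le> 0} = 0"
      by (subst (asm) AE_iff_measurable[OF _ refl]) auto
    moreover have "emeasure lborel {0<..1::real} \<le> emeasure lborel {x::real. \<not> x \<le> 0}"
      by (intro emeasure_mono) auto
    ultimately show False by simp
  qed
  moreover have "c \<le> 1" unfolding c_def cdf_def by (rule N.prob_le_1)
  ultimately have c: "c < 1" by simp
  have "\<forall>\<^sub>F n in sequentially. cdf (distr M borel (\<lambda>\<omega>. T n \<omega> / sqrt (n * v))) 0 < (1 + c) / 2"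
    using lim c by (intro order_tendstoD(2)) (auto simp: c_def)
  then have "\<forall>\<^sub>F n in sequentially. (1 - c) / 2 \<le> tail_prob n"
    using eventually_gt_at_top[of 0]
  proof eventually_elim
    case (elim n)
    have "sqrt (n * v) > 0" using elim(2) v by simp
    then have "cdf (distr M borel (\<lambda>\<omega>. T n \<omega> / sqrt (n * v))) 0 = prob {\<omega> \<in> space M. T n \<omega> \<le> 0}"
      unfolding cdf_def
      by (subst measure_distr) (auto simp: divide_le_0_iff intro!: arg_cong[where f=prob])
    moreover have "prob (space M - {\<omega> \<in> space M. T n \<omega> \<le> 0}) = 1 - prob {\<omega> \<in> space M. T n \<omega> \<le> 0}"
      by (rule prob_compl) measurable
    moreover have "prob (space M - {\<omega> \<in> space M. T n \<omega> \<le> 0}) \<le> tail_prob n"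
      by (intro finite_measure_mono) auto
    ultimately show ?case using elim(1) by (simp add: field_simps)
  qed
  then show thesis using c by (intro that[of "(1 - c) / 2"]) auto
qed

text \<open>The expansion and its error bound do not depend on the index \<open>i\<close>, so they
  pass to the average over \<open>i\<close>; taking real parts returns to real numbers.\<close>

lemma mean_tail_expansion:
  assumes "\<And>i. i < n \<Longrightarrow> norm (complex_of_real (r * tail i n / e) - w) \<le> B" and n: "n > 0"
  shows "\<bar>r * ((\<Sum>i<n. tail i n) / n) / e - Re w\<bar> \<le> B"
proof -
  define E where "E = (\<lambda>i. tail i n)"
  have "\<bar>r * E i / e - Re w\<bar> \<le> B" if "i < n" for i
    using order_trans[OF abs_Re_le_cmod assms(1)[OF that]] by (simp add: E_def)
  then have "\<bar>\<Sum>i<n. (r * E i / e - Re w)\<bar> \<le> (\<Sum>i<n. B)"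
    by (intro order_trans[OF sum_abs] sum_mono) auto
  moreover have "(\<Sum>i<n. (r * E i / e - Re w)) = n * (r * ((\<Sum>i<n. E i) / n) / e - Re w)"
    using n by (simp add: sum_subtractf right_diff_distrib sum_distrib_left sum_divide_distrib)
  ultimately have "n * \<bar>r * ((\<Sum>i<n. E i) / n) / e - Re w\<bar> \<le> n * B"
    by (simp add: abs_mult)
  then show ?thesis using n by (simp add: E_def)
qed

end

section \<open>The saddlepoint expansion\<close>

lemma std_cumulant_sqrt:
  assumes "(deriv ^^ 2) K e > 0"
  shows "std_cumulant K r e = (deriv ^^ r) K e / sqrt ((deriv ^^ 2) K e) ^ r"
proof -
  have "((deriv ^^ 2) K e) powr (real r / 2) = (((deriv ^^ 2) K e) powr (1 / 2)) powr real r"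
    by (simp add: powr_powr)
  also have "\<dots> = sqrt ((deriv ^^ 2) K e) ^ r"
    using assms by (simp add: powr_half_sqrt powr_realpow)
  finally show ?thesis by (simp add: std_cumulant_def)
qed

text \<open>\<open>h0\<close>, \<open>h1\<close>, \<open>h2\<close> are the solution, by successive
  division by \<eta>, of the equations in \<open>cumulant_tail_expansion\<close>, and
  \<open>q\<close> stands for \<open>sqrt K2\<close>. The factor \<open>q\<close> on the right
  appears because Laplace's method normalises by \<open>sqrt (2 * pi * n * K2)\<close> and the
  statement by \<open>sqrt (2 * pi * n)\<close>.\<close>

lemma saddlepoint_coefficient_eq:
  fixes d p s \<eta> q K3 K4 :: real
  assumes \<eta>: "\<eta> \<noteq> 0" and q: "q \<noteq> 0"
  defines "h0 \<equiv> d / \<eta>" and "h1 \<equiv> (p - d / \<eta>) / \<eta>"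
  defines "h2 \<equiv> (s / 2 - h1) / \<eta>" and "z \<equiv> \<eta> * q"
  defines "r3 \<equiv> K3 / q ^ 3" and "r4 \<equiv> K4 / q ^ 4"
  shows "- h2 / q\<^sup>2 + 3 * (K3 / 6 * h1 + K4 / 24 * h0) / (q\<^sup>2)\<^sup>2 - 15 * (K3 / 6)\<^sup>2 * h0 / (2 * (q\<^sup>2) ^ 3)
    = q * (d / z * (r4 / 8 - 5 * r3\<^sup>2 / 24 - r3 / (2 * z) - 1 / z\<^sup>2) + 1 / (z * q) * (r3 / 2 + 1 / z) * p - 1 / (2 * z * q\<^sup>2) * s)"
  unfolding h2_def h1_def h0_def z_def r3_def r4_def
  using \<eta> q by (simp add: field_simps power2_eq_square power3_eq_cube power4_eq_xxxx)

theorem theorem2: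
  fixes M :: "'a measure" and X Y :: "nat \<Rightarrow> 'a \<Rightarrow> real"
    and f :: "real \<times> real \<Rightarrow> ennreal" and a eta :: real
  defines "KY \<equiv> cgf_Y M (X 0) (Y 0)"
      and "Kg \<equiv> cgf_gamma M (X 0) (Y 0)"
      and "EXm \<equiv> integral\<^sup>L M (X 0)"
      and "P \<equiv> (\<lambda>n. measure M {\<omega> \<in> space M. a \<le> sample_mean Y n \<omega>})"
      and "CE \<equiv> (\<lambda>n. cond_exp_ge M (sample_mean X n) (sample_mean Y n) a)"
  assumes prob: "prob_space M"
    and meas: "\<And>i. X i \<in> borel_measurable M" "\<And>i. Y i \<in> borel_measurable M"
    and indep: "prob_space.indep_vars M (\<lambda>_. borel) (\<lambda>i \<omega>. (X i \<omega>, Y i \<omega>)) UNIV"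
    and ident: "\<And>i. distr M borel (\<lambda>\<omega>. (X i \<omega>, Y i \<omega>)) = distr M borel (\<lambda>\<omega>. (X 0 \<omega>, Y 0 \<omega>))"
    and dens: "distributed M lborel (\<lambda>\<omega>. (X 0 \<omega>, Y 0 \<omega>)) f"
    and cgf_origin: "\<exists>\<epsilon>>0. \<forall>g e. \<bar>g\<bar> < \<epsilon> \<longrightarrow> \<bar>e\<bar> < \<epsilon> \<longrightarrow>
                        integrable M (\<lambda>\<omega>. exp (g * X 0 \<omega> + e * Y 0 \<omega>))"
    and cgf_saddle: "\<exists>\<delta>>0. \<forall>g e. \<bar>g\<bar> < \<delta> \<longrightarrow> \<bar>e - eta\<bar> < \<delta> \<longrightarrow>
                        integrable M (\<lambda>\<omega>. exp (g * X 0 \<omega> + e * Y 0 \<omega>))"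
    and saddle: "(KY has_real_derivative a) (at eta)"
    and analytic: "real_analytic_at Kg eta"
    and Ycont: "\<exists>fY::real \<Rightarrow> real. distributed M lborel (Y 0) (\<lambda>y. ennreal (fY y)) \<and> isCont fY a"
  shows
   "(eta \<noteq> 0 \<longrightarrow>
      (let K2 = deriv (deriv KY) eta;
           z = eta * sqrt K2;
           r3 = std_cumulant KY 3 eta;
           r4 = std_cumulant KY 4 eta;
           D = (Kg eta - Kg 0) / z
       in \<exists>R :: nat \<Rightarrow> real. R \<in> O(\<lambda>n. 1 / real n ^ 2) \<and>
          (\<forall>\<^sub>F n in sequentially.
             CE n = EXm + 1 / P n * exp (real n * (KY eta - eta * a)) / sqrt (2 * pi * real n) *
               (D + 1 / real n *
                  (D * (r4 / 8 - 5 * r3 ^ 2 / 24 - r3 / (2 * z) - 1 / z ^ 2)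
                   + 1 / (z * sqrt K2) * (r3 / 2 + 1 / z) * deriv Kg eta
                   - 1 / (2 * z * K2) * deriv (deriv Kg) eta)
                + R n))))
    \<and> (eta = 0 \<longrightarrow>
      (\<exists>R :: nat \<Rightarrow> real. R \<in> O(\<lambda>n. real n powr (-3/2)) \<and>
          (\<forall>\<^sub>F n in sequentially.
             CE n = EXm + deriv Kg 0 / (sqrt (2 * pi * real n * deriv (deriv KY) 0) * P n) + R n)))"
proof -
  interpret prob_space M by fact
  note [measurable] = meas
  obtain \<epsilon> where \<epsilon>: "\<epsilon> > 0" "\<And>g e. \<bar>g\<bar> < \<epsilon> \<Longrightarrow> \<bar>e\<bar> < \<epsilon> \<Longrightarrow> integrable M (\<lambda>x. exp (g * X 0 x + e * Y 0 x))"
    using cgf_origin by blast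
  obtain \<delta> where \<delta>: "\<delta> > 0" "\<And>g e. \<bar>g\<bar> < \<delta> \<Longrightarrow> \<bar>e - eta\<bar> < \<delta> \<Longrightarrow> integrable M (\<lambda>x. exp (g * X 0 x + e * Y 0 x))"
    using cgf_saddle by blast
  define J where "J = {eta - \<delta><..<eta + \<delta>} \<union> {- \<epsilon><..<\<epsilon>}"
  \<comment> \<open>One range of \<open>g\<close> valid near both the origin and the saddlepoint, so
    that differentiation at \<open>g = 0\<close> is possible for every \<open>e\<close> in
    \<open>J\<close>.\<close>
  define r where "r = min \<epsilon> \<delta>"
  have r: "r > 0" using \<epsilon> \<delta> by (simp add: r_def)
  have int: "integrable M (\<lambda>x. exp (e * Y 0 x) * exp (g * X 0 x))" if "e \<in> J" "g \<in> {- r<..<r}" for e g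
  proof -
    have "integrable M (\<lambda>x. exp (g * X 0 x + e * Y 0 x))"
      using that \<epsilon>(2)[of g e] \<delta>(2)[of g e] unfolding J_def r_def
      by (auto simp: abs_less_iff less_diff_eq algebra_simps)
    then show ?thesis by (simp add: exp_add mult.commute)
  qed
  have intY: "integrable M (\<lambda>x. exp (e * Y 0 x))" if "e \<in> J" for e
    using int[OF that, of 0] r by simp
  have intXY: "integrable M (\<lambda>x. exp (e * Y 0 x) * X 0 x)" if "e \<in> J" for e
  proof -
    \<comment> \<open>Here the roles are exchanged: \<open>exp (e * Y 0 x)\<close> is the weight,
      \<open>X 0\<close> the exponent variable, and the tilt is 0. The same exchange gives the
      derivative in \<open>g\<close> below.\<close>
    have "integrable M (\<lambda>x. exp (e * Y 0 x) * X 0 x * exp (0 * X 0 x))"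
      by (rule integrable_exp_times[where l="- r" and u=r]) (use int[OF that] r in auto)
    then show ?thesis by simp
  qed
  have J0: "0 \<in> J" "eta \<in> J" using \<epsilon> \<delta> by (auto simp: J_def)
  have intX: "integrable M (X 0)" using intXY[OF J0(1)] by simp
  define U where "U = (\<lambda>i x. X i x - EXm)"
  define Z where "Z = (\<lambda>i x. Y i x - a)"
  obtain fY where fY: "distributed M lborel (Y 0) (\<lambda>y. ennreal (fY y))" using Ycont by blast
  have densZ: "distributed M lborel (Z 0) (\<lambda>z. ennreal (fY ((z - - a) / 1)) / ennreal \<bar>1\<bar>)"
    using distributed_affine[OF fY, of 1 "- a"] by (simp add: Z_def)
  have expZ: "exp (e * Z 0 x) = exp (- (e * a)) * exp (e * Y 0 x)" for e x
    by (simp add: Z_def right_diff_distrib exp_diff exp_minus field_simps)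
  have expUZ: "U 0 x * exp (e * Z 0 x) = exp (- (e * a)) * (exp (e * Y 0 x) * X 0 x - EXm * exp (e * Y 0 x))" for e x
    unfolding expZ by (simp add: U_def algebra_simps)
  interpret centred_pairs M U Z J eta "eta - \<delta>" "eta + \<delta>" "- \<epsilon>" \<epsilon> "\<lambda>z. ennreal (fY ((z - - a) / 1)) / ennreal \<bar>1\<bar>"
  proof
    show "U i \<in> borel_measurable M" "Z i \<in> borel_measurable M" for i
      by (simp_all add: U_def Z_def)
    show "indep_vars (\<lambda>_. borel) (\<lambda>i x. (U i x, Z i x)) UNIV"
    proof -
      have "indep_vars (\<lambda>_. borel) (\<lambda>i x. (\<lambda>p. (fst p - EXm, snd p - a)) (X i x, Y i x)) UNIV"
        by (rule indep_vars_compose2[OF indep]) (simp add: borel_prod[symmetric])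
      then show ?thesis by (simp add: U_def Z_def)
    qed
    show "distr M borel (\<lambda>x. (U i x, Z i x)) = distr M borel (\<lambda>x. (U 0 x, Z 0 x))" for i
    proof -
      have "distr M borel (\<lambda>x. (U i x, Z i x)) = distr (distr M borel (\<lambda>x. (X i x, Y i x))) borel (\<lambda>p. (fst p - EXm, snd p - a))" for i
        by (subst distr_distr) (auto simp: comp_def borel_prod[symmetric] U_def Z_def)
      then show ?thesis using ident[of i] by simp
    qed
    show "J = {eta - \<delta><..<eta + \<delta>} \<union> {- \<epsilon><..<\<epsilon>}" by (rule J_def)
    show "eta \<in> {eta - \<delta><..<eta + \<delta>}" "0 \<in> {- \<epsilon><..<\<epsilon>}" using \<epsilon> \<delta> by auto
    show "integrable M (\<lambda>x. exp (e * Z 0 x))" if "e \<in> J" for e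
      unfolding expZ by (intro integrable_mult_right intY that)
    show "integrable M (\<lambda>x. U 0 x * exp (e * Z 0 x))" if "e \<in> J" for e
      unfolding expUZ by (intro integrable_mult_right Bochner_Integration.integrable_diff intY intXY that)
    show "expectation (U 0) = 0" using intX by (simp add: U_def prob_space EXm_def)
    show "distributed M lborel (Z 0) (\<lambda>z. ennreal (fY ((z - - a) / 1)) / ennreal \<bar>1\<bar>)" by (rule densZ)
  qed
  have KY_eq: "KY e = ln (mgf e) + e * a" if "e \<in> J" for e
  proof -
    have "mgf e = exp (- (e * a)) * expectation (\<lambda>x. exp (e * Y 0 x))"
      unfolding expZ by simp
    then have "expectation (\<lambda>x. exp (e * Y 0 x)) = exp (e * a) * mgf e"
      by (simp add: exp_minus field_simps)
    then show ?thesis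
      using mgf_pos[OF that] by (simp add: KY_def cgf_Y_def joint_cgf_def ln_mult)
  qed
  have Kg_eq: "Kg e = EXm + U_mgf e / mgf e" if e: "e \<in> J" for e
  proof -
    define m where "m = expectation (\<lambda>x. exp (e * Y 0 x))"
    define mX where "mX = expectation (\<lambda>x. exp (e * Y 0 x) * X 0 x)"
    have mZ: "mgf e = exp (- (e * a)) * m"
      unfolding expZ m_def by simp
    then have m: "m > 0" using mgf_pos[OF e] by (simp add: zero_less_mult_iff)
    have "((\<lambda>g. expectation (\<lambda>x. exp (e * Y 0 x) * exp (g * X 0 x))) has_real_derivative
        expectation (\<lambda>x. exp (e * Y 0 x) * X 0 x * exp (0 * X 0 x))) (at 0)"
      by (rule has_real_derivative_mgf[where l="- r" and u=r]) (use int[OF e] r in auto)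
    then have der: "((\<lambda>g. expectation (\<lambda>x. exp (e * Y 0 x) * exp (g * X 0 x))) has_real_derivative mX) (at 0)"
      by (simp add: mX_def)
    have "((\<lambda>g. ln (expectation (\<lambda>x. exp (e * Y 0 x) * exp (g * X 0 x)))) has_real_derivative mX / m) (at 0)"
      using m by (auto intro!: derivative_eq_intros der simp: m_def)
    moreover have "joint_cgf M (X 0) (Y 0) g e = ln (expectation (\<lambda>x. exp (e * Y 0 x) * exp (g * X 0 x)))" for g
      by (simp add: joint_cgf_def exp_add mult.commute)
    ultimately have "Kg e = mX / m" by (simp add: Kg_def cgf_gamma_def DERIV_imp_deriv)
    moreover have "U_mgf e = exp (- (e * a)) * (mX - EXm * m)"
      unfolding expUZ using intY[OF e] intXY[OF e] by (simp add: mX_def m_def)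
    ultimately show ?thesis using m unfolding mZ by (simp add: field_simps)
  qed
  have evJ: "\<forall>\<^sub>F e in nhds eta. e \<in> J"
    using \<delta> eventually_nhds_in_open[of "{eta - \<delta><..<eta + \<delta>}" eta] by (auto simp: J_def elim: eventually_mono)
  have K: "\<forall>\<^sub>F e in nhds eta. KY e = ln (mgf e) + e * a"
    using evJ by eventually_elim (rule KY_eq)
  have KG: "\<forall>\<^sub>F e in nhds eta. Kg e = EXm + U_mgf e / mgf e"
    using evJ by eventually_elim (rule Kg_eq)
  have Kg0: "Kg 0 = EXm" using Kg_eq[OF J0(1)] mean_U by simp
  define K2 where "K2 = deriv (deriv KY) eta"
  define K3 where "K3 = (deriv ^^ 3) KY eta"
  define K4 where "K4 = (deriv ^^ 4) KY eta"
  have K2: "K2 > 0" unfolding K2_def by (rule cumulant_tail_expansion(1)[OF K KG saddle])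
  obtain H0 H1 H2 C where H: "of_real eta * H0 = complex_of_real (Kg eta - EXm)"
      "of_real eta * H1 + H0 = complex_of_real (deriv Kg eta)"
      "of_real eta * H2 + H1 = complex_of_real (deriv (deriv Kg) eta / 2)"
    and C: "\<And>n i. i < n \<Longrightarrow>
           norm (complex_of_real (sqrt (2 * pi * n * K2) * tail i n
              / exp (n * (KY eta - eta * a)))
            - (H0 + (- H2 / of_real K2 + 3 * (of_real (K3 / 6) * H1 + of_real (K4 / 24) * H0) / of_real K2 ^ 2
                - 15 * of_real (K3 / 6) ^ 2 * H0 / (2 * of_real K2 ^ 3)) / n)) \<le> C / (real n)\<^sup>2"
    using cumulant_tail_expansion(2)[OF K KG saddle] unfolding K2_def[symmetric] K3_def[symmetric] K4_def[symmetric]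
    by blast
  define A where "A = - H2 / of_real K2 + 3 * (of_real (K3 / 6) * H1 + of_real (K4 / 24) * H0) / of_real K2 ^ 2
                - 15 * of_real (K3 / 6) ^ 2 * H0 / (2 * of_real K2 ^ 3)"
  define avg where "avg = (\<lambda>n. (\<Sum>i<n. tail i n) / n)"
  have bound: "\<bar>sqrt (2 * pi * n * K2) * avg n / exp (n * (KY eta - eta * a)) - (Re H0 + Re A / n)\<bar> \<le> C / (real n)\<^sup>2"
    if "n > 0" for n
    using mean_tail_expansion[OF C that] by (simp add: A_def avg_def)
  have event: "a \<le> sample_mean Y n x \<longleftrightarrow> 0 \<le> T n x" if "n > 0" for n x
    using that unfolding T_def by (simp add: sample_mean_def Z_def sum_subtractf field_simps)
  have P_eq: "P n = tail_prob n" if "n > 0" for n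
    by (simp add: P_def event[OF that])
  have P_pos: "P n > 0" if "n > 0" for n
    unfolding P_eq[OF that] by (rule prob_T_nonneg_pos[OF tilted_mean_zero[OF K saddle]])
  have CE_eq: "CE n = EXm + avg n / P n" if n: "n > 0" for n
  proof -
    have Ui: "integrable M (\<lambda>x. U i x * indicat_real {0..} (T n x))" for i
      by (rule bochner_bound[OF integrable_U[of i]]) (auto simp: abs_mult indicator_def)
    have ind: "integrable M (\<lambda>x. indicat_real {0..} (T n x))"
      by (rule integrable_const_bound[of _ 1]) auto
    have "(\<integral>x. sample_mean X n x * indicator {x. a \<le> sample_mean Y n x} x \<partial>M)
      = (\<integral>x. EXm * indicat_real {0..} (T n x) + (\<Sum>i<n. U i x * indicat_real {0..} (T n x)) / n \<partial>M)"
    proof (rule bochner_cong)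
      fix x
      have "sample_mean X n x = EXm + (\<Sum>i<n. U i x) / n"
        using n by (simp add: sample_mean_def U_def sum_subtractf field_simps)
      moreover have "indicat_real {x. a \<le> sample_mean Y n x} x = indicat_real {0..} (T n x)"
        using event[OF n] by (simp add: indicator_def)
      ultimately show "sample_mean X n x * indicator {x. a \<le> sample_mean Y n x} x
          = EXm * indicat_real {0..} (T n x) + (\<Sum>i<n. U i x * indicat_real {0..} (T n x)) / n"
        by (simp add: distrib_right sum_distrib_right)
    qed simp
    also have "\<dots> = EXm * (\<integral>x. indicat_real {0..} (T n x) \<partial>M) + avg n"
    proof -
      have "(\<integral>x. EXm * g x + (\<Sum>i<n. v i x) / n \<partial>M) = EXm * (\<integral>x. g x \<partial>M) + (\<Sum>i<n. \<integral>x. v i x \<partial>M) / n"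
        if "integrable M g" "\<And>i. integrable M (v i)" for g v
        using that by simp
      from this[OF ind Ui] show ?thesis unfolding avg_def .
    qed
    also have "(\<integral>x. indicat_real {0..} (T n x) \<partial>M) = (\<integral>x. indicat_real {x \<in> space M. 0 \<le> T n x} x \<partial>M)"
      by (rule bochner_cong) (auto simp: indicator_def)
    also have "\<dots> = P n" unfolding P_eq[OF n] by simp
    finally show ?thesis
      using P_pos[OF n] unfolding CE_def cond_exp_ge_def P_def[symmetric]
      by (simp add: P_def field_simps)
  qed
  define q where "q = sqrt K2"
  have q: "q > 0" "K2 = q\<^sup>2" using K2 by (auto simp: q_def)
  show ?thesis
  proof (intro conjI impI, goal_cases)
    case eta: 1
    have K2': "(deriv ^^ 2) KY eta = K2" by (simp add: K2_def numeral_2_eq_2)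
    have r3: "std_cumulant KY 3 eta = K3 / q ^ 3" and r4: "std_cumulant KY 4 eta = K4 / q ^ 4"
      using K2 by (simp_all add: std_cumulant_sqrt K2' q_def K3_def K4_def)
    define d where "d = Kg eta - Kg 0"
    define z where "z = eta * q"
    define D where "D = d / z"
    define B where "B = D * (K4 / q ^ 4 / 8 - 5 * (K3 / q ^ 3)\<^sup>2 / 24 - K3 / q ^ 3 / (2 * z) - 1 / z\<^sup>2)
        + 1 / (z * q) * (K3 / q ^ 3 / 2 + 1 / z) * deriv Kg eta - 1 / (2 * z * q\<^sup>2) * deriv (deriv Kg) eta"
    have H0: "H0 = of_real (d / eta)" using H(1) eta by (simp add: d_def Kg0 field_simps)
    have H1: "H1 = of_real ((deriv Kg eta - d / eta) / eta)" using H(2) eta unfolding H0 by (simp add: field_simps)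
    have H2: "H2 = of_real ((deriv (deriv Kg) eta / 2 - (deriv Kg eta - d / eta) / eta) / eta)"
      using H(3) eta unfolding H1 by (simp add: field_simps)
    have "Re A = q * B"
    proof -
      have "A = of_real (- ((deriv (deriv Kg) eta / 2 - (deriv Kg eta - d / eta) / eta) / eta) / q\<^sup>2
         + 3 * (K3 / 6 * ((deriv Kg eta - d / eta) / eta) + K4 / 24 * (d / eta)) / (q\<^sup>2)\<^sup>2 - 15 * (K3 / 6)\<^sup>2 * (d / eta) / (2 * (q\<^sup>2) ^ 3))"
        unfolding A_def H0 H1 H2 q(2) by simp
      also have "\<dots> = of_real (q * B)"
        unfolding B_def D_def z_def using q(1) eta by (subst saddlepoint_coefficient_eq) auto
      finally show ?thesis by simp
    qed
    have h0: "Re H0 = q * D" using q eta by (simp add: H0 D_def z_def)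
    \<comment> \<open>\<open>R\<close> is defined as the exact remainder, so the formula holds
      identically for \<open>n > 0\<close> and only its size has to be estimated.\<close>
    define R where "R = (\<lambda>n. sqrt (2 * pi * real n) * avg n / exp (n * (KY eta - eta * a)) - D - 1 / n * B)"
    have R_bound: "\<bar>R n\<bar> \<le> C / q * (1 / real n ^ 2)" if "n > 0" for n
    proof -
      have "sqrt (2 * pi * n * K2) = q * sqrt (2 * pi * n)" by (simp add: q_def real_sqrt_mult)
      then have "sqrt (2 * pi * n * K2) * avg n / exp (n * (KY eta - eta * a)) - (Re H0 + Re A / n) = q * R n"
        unfolding h0 \<open>Re A = q * B\<close> R_def by (simp add: algebra_simps)
      then have "q * \<bar>R n\<bar> \<le> C / (real n)\<^sup>2" using bound[OF that] q by (simp add: abs_mult)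
      then have "\<bar>R n\<bar> \<le> C / (real n)\<^sup>2 / q" by (subst pos_le_divide_eq[OF q(1)]) (simp only: mult.commute)
      then show ?thesis by (simp add: mult_ac)
    qed
    have "R \<in> O(\<lambda>n. 1 / real n ^ 2)"
      using R_bound by (intro bigoI[of _ "C / q"] eventually_mono[OF eventually_gt_at_top[of 0]]) auto
    moreover have "\<forall>\<^sub>F n in sequentially. CE n = EXm + 1 / P n * exp (real n * (KY eta - eta * a)) / sqrt (2 * pi * real n) * (D + 1 / real n * B + R n)"
      using eventually_gt_at_top[of 0]
    proof eventually_elim
      case (elim n)
      have "D + 1 / real n * B + R n = sqrt (2 * pi * real n) * avg n / exp (n * (KY eta - eta * a))" by (simp add: R_def)
      then show ?case unfolding CE_eq[OF elim] using elim by simp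
    qed
    ultimately show ?case
      unfolding Let_def r3 r4 K2_def[symmetric] q_def[symmetric] z_def[symmetric] d_def[symmetric] D_def[symmetric]
      by (intro exI[of _ R]) (simp add: B_def q(2))
  next
    case eta: 2
    have "KY 0 = 0" by (simp add: KY_def cgf_Y_def joint_cgf_def prob_space)
    \<comment> \<open>At \<eta> = 0 the exponential factor is 1, and the second equation in
      \<open>H\<close> reduces to \<open>H0 = deriv Kg 0\<close>.\<close>
    then have bound0: "\<bar>sqrt (2 * pi * n * K2) * avg n - (deriv Kg 0 + Re A / n)\<bar> \<le> C / (real n)\<^sup>2" if "n > 0" for n
      using bound[OF that] H(2) by (simp add: eta)
    have "expectation (Z 0) = 0" using tilted_mean_zero[OF K saddle] by (simp add: eta)
    from prob_T_nonneg_bounded_below[OF eta this] obtain p where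
      p: "p > 0" "\<forall>\<^sub>F n in sequentially. p \<le> tail_prob n" by blast
    define R where "R = (\<lambda>n. avg n / P n - deriv Kg 0 / (sqrt (2 * pi * real n * K2) * P n))"
    \<comment> \<open>The 1/n term \<open>Re A / n\<close> is absorbed into the error here; division
      by \<open>sqrt (2 * pi * n * K2)\<close> and by the lower bound \<open>p\<close> then gives
      order \<open>n powr (-3/2)\<close>.\<close>
    have "\<forall>\<^sub>F n in sequentially. norm (R n) \<le> (\<bar>Re A\<bar> + \<bar>C\<bar>) / (sqrt (2 * pi * K2) * p) * norm (real n powr (-3/2))"
      using p(2) eventually_gt_at_top[of 0]
    proof eventually_elim
      case (elim n)
      define s where "s = sqrt (2 * pi * n * K2)"
      have s: "s > 0" "s = sqrt (2 * pi * K2) * sqrt n" using elim K2 by (auto simp: s_def simp flip: real_sqrt_mult)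
      have "C / (real n)\<^sup>2 \<le> \<bar>C\<bar> / n"
      proof -
        have "C / (real n)\<^sup>2 \<le> \<bar>C\<bar> / (real n)\<^sup>2" by (intro divide_right_mono) auto
        also have "\<dots> \<le> \<bar>C\<bar> / n"
          using elim by (intro divide_left_mono) (auto simp: power2_eq_square)
        finally show ?thesis .
      qed
      moreover have "\<bar>Re A / n\<bar> = \<bar>Re A\<bar> / n" by simp
      ultimately have num: "\<bar>s * avg n - deriv Kg 0\<bar> \<le> (\<bar>Re A\<bar> + \<bar>C\<bar>) / n"
        using bound0[OF elim(2)] unfolding s_def[symmetric] add_divide_distrib by linarith
      have "R n = (s * avg n - deriv Kg 0) / (s * P n)"
        using s(1) P_pos[OF elim(2)] by (simp add: R_def s_def[symmetric] diff_divide_distrib)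
      then have "\<bar>R n\<bar> = \<bar>s * avg n - deriv Kg 0\<bar> / (s * P n)"
        using s(1) P_pos[OF elim(2)] by (simp add: abs_mult)
      also have "\<dots> \<le> (\<bar>Re A\<bar> + \<bar>C\<bar>) / n / (s * P n)"
        using s(1) P_pos[OF elim(2)] by (intro divide_right_mono num) auto
      also have "\<dots> \<le> (\<bar>Re A\<bar> + \<bar>C\<bar>) / n / (s * p)"
        using s(1) p(1) elim P_eq[OF elim(2)] by (intro divide_left_mono mult_left_mono) auto
      also have "\<dots> = (\<bar>Re A\<bar> + \<bar>C\<bar>) / (sqrt (2 * pi * K2) * p) * (1 / (n * sqrt n))"
        unfolding s(2) by (simp add: mult_ac)
      also have "1 / (n * sqrt n) = norm (real n powr (-3/2))"
      proof -
        have "real n powr (-3/2) = real n powr - (1 + 1/2)" by simp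
        also have "\<dots> = inverse (real n powr (1 + 1/2))" by (rule powr_minus)
        also have "real n powr (1 + 1/2) = real n powr 1 * real n powr (1/2)" by (rule powr_add)
        also have "\<dots> = real n * sqrt n" using powr_half_sqrt[of "real n"] by simp
        finally have "real n powr (-3/2) = inverse (real n * sqrt n)" .
        then show ?thesis
          unfolding real_norm_def abs_of_nonneg[OF powr_ge_zero] by (simp only: divide_inverse mult_1_left)
      qed
      finally show ?case by simp
    qed
    then have "R \<in> O(\<lambda>n. real n powr (-3/2))" by (rule bigoI)
    moreover have "\<forall>\<^sub>F n in sequentially. CE n = EXm + deriv Kg 0 / (sqrt (2 * pi * real n * deriv (deriv KY) 0) * P n) + R n"
      using eventually_gt_at_top[of 0]
    proof eventually_elim
      case (elim n)
      then show ?case unfolding CE_eq[OF elim] by (simp add: R_def K2_def eta)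
    qed
    ultimately show ?case
      by blast
  qed
qed

end
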